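(* Let $L$ be a finite-dimensional almost-reductive symmetric Leibniz algebra over a field of characteristic zero, with nilradical $N$ and Leibniz kernel $I$. If every almost-algebraic subalgebra of the Lie algebra $L/I$ is $\phi$-free, then $\phi(L)=N^2=I$ and $L$ is an $E$-algebra.
   Context: A (right) Leibniz algebra over a field $F$ is an $F$-vector space with a bilinear product $[\cdot,\cdot]$ satisfying $[x,[y,z]]=[[x,y],z]-[[x,z],y]$ for all $x,y,z$; a left Leibniz algebra satisfies $[x,[y,z]]=[[x,y],z]+[y,[x,z]]$. A symmetric Leibniz algebra is one that is both right and left Leibniz and satisfies $[[x,y],[x,y]]=0$ for all $x,y$. The Leibniz kernel of $L$ is $I=\mathrm{span}\{x^2: x\in L\}$ with $x^2=[x,x]$; it is an ideal and $L/I$ is a Lie algebra. With $M^1=M$, $M^{k+1}=[M^k,M]$, $M$ is nilpotent if $M^n=0$ for some $n$; the nilradical $N(L)$ is the largest nilpotent ideal of $L$, and $N^2=[N,N]$. The Frattini ideal $\phi(M)$ is the largest ideal of $M$ contained in all maximal subalgebras of $M$; $M$ is $\phi$-free if $\phi(M)=0$. $L$ is an $E$-algebra if $\phi(B)\leq\phi(L)$ for every subalgebra $B$ of $L$. Almost reductive: $L$ is almost reductive if $L=N(L)\dot{+}\Sigma$ (vector space direct sum) where $\Sigma$ is a subalgebra of $L$ that is a Lie algebra and $N(L)$ is a completely reducible $\Sigma$-bimodule, i.e. $N(L)$ is a direct sum of subspaces $A$ with $[A,\Sigma]\subseteq A$, $[\Sigma,A]\subseteq A$, each irreducible with respect to these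 left and right actions. Almost algebraic: a linear Lie algebra $\mathfrak g\leq \mathrm{gl}(V)$ is almost algebraic if it contains the semisimple and nilpotent Jordan components of each of its elements; an abstract Lie algebra $\mathfrak g$ is almost algebraic if $\mathrm{ad}\,\mathfrak g\leq \mathrm{gl}(\mathfrak g)$ is almost algebraic. *)

theory Defs
  imports "Jordan_Normal_Form.VS_Connect" "HOL-Algebra.QuotRing"
begin

text \<open>
  An algebra over the field \<open>'f\<close> is a \<^typ>\<open>('f, 'a) module\<close> record whose field
  \<^const>\<open>monoid.mult\<close> is the product \<open>[x, y]\<close>; the field \<^const>\<open>monoid.one\<close> of that record
  plays no role. A subalgebra or ideal \<open>B\<close> is a subset of the carrier, and as an algebra in its
  own right it is \<open>L\<lparr>carrier := B\<rparr>\<close>.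
\<close>

locale bracket_algebra =
  vectorspace "class_ring :: 'f::field ring" L
  for L :: "('f::field, 'a, 'm) module_scheme" (structure) +
  assumes bracket_closed: "\<lbrakk>x \<in> carrier L; y \<in> carrier L\<rbrakk> \<Longrightarrow> x \<otimes> y \<in> carrier L"
    and bracket_add_left:
      "\<lbrakk>x \<in> carrier L; y \<in> carrier L; z \<in> carrier L\<rbrakk> \<Longrightarrow> (x \<oplus> y) \<otimes> z = x \<otimes> z \<oplus> y \<otimes> z"
    and bracket_add_right:
      "\<lbrakk>x \<in> carrier L; y \<in> carrier L; z \<in> carrier L\<rbrakk> \<Longrightarrow> x \<otimes> (y \<oplus> z) = x \<otimes> y \<oplus> x \<otimes> z"
    and bracket_smult_left:
      "\<lbrakk>x \<in> carrier L; y \<in> carrier L\<rbrakk> \<Longrightarrow> (c \<odot> x) \<otimes> y = c \<odot> (x \<otimes> y)"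
    and bracket_smult_right:
      "\<lbrakk>x \<in> carrier L; y \<in> carrier L\<rbrakk> \<Longrightarrow> x \<otimes> (c \<odot> y) = c \<odot> (x \<otimes> y)"

locale right_leibniz_algebra = bracket_algebra +
  assumes right_leibniz:
    "\<lbrakk>x \<in> carrier L; y \<in> carrier L; z \<in> carrier L\<rbrakk>
      \<Longrightarrow> x \<otimes> (y \<otimes> z) = ((x \<otimes> y) \<otimes> z) \<ominus> ((x \<otimes> z) \<otimes> y)"

locale left_leibniz_algebra = bracket_algebra +
  assumes left_leibniz:
    "\<lbrakk>x \<in> carrier L; y \<in> carrier L; z \<in> carrier L\<rbrakk>
      \<Longrightarrow> x \<otimes> (y \<otimes> z) = ((x \<otimes> y) \<otimes> z) \<oplus> (y \<otimes> (x \<otimes> z))"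

locale symmetric_leibniz_algebra = right_leibniz_algebra + left_leibniz_algebra +
  assumes bracket_square_zero:
    "\<lbrakk>x \<in> carrier L; y \<in> carrier L\<rbrakk> \<Longrightarrow> (x \<otimes> y) \<otimes> (x \<otimes> y) = \<zero>"

locale lie_algebra = bracket_algebra +
  assumes alternating: "x \<in> carrier L \<Longrightarrow> x \<otimes> x = \<zero>"
    and jacobi:
      "\<lbrakk>x \<in> carrier L; y \<in> carrier L; z \<in> carrier L\<rbrakk>
        \<Longrightarrow> x \<otimes> (y \<otimes> z) \<oplus> y \<otimes> (z \<otimes> x) \<oplus> z \<otimes> (x \<otimes> y) = \<zero>"


abbreviation lin_subspace :: "('f::field, 'a, 'm) module_scheme \<Rightarrow> 'a set \<Rightarrow> bool" where
  "lin_subspace L W \<equiv> VectorSpace.subspace class_ring W L"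

abbreviation lin_span :: "('f::field, 'a, 'm) module_scheme \<Rightarrow> 'a set \<Rightarrow> 'a set" where
  "lin_span L S \<equiv> LinearCombinations.module.span class_ring L S"

definition is_subalgebra :: "('f::field, 'a, 'm) module_scheme \<Rightarrow> 'a set \<Rightarrow> bool" where
  "is_subalgebra L B \<longleftrightarrow> lin_subspace L B \<and> (\<forall>x\<in>B. \<forall>y\<in>B. x \<otimes>\<^bsub>L\<^esub> y \<in> B)"

definition is_ideal :: "('f::field, 'a, 'm) module_scheme \<Rightarrow> 'a set \<Rightarrow> bool" where
  "is_ideal L J \<longleftrightarrow>
    lin_subspace L J \<and> (\<forall>x\<in>J. \<forall>y\<in>carrier L. x \<otimes>\<^bsub>L\<^esub> y \<in> J \<and> y \<otimes>\<^bsub>L\<^esub> x \<in> J)"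

definition bracket_span :: "('f::field, 'a, 'm) module_scheme \<Rightarrow> 'a set \<Rightarrow> 'a set \<Rightarrow> 'a set" where
  "bracket_span L A B = lin_span L {a \<otimes>\<^bsub>L\<^esub> b | a b. a \<in> A \<and> b \<in> B}"

text \<open>\<open>lower_central M k\<close> is the term \<open>M\<^sup>k\<^sup>+\<^sup>1\<close> of the series \<open>M\<^sup>1 = M\<close>, \<open>M\<^sup>k\<^sup>+\<^sup>1 = [M\<^sup>k, M]\<close>.\<close>

primrec lower_central :: "('f::field, 'a, 'm) module_scheme \<Rightarrow> nat \<Rightarrow> 'a set" where
  "lower_central M 0 = carrier M"
| "lower_central M (Suc k) = bracket_span M (lower_central M k) (carrier M)"

definition nilpotent_algebra :: "('f::field, 'a, 'm) module_scheme \<Rightarrow> bool" where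
  "nilpotent_algebra M \<longleftrightarrow> (\<exists>k. lower_central M k = {\<zero>\<^bsub>M\<^esub>})"

definition nilradical :: "('f::field, 'a, 'm) module_scheme \<Rightarrow> 'a set" where
  "nilradical L = (GREATEST J. is_ideal L J \<and> nilpotent_algebra (L\<lparr>carrier := J\<rparr>))"

definition leibniz_kernel :: "('f::field, 'a, 'm) module_scheme \<Rightarrow> 'a set" where
  "leibniz_kernel L = lin_span L {x \<otimes>\<^bsub>L\<^esub> x | x. x \<in> carrier L}"

definition maximal_subalgebra :: "('f::field, 'a, 'm) module_scheme \<Rightarrow> 'a set \<Rightarrow> bool" where
  "maximal_subalgebra M S \<longleftrightarrow> is_subalgebra M S \<and> S \<noteq> carrier M \<and>
    (\<forall>T. is_subalgebra M T \<and> S \<subseteq> T \<longrightarrow> T = S \<or> T = carrier M)"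

definition frattini_ideal :: "('f::field, 'a, 'm) module_scheme \<Rightarrow> 'a set" where
  "frattini_ideal M = (GREATEST J. is_ideal M J \<and> (\<forall>S. maximal_subalgebra M S \<longrightarrow> J \<subseteq> S))"

definition phi_free :: "('f::field, 'a, 'm) module_scheme \<Rightarrow> bool" where
  "phi_free M \<longleftrightarrow> frattini_ideal M = {\<zero>\<^bsub>M\<^esub>}"

definition E_algebra :: "('f::field, 'a, 'm) module_scheme \<Rightarrow> bool" where
  "E_algebra L \<longleftrightarrow>
    (\<forall>B. is_subalgebra L B \<longrightarrow> frattini_ideal (L\<lparr>carrier := B\<rparr>) \<subseteq> frattini_ideal L)"

text \<open>
  \<^const>\<open>FactRing\<close> is defined for arbitrary ring records, so it also supplies the cosets, their sum
  and their product for a nonassociative algebra modulo a two-sided ideal.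
\<close>

definition quotient_algebra :: "('f::field, 'a, 'm) module_scheme \<Rightarrow> 'a set \<Rightarrow> ('f, 'a set) module" where
  "quotient_algebra L J =
    ring.extend (L Quot J) (module.fields (\<lambda>c A. \<Union>a\<in>A. J +>\<^bsub>L\<^esub> (c \<odot>\<^bsub>L\<^esub> a)))"


definition sub_bimodule :: "('f::field, 'a, 'm) module_scheme \<Rightarrow> 'a set \<Rightarrow> 'a set \<Rightarrow> bool" where
  "sub_bimodule L \<Sigma> A \<longleftrightarrow>
    lin_subspace L A \<and> (\<forall>a\<in>A. \<forall>s\<in>\<Sigma>. a \<otimes>\<^bsub>L\<^esub> s \<in> A \<and> s \<otimes>\<^bsub>L\<^esub> a \<in> A)"

definition irreducible_bimodule :: "('f::field, 'a, 'm) module_scheme \<Rightarrow> 'a set \<Rightarrow> 'a set \<Rightarrow> bool" where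
  "irreducible_bimodule L \<Sigma> A \<longleftrightarrow> sub_bimodule L \<Sigma> A \<and> A \<noteq> {\<zero>\<^bsub>L\<^esub>} \<and>
    (\<forall>B. sub_bimodule L \<Sigma> B \<and> B \<subseteq> A \<longrightarrow> B = {\<zero>\<^bsub>L\<^esub>} \<or> B = A)"

text \<open>
  The family of summands may be taken to be a set, as no nonzero subspace can occur twice in a
  direct sum inside \<open>L\<close>. The last conjunct says that the sum of the family is direct.
\<close>

definition completely_reducible_bimodule ::
    "('f::field, 'a, 'm) module_scheme \<Rightarrow> 'a set \<Rightarrow> 'a set \<Rightarrow> bool" where
  "completely_reducible_bimodule L \<Sigma> V \<longleftrightarrow> (\<exists>\<A>.
    (\<forall>A\<in>\<A>. irreducible_bimodule L \<Sigma> A) \<and>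
    lin_span L (\<Union>\<A>) = V \<and>
    (\<forall>A\<in>\<A>. A \<inter> lin_span L (\<Union>(\<A> - {A})) = {\<zero>\<^bsub>L\<^esub>}))"

definition almost_reductive :: "('f::field, 'a, 'm) module_scheme \<Rightarrow> bool" where
  "almost_reductive L \<longleftrightarrow> (\<exists>\<Sigma>.
    is_subalgebra L \<Sigma> \<and> lie_algebra (L\<lparr>carrier := \<Sigma>\<rparr>) \<and>
    nilradical L <+>\<^bsub>L\<^esub> \<Sigma> = carrier L \<and> nilradical L \<inter> \<Sigma> = {\<zero>\<^bsub>L\<^esub>} \<and>
    completely_reducible_bimodule L \<Sigma> (nilradical L))"


text \<open>
  Linear endomorphisms of \<open>V\<close> are taken to be \<^const>\<open>undefined\<close> off the carrier, so that equality
  of functions is equality of endomorphisms.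
\<close>

definition endomorphisms :: "('f::field, 'v, 'm) module_scheme \<Rightarrow> ('v \<Rightarrow> 'v) set" where
  "endomorphisms V = LinearCombinations.module_hom class_ring V V \<inter> extensional (carrier V)"

definition invariant_subspace ::
    "('f::field, 'v, 'm) module_scheme \<Rightarrow> ('v \<Rightarrow> 'v) \<Rightarrow> 'v set \<Rightarrow> bool" where
  "invariant_subspace V f W \<longleftrightarrow> lin_subspace V W \<and> f ` W \<subseteq> W"

definition semisimple_endo :: "('f::field, 'v, 'm) module_scheme \<Rightarrow> ('v \<Rightarrow> 'v) \<Rightarrow> bool" where
  "semisimple_endo V f \<longleftrightarrow> f \<in> endomorphisms V \<and>
    (\<forall>W. invariant_subspace V f W \<longrightarrow>
      (\<exists>W'. invariant_subspace V f W' \<and> W <+>\<^bsub>V\<^esub> W' = carrier V \<and> W \<inter> W' = {\<zero>\<^bsub>V\<^esub>}))"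

definition nilpotent_endo :: "('f::field, 'v, 'm) module_scheme \<Rightarrow> ('v \<Rightarrow> 'v) \<Rightarrow> bool" where
  "nilpotent_endo V f \<longleftrightarrow> f \<in> endomorphisms V \<and> (\<exists>k. \<forall>x\<in>carrier V. (f ^^ k) x = \<zero>\<^bsub>V\<^esub>)"

definition jordan_components ::
    "('f::field, 'v, 'm) module_scheme \<Rightarrow> ('v \<Rightarrow> 'v) \<Rightarrow> ('v \<Rightarrow> 'v) \<Rightarrow> ('v \<Rightarrow> 'v) \<Rightarrow> bool" where
  "jordan_components V f s n \<longleftrightarrow> semisimple_endo V s \<and> nilpotent_endo V n \<and>
    (\<forall>x\<in>carrier V. f x = s x \<oplus>\<^bsub>V\<^esub> n x \<and> s (n x) = n (s x))"

text \<open>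
  In finite dimension over a perfect field the Jordan components exist and are unique, so the
  existential quantifier below says that they lie in \<open>\<gg>\<close>.
\<close>

definition almost_algebraic_linear ::
    "('f::field, 'v, 'm) module_scheme \<Rightarrow> ('v \<Rightarrow> 'v) set \<Rightarrow> bool" where
  "almost_algebraic_linear V \<gg> \<longleftrightarrow>
    \<gg> \<subseteq> endomorphisms V \<and> (\<forall>f\<in>\<gg>. \<exists>s\<in>\<gg>. \<exists>n\<in>\<gg>. jordan_components V f s n)"

definition ad :: "('f::field, 'a, 'm) module_scheme \<Rightarrow> 'a \<Rightarrow> 'a \<Rightarrow> 'a" where
  "ad M x = (\<lambda>y\<in>carrier M. x \<otimes>\<^bsub>M\<^esub> y)"

text \<open>To be applied to Lie algebras \<open>M\<close> only, for which \<open>ad M\<close> is a Lie subalgebra of \<open>gl(M)\<close>.\<close>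

definition almost_algebraic :: "('f::field, 'a, 'm) module_scheme \<Rightarrow> bool" where
  "almost_algebraic M \<longleftrightarrow> almost_algebraic_linear M (ad M ` carrier M)"

end

theory Submission
  imports Defs "HOL-Algebra.Algebraic_Closure_Type"
begin

hide_const (open) Polynomials.degree

text \<open>
  Put \<open>G = L/I\<close>. Squares annihilate \<open>L\<close> from both sides, so a maximal subalgebra that misses some
  square contains \<open>L\<^sup>2 \<ge> I\<close>; hence \<open>I \<le> \<phi>(L)\<close>. What remains is that every subalgebra \<open>U\<close> of \<open>G\<close> is
  \<open>\<phi>\<close>-free and that \<open>N\<^sup>2 = I\<close>.

  A nilpotent subalgebra of \<open>G\<close> is almost algebraic, hence \<open>\<phi>\<close>-free, hence abelian. Therefore
  \<open>N\<^sup>2 \<le> I\<close>, and \<open>K = \<phi>(U)\<close>, which is nilpotent by the theorems of Fitting and Engel, is abelian. The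
  normaliser \<open>M\<close> of \<open>K\<close> in \<open>G\<close> is almost algebraic, because the Jordan components of \<open>ad x\<close>
  are polynomials in \<open>ad x\<close> and are inner (below). So \<open>M\<close> is \<open>\<phi>\<close>-free and \<open>K\<close> has
  a complement \<open>C\<close> in \<open>M\<close>. If \<open>K \<noteq> 0\<close>, then \<open>C \<inter> U\<close> lies in a maximal subalgebra of \<open>U\<close>, which
  contains \<open>K\<close> as well and thus all of \<open>U\<close>, a contradiction.

  The Jordan components are inner since \<open>G = A + S\<close> with \<open>A = N/I\<close> an abelian ideal that is a
  completely reducible \<open>S\<close>-module: Cartan's criterion for the trace form of \<open>ad\<close> splits \<open>S\<close> into its
  centre and \<open>[S, S]\<close>, on which the form is nondegenerate, and an element \<open>a + s\<close> is conjugate under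
  some \<open>1 + ad c\<close> with \<open>c \<in> A\<close> to an element whose \<open>A\<close>-part commutes with the semisimple part of \<open>s\<close>.

  For \<open>I \<le> N\<^sup>2\<close>, write \<open>x = z + c + s\<close> with \<open>z\<close> in the part \<open>Z\<close> of \<open>N\<close> that annihilates \<open>L\<close>, \<open>c\<close> in a
  complementary bimodule \<open>C\<close> and \<open>s \<in> \<Sigma>\<close>. Then \<open>[c, s] + [s, c] \<in> C \<inter> I = 0\<close>, so \<open>[x, x] = [c, c]\<close>.
\<close>

subsection \<open>Separable polynomials and Newton iteration\<close>

text \<open>An arbitrary subalgebra U need not be almost algebraic, so the hypothesis says nothing
  about U itself. The normaliser of \<phi>(U) is the substitute: it contains U, and membership only
  asks that a subspace be stable under ad x, a condition that passes to polynomials in ad x.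

  The ground field need not contain eigenvalues. Semisimplicity therefore appears as annihilation by
  a polynomial prime to its derivative, a condition without eigenvalues that restricts to every
  invariant subspace and yields complements there. Eigenvalues serve for two statements, that the
  semisimple part of a derivation is a derivation and that a trace condition forces nilpotency; both
  are proved over the algebraic closure and carried back by comparing coordinates or by linear
  functionals.

  That the components of an element of S are inner cannot be taken from semisimplicity of S, as S is
  only reductive and its centre may act on N. The Killing form handles [S, S], and the complete
  reducibility of N handles the rest.\<close>

lemma poly_bezout:
  fixes p q :: "'f::field poly"
  shows "\<exists>a b. a * p + b * q dvd p \<and> a * p + b * q dvd q"
\<comment> \<open>Euclid's algorithm, passing to (q, p mod q). \<open>Suc (degree q)\<close> puts a
  zero remainder strictly below a nonzero constant q.\<close>
proof (induction "if q = 0 then 0 else Suc (degree q)" arbitrary: p q rule: less_induct)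
  case less
  show ?case
  proof (cases "q = 0")
    case True
    then show ?thesis by (intro exI[of _ 1] exI[of _ 0]) auto
  next
    case False
    have "(if p mod q = 0 then 0 else Suc (degree (p mod q))) < (if q = 0 then 0 else Suc (degree q))"
      using False degree_mod_less[of q p] by auto
    from less[OF this] obtain a b where
      ab: "a * q + b * (p mod q) dvd q" "a * q + b * (p mod q) dvd p mod q" by blast
    have eq: "b * p + (a - b * (p div q)) * q = a * q + b * (p mod q)"
      by (simp add: algebra_simps minus_div_mult_eq_mod[symmetric])
    have "a * q + b * (p mod q) dvd p"
      using ab by (metis dvd_mod_iff)
    then show ?thesis using ab(1) eq by (intro exI[of _ b] exI[of _ "a - b * (p div q)"]) simp
  qed
qed

text \<open>Among the polynomials with a power divisible by \<chi>, q has least degree. If q had a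
  nonconstant common factor with its derivative, a minimal such factor \<pi> would be a repeated
  factor of q, as \<pi> cannot divide its own derivative in characteristic 0. Then q / \<pi> still
  has a power divisible by \<chi>, against minimality.\<close>

lemma poly_separable_radical:
  fixes \<chi> :: "'f::field_char_0 poly"
  assumes "\<chi> \<noteq> 0"
  shows "\<exists>q m r s. \<chi> dvd q ^ m \<and> r * q + s * pderiv q = 1"
proof -
  have "\<chi> \<noteq> 0 \<and> (\<exists>m. \<chi> dvd \<chi> ^ m)"
    using assms by (intro conjI exI[of _ 1]) auto
  from ex_has_least_nat[where P = "\<lambda>q. q \<noteq> 0 \<and> (\<exists>m. \<chi> dvd q ^ m)" and m = degree, OF this]
  obtain q where q: "q \<noteq> 0" "\<exists>m. \<chi> dvd q ^ m"
    and qmin: "\<And>p. p \<noteq> 0 \<and> (\<exists>m. \<chi> dvd p ^ m) \<Longrightarrow> degree q \<le> degree p"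
    by blast
  obtain m where m: "\<chi> dvd q ^ m" using q by blast
  obtain a b where ab: "a * q + b * pderiv q dvd q" "a * q + b * pderiv q dvd pderiv q"
    using poly_bezout by blast
  define d where "d = a * q + b * pderiv q"
  have dq: "d dvd q" "d dvd pderiv q" using ab by (auto simp: d_def)
  then have d0: "d \<noteq> 0" using q by auto
  show ?thesis
  proof (cases "degree d = 0")
    case True
    then obtain c where c: "d = [:c:]" by (meson degree_0_id degree_eq_zeroE)
    with d0 have "c \<noteq> 0" by auto
    have "[:inverse c:] * a * q + [:inverse c:] * b * pderiv q = [:inverse c:] * d"
      by (simp add: d_def algebra_simps)
    also have "\<dots> = 1" using c \<open>c \<noteq> 0\<close> by (simp add: one_pCons)
    finally show ?thesis using m by blast
  next
    case False
    then have "d dvd d \<and> degree d > 0" by simp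
    \<comment> \<open>A nonconstant divisor of least degree takes the place of an irreducible
      factor; \<open>prime\<close> is Euclid's lemma for it.\<close>
    from ex_has_least_nat[where P = "\<lambda>p. p dvd d \<and> degree p > 0" and m = degree, OF this]
    obtain \<pi> where pi: "\<pi> dvd d" "degree \<pi> > 0"
      and pimin: "\<And>p. p dvd d \<and> degree p > 0 \<Longrightarrow> degree \<pi> \<le> degree p"
      by blast
    have prime: "\<pi> dvd v" if "\<pi> dvd u * v" "\<not> \<pi> dvd u" for u v
    proof -
      obtain x y where xy: "x * \<pi> + y * u dvd \<pi>" "x * \<pi> + y * u dvd u"
        using poly_bezout by blast
      define g where "g = x * \<pi> + y * u"
      have "g \<noteq> 0" using xy pi by (auto simp: g_def)
      have "degree g = 0"
      proof (rule ccontr)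
        assume "degree g \<noteq> 0"
        then have "degree \<pi> \<le> degree g" using xy pi pimin by (metis dvd_trans g_def neq0_conv)
        obtain k where k: "\<pi> = g * k" using xy g_def by auto
        have "k \<noteq> 0" using k pi(2) by auto
        then have "degree k = 0" using \<open>degree \<pi> \<le> degree g\<close> \<open>g \<noteq> 0\<close>
          unfolding k by (simp add: degree_mult_eq)
        then have "\<pi> dvd g" using k
          using \<open>k \<noteq> 0\<close> by (metis dvd_mult_unit_iff dvd_refl is_unit_iff_degree)
        with xy that show False by (metis dvd_trans g_def)
      qed
      then have "g dvd 1" using \<open>g \<noteq> 0\<close> by (simp add: is_unit_iff_degree)
      then obtain h where "1 = g * h" by auto
      then have "v = g * h * v" by simp
      also have "\<dots> = h * (x * \<pi> * v + y * (u * v))"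
        by (simp add: g_def algebra_simps)
      finally have "v = h * (x * \<pi> * v + y * (u * v))" .
      with that show ?thesis by (metis dvd_add dvd_mult dvd_mult2 dvd_triv_right)
    qed
    obtain h where h: "q = \<pi> * h" using pi dq by (meson dvd_def dvd_trans)
    have h0: "h \<noteq> 0" "\<pi> \<noteq> 0" using h q by auto
    have "\<pi> dvd pderiv q" using pi dq by (meson dvd_trans)
    then have "\<pi> dvd pderiv \<pi> * h" unfolding h pderiv_mult
      by (metis add.commute dvd_add_right_iff dvd_triv_left mult.commute)
    moreover have "\<not> \<pi> dvd pderiv \<pi>"
      using pi dvd_imp_degree_le[of \<pi> "pderiv \<pi>"] degree_pderiv[of \<pi>] by (auto simp: pderiv_eq_0_iff)
    ultimately have "\<pi> dvd h" using prime by blast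
    then have "q dvd h ^ 2" using h by (simp add: power2_eq_square mult_dvd_mono)
    then have "q ^ m dvd (h ^ 2) ^ m" by (rule dvd_power_same)
    then have "\<chi> dvd h ^ (2 * m)" using m by (metis dvd_trans power_mult)
    then have "degree q \<le> degree h" using qmin h0 by blast
    moreover have "degree q = degree \<pi> + degree h" using h h0 by (simp add: degree_mult_eq)
    ultimately show ?thesis using pi by simp
  qed
qed

text \<open>Taylor's formula cut after the linear term; of the remainder only the factor
  \<open>h\<^sup>2\<close> matters.\<close>

lemma pcompose_add_taylor:
  fixes q :: "'f::field poly"
  shows "\<exists>w. pcompose q (a + h) = pcompose q a + h * pcompose (pderiv q) a + h\<^sup>2 * w"
proof (induction q)
  case 0
  then show ?case by (auto intro: exI[of _ 0])
next
  case (pCons c q)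
  then obtain w where w: "pcompose q (a + h) = pcompose q a + h * pcompose (pderiv q) a + h\<^sup>2 * w" by blast
  show ?case
    by (rule exI[of _ "pcompose (pderiv q) a + (a + h) * w"])
      (simp add: pcompose_pCons w pderiv_pCons pcompose_add algebra_simps power2_eq_square)
qed

text \<open>Newton's iteration for the equation q(P) = 0, q-adically, with starting value X. Instead
  of dividing by q'(P) it multiplies by s, the inverse of q' modulo q, so each round gains one power
  of q. All corrections are multiples of q, whence P stays congruent to X modulo q.\<close>

lemma poly_newton:
  fixes q :: "'f::field poly"
  assumes bez: "r * q + s * pderiv q = 1"
  shows "\<exists>P. q ^ m dvd pcompose q P \<and> q dvd P - [:0, 1:]"
proof (induction m)
  case 0
  show ?case by (rule exI[of _ "[:0, 1:]"]) simp
next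
  case (Suc m)
  show ?case
  \<comment> \<open>The first round keeps P = X: a correction by \<open>q ^ 0 * h\<close> would not
    be divisible by q.\<close>
  proof (cases "m = 0")
    case True
    then show ?thesis by (intro exI[of _ "[:0, 1:]"]) simp
  next
    case False
    from Suc obtain P where P: "q ^ m dvd pcompose q P" "q dvd P - [:0, 1:]" by blast
    obtain c where c: "pcompose q P = q ^ m * c" using P by auto
    obtain k where k: "P = [:0, 1:] + q * k" using P by (metis diff_add_cancel add.commute dvdE)
    obtain w where w: "pcompose (pderiv q) P = pderiv q + q * w"
      using pcompose_add_taylor[of "pderiv q" "[:0, 1:]" "q * k"] unfolding k
      by (metis (no_types, opaque_lifting) distrib_left mult.assoc pcompose_idR add.assoc power2_eq_square)
    define h where "h = - s * c"
    obtain w' where w': "pcompose q (P + q ^ m * h) = pcompose q P + q ^ m * h * pcompose (pderiv q) P + (q ^ m * h)\<^sup>2 * w'"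
      using pcompose_add_taylor by blast
    obtain m' where m': "m = Suc m'" using False by (cases m) auto
    have "pcompose q (P + q ^ m * h)
        = q ^ m * (c + h * pderiv q) + q ^ m * q * (h * w) + q ^ m * q ^ m * (h\<^sup>2 * w')"
      unfolding w' unfolding c w by (simp add: algebra_simps power2_eq_square)
    also have "c + h * pderiv q = c * (1 - s * pderiv q)" by (simp add: h_def algebra_simps)
    also have "1 - s * pderiv q = r * q" using bez by (simp add: algebra_simps)
    also have "q ^ m * (c * (r * q)) + q ^ m * q * (h * w) + q ^ m * q ^ m * (h\<^sup>2 * w')
       = q ^ Suc m * (c * r + h * w + q ^ m' * (h\<^sup>2 * w'))"
      by (simp add: algebra_simps m')
    finally have "q ^ Suc m dvd pcompose q (P + q ^ m * h)" by simp
    moreover have "q dvd (P - [:0, 1:]) + q ^ m * h"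
      using P(2) by (intro dvd_add) (simp_all add: m')
    then have "q dvd P + q ^ m * h - [:0, 1:]" by (simp add: algebra_simps)
    ultimately show ?thesis by blast
  qed
qed

subsection \<open>Coordinate vectors and linear operators\<close>

text \<open>Every operator acts on the one type of sequences; spaces of finite dimension are the subspaces
  \<open>vecs n\<close> below, so that dimensions and subspaces may vary inside a proof.\<close>

typedef 'f fvec = "UNIV :: (nat \<Rightarrow> 'f) set"
  morphisms cf mkv by simp

lemma cf_mkv [simp]: "cf (mkv f) i = f i"
  by (simp add: mkv_inverse)

lemma fvec_eq_iff: "u = v \<longleftrightarrow> (\<forall>i. cf u i = cf v i)"
  by (metis cf_inject ext)

instantiation fvec :: (ab_group_add) ab_group_add
begin
definition "0 = mkv (\<lambda>_. 0)"
definition "u + v = mkv (\<lambda>i. cf u i + cf v i)"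
definition "- u = mkv (\<lambda>i. - cf u i)"
definition "u - v = mkv (\<lambda>i. cf u i - cf v i)"
instance
  by standard (auto simp: fvec_eq_iff zero_fvec_def plus_fvec_def uminus_fvec_def minus_fvec_def)
end

lemma cf_simps [simp]:
  "cf 0 i = 0" "cf (u + v) i = cf u i + cf v i" "cf (- u) i = - cf u i" "cf (u - v) i = cf u i - cf v i"
  by (simp_all add: zero_fvec_def plus_fvec_def uminus_fvec_def minus_fvec_def)

definition smul :: "'f::field \<Rightarrow> 'f fvec \<Rightarrow> 'f fvec" where
  "smul c v = mkv (\<lambda>i. c * cf v i)"

lemma cf_smul [simp]: "cf (smul c v) i = c * cf v i"
  by (simp add: smul_def)

global_interpretation fv: vector_space "smul :: 'f::field \<Rightarrow> 'f fvec \<Rightarrow> 'f fvec"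
  by unfold_locales (auto simp: fvec_eq_iff algebra_simps)

global_interpretation fvp: vector_space_pair
  "smul :: 'f::field \<Rightarrow> 'f fvec \<Rightarrow> 'f fvec" "smul :: 'f::field \<Rightarrow> 'f fvec \<Rightarrow> 'f fvec"
  by unfold_locales

definition lin :: "('f::field fvec \<Rightarrow> 'f fvec) \<Rightarrow> bool" where
  "lin T \<longleftrightarrow> (\<forall>u v. T (u + v) = T u + T v) \<and> (\<forall>c v. T (smul c v) = smul c (T v))"

lemma linI: "(\<And>u v. T (u + v) = T u + T v) \<Longrightarrow> (\<And>c v. T (smul c v) = smul c (T v)) \<Longrightarrow> lin T"
  by (simp add: lin_def)

lemma lin_add: "lin T \<Longrightarrow> T (u + v) = T u + T v"
  by (simp add: lin_def)

lemma lin_smul: "lin T \<Longrightarrow> T (smul c v) = smul c (T v)"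
  by (simp add: lin_def)

lemma lin_0: "lin T \<Longrightarrow> T 0 = 0"
  using lin_smul[of T 0 0] by simp

lemma lin_minus: "lin T \<Longrightarrow> T (- v) = - T v"
  using lin_smul[of T "- 1" v] by simp

lemma lin_diff: "lin T \<Longrightarrow> T (u - v) = T u - T v"
  using lin_add[of T "u - v" v] by (simp add: eq_diff_eq)

lemma lin_sum: "lin T \<Longrightarrow> T (\<Sum>i\<in>A. f i) = (\<Sum>i\<in>A. T (f i))"
  by (induction A rule: infinite_finite_induct) (auto simp: lin_0 lin_add)

lemma lin_id: "lin (\<lambda>v. v)"
  by (simp add: lin_def)

lemma lin_zero: "lin (\<lambda>v. 0)"
  by (simp add: lin_def)

lemma lin_comp: "lin S \<Longrightarrow> lin T \<Longrightarrow> lin (\<lambda>v. S (T v))"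
  by (simp add: lin_def)

lemma lin_plus: "lin S \<Longrightarrow> lin T \<Longrightarrow> lin (\<lambda>v. S v + T v)"
  by (simp add: lin_def fv.scale_right_distrib)

lemma lin_sub: "lin S \<Longrightarrow> lin T \<Longrightarrow> lin (\<lambda>v. S v - T v)"
  by (simp add: lin_def fv.scale_right_diff_distrib)

lemma lin_funpow: "lin T \<Longrightarrow> lin (T ^^ k)"
  by (induction k) (auto simp: lin_def)

lemma lin_linear: "Vector_Spaces.linear smul smul T \<Longrightarrow> lin T"
  by (auto simp: lin_def Vector_Spaces.linear_iff)

lemma linear_lin: "lin T \<Longrightarrow> Vector_Spaces.linear smul smul T"
  by (auto simp: lin_def Vector_Spaces.linear_iff fv.vector_space_axioms)

lemma subspace_image: "lin T \<Longrightarrow> fv.subspace W \<Longrightarrow> fv.subspace (T ` W)"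
  by (rule fvp.linear_subspace_image) (auto intro: linear_lin)

lemma subspace_kernel: "lin T \<Longrightarrow> fv.subspace W \<Longrightarrow> fv.subspace {v \<in> W. T v = 0}"
  by (auto simp: fv.subspace_def lin_0 lin_add lin_smul)

lemma funpow_invariant: "(\<And>v. v \<in> W \<Longrightarrow> T v \<in> W) \<Longrightarrow> v \<in> W \<Longrightarrow> (T ^^ k) v \<in> W"
  by (induction k) auto

lemma funpow_zero_mono: "lin T \<Longrightarrow> (T ^^ k) v = 0 \<Longrightarrow> k \<le> l \<Longrightarrow> (T ^^ l) v = 0"
proof (induction l)
  case (Suc l)
  then show ?case by (cases "k = Suc l") (auto simp: lin_0)
qed simp

subsection \<open>Polynomials in an operator\<close>

text \<open>The operator p(T), by Horner's scheme.\<close>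

definition pop :: "('f::field fvec \<Rightarrow> 'f fvec) \<Rightarrow> 'f poly \<Rightarrow> 'f fvec \<Rightarrow> 'f fvec" where
  "pop T p = fold_coeffs (\<lambda>a f v. smul a v + T (f v)) p (\<lambda>_. 0)"

lemma pop_0 [simp]: "pop T 0 v = 0"
  by (simp add: pop_def)

lemma pop_pCons: "lin T \<Longrightarrow> pop T (pCons a p) v = smul a v + T (pop T p v)"
  by (cases "a = 0 \<and> p = 0") (auto simp: pop_def lin_0)

lemma lin_pop: "lin T \<Longrightarrow> lin (pop T p)"
proof (induction p)
  case (pCons a p)
  then have "lin (\<lambda>v. smul a v + T (pop T p v))"
    by (auto simp: lin_def fv.scale_right_distrib fv.scale_left_commute mult.commute)
  moreover have "pop T (pCons a p) = (\<lambda>v. smul a v + T (pop T p v))"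
    using pCons.prems by (intro ext pop_pCons)
  ultimately show ?case by simp
qed (auto simp: lin_def)

lemma pop_const: "lin T \<Longrightarrow> pop T [:c:] v = smul c v"
  by (simp add: pop_pCons lin_0)

lemma pop_1: "lin T \<Longrightarrow> pop T 1 v = v"
  by (simp add: one_pCons pop_const)

lemma pop_X: "lin T \<Longrightarrow> pop T [:0, 1:] v = T v"
  by (simp add: pop_pCons lin_0)

lemma pop_add: "lin T \<Longrightarrow> pop T (p + q) v = pop T p v + pop T q v"
proof (induction p arbitrary: q)
  case (pCons a p)
  obtain b q' where q: "q = pCons b q'" by (cases q) auto
  show ?case using pCons by (simp add: q pop_pCons lin_add fv.scale_left_distrib)
qed simp

lemma pop_smult: "lin T \<Longrightarrow> pop T (Polynomial.smult c p) v = smul c (pop T p v)"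
  by (induction p) (auto simp: pop_pCons lin_smul fv.scale_right_distrib)

lemma pop_diff: "lin T \<Longrightarrow> pop T (p - q) v = pop T p v - pop T q v"
  using pop_add[of T "p - q" q v] by (simp add: eq_diff_eq)

lemma pop_commute:
  assumes "lin T" "lin S" "\<And>v. v \<in> W \<Longrightarrow> T v \<in> W" "fv.subspace W"
    and "\<And>v. v \<in> W \<Longrightarrow> S (T v) = T (S v)" and "v \<in> W"
  shows "S (pop T p v) = pop T p (S v)"
  using assms(6)
proof (induction p arbitrary: v)
  case (pCons a p)
  have "pop T p v \<in> W" if "v \<in> W" for v p
    using that by (induction p) (auto simp: pop_pCons assms fv.subspace_add fv.subspace_scale fv.subspace_0)
  then show ?case using pCons assms by (simp add: pop_pCons lin_add lin_smul)
qed (simp add: lin_0 assms)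

lemma pop_invariant:
  assumes "lin T" "\<And>v. v \<in> W \<Longrightarrow> T v \<in> W" "fv.subspace W" "v \<in> W"
  shows "pop T p v \<in> W"
  using assms by (induction p) (auto simp: pop_pCons fv.subspace_add fv.subspace_scale fv.subspace_0)

lemma pop_apply_commute: "lin T \<Longrightarrow> T (pop T p v) = pop T p (T v)"
  by (rule pop_commute[where W = UNIV]) auto

lemma pop_mult: "lin T \<Longrightarrow> pop T (p * q) v = pop T p (pop T q v)"
  by (induction p) (auto simp: pop_pCons pop_add pop_smult lin_pop)

lemma pop_power: "lin T \<Longrightarrow> pop T (p ^ k) v = (pop T p ^^ k) v"
  by (induction k arbitrary: v) (auto simp: pop_1 pop_mult)

lemma pop_X_power: "lin T \<Longrightarrow> pop T ([:0, 1:] ^ k) v = (T ^^ k) v"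
  by (induction k arbitrary: v) (auto simp: pop_1 pop_pCons)

lemma pop_dvd_zero:
  assumes "lin T" "p dvd q" "pop T p v = 0"
  shows "pop T q v = 0"
  using assms by (metis dvd_def lin_0 lin_pop mult.commute pop_mult)

lemma pop_pcompose: "lin T \<Longrightarrow> pop T (pcompose p q) v = pop (pop T q) p v"
  by (induction p) (auto simp: pop_pCons pcompose_pCons lin_pop lin_0 pop_add pop_mult pop_const)

lemma pop_cong:
  assumes "lin T" "lin S" "\<And>v. v \<in> W \<Longrightarrow> T v \<in> W" "fv.subspace W"
    and "\<And>v. v \<in> W \<Longrightarrow> S v = T v" and "v \<in> W"
  shows "pop S p v = pop T p v"
  using assms(6)
proof (induction p)
  case (pCons a p)
  then show ?case using assms pop_invariant[OF assms(1,3,4), of v p] by (simp add: pop_pCons)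
qed simp

subsection \<open>Finite-dimensional coordinate spaces\<close>

definition vecs :: "nat \<Rightarrow> 'f::field fvec set" where
  "vecs n = {v. \<forall>i\<ge>n. cf v i = 0}"

definition evec :: "nat \<Rightarrow> 'f::field fvec" where
  "evec i = mkv (\<lambda>j. if j = i then 1 else 0)"

text \<open>The projection onto \<open>vecs n\<close>. A linear map given on \<open>vecs n\<close>,
  composed with it, becomes linear on all sequences.\<close>

definition trunc :: "nat \<Rightarrow> 'f::field fvec \<Rightarrow> 'f fvec" where
  "trunc n v = mkv (\<lambda>i. if i < n then cf v i else 0)"

lemma subspace_vecs: "fv.subspace (vecs n)"
  by (auto simp: fv.subspace_def vecs_def)

lemma evec_in_vecs [simp]: "i < n \<Longrightarrow> evec i \<in> vecs n"
  by (auto simp: vecs_def evec_def)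

lemma lin_trunc: "lin (trunc n)"
  by (rule linI) (auto simp: trunc_def fvec_eq_iff)

lemma trunc_in_vecs [simp]: "trunc n v \<in> vecs n"
  by (auto simp: vecs_def trunc_def)

lemma trunc_id: "v \<in> vecs n \<Longrightarrow> trunc n v = v"
  by (auto simp: vecs_def trunc_def fvec_eq_iff)

lemma cf_sum: "cf (\<Sum>i\<in>A. f i) x = (\<Sum>i\<in>A. cf (f i) x)"
  by (induction A rule: infinite_finite_induct) auto

lemma vecs_expand: "v \<in> vecs n \<Longrightarrow> v = (\<Sum>i<n. smul (cf v i) (evec i))"
  by (auto simp: fvec_eq_iff cf_sum evec_def vecs_def if_distrib cong: if_cong)

lemma vecs_span: "(vecs n :: 'f::field fvec set) = fv.span (evec ` {..<n})"
proof
  show "(vecs n :: 'f fvec set) \<subseteq> fv.span (evec ` {..<n})"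
  proof
    fix v :: "'f fvec" assume "v \<in> vecs n"
    then show "v \<in> fv.span (evec ` {..<n})"
      by (metis (no_types, lifting) vecs_expand fv.span_sum fv.span_scale fv.span_base imageI)
  qed
  show "fv.span (evec ` {..<n}) \<subseteq> (vecs n :: 'f fvec set)"
    by (rule fv.span_minimal) (auto simp: subspace_vecs)
qed

lemma lin_eq_on_vecs:
  assumes "lin S" "lin T" "\<And>i. i < n \<Longrightarrow> S (evec i) = T (evec i)" "v \<in> vecs n"
  shows "S v = T v"
proof -
  have "S v = (\<Sum>i<n. smul (cf v i) (S (evec i)))"
    by (subst vecs_expand[OF assms(4)]) (simp add: lin_sum lin_smul assms)
  also have "\<dots> = T v"
    by (subst (2) vecs_expand[OF assms(4)]) (simp add: lin_sum lin_smul assms)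
  finally show ?thesis .
qed

lemma subspace_finite_basis:
  assumes "fv.subspace W" "W \<subseteq> vecs n"
  obtains B where "finite B" "B \<subseteq> W" "fv.independent B" "fv.span B = W" "card B = fv.dim W" "card B \<le> n"
proof -
  obtain B where B: "B \<subseteq> W" "fv.independent B" "W \<subseteq> fv.span B" "card B = fv.dim W"
    using fv.basis_exists by blast
  have "B \<subseteq> fv.span (evec ` {..<n})" using B assms vecs_span by blast
  then have "finite B \<and> card B \<le> card ((evec :: nat \<Rightarrow> 'a fvec) ` {..<n})"
    by (intro fv.independent_span_bound B) auto
  moreover have "card ((evec :: nat \<Rightarrow> 'a fvec) ` {..<n}) \<le> n"
    by (metis card_image_le card_lessThan finite_lessThan)
  moreover have "fv.span B = W" using B assms by (metis fv.span_minimal subset_antisym)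
  ultimately show ?thesis using B that by auto
qed

lemma dim_le_vecs: "fv.subspace W \<Longrightarrow> W \<subseteq> vecs n \<Longrightarrow> fv.dim W \<le> n"
  by (metis subspace_finite_basis)

lemma dim_strict_mono:
  assumes "fv.subspace W" "fv.subspace W'" "W \<subset> W'" "W' \<subseteq> vecs n"
  shows "fv.dim W < fv.dim W'"
proof -
  obtain B where B: "finite B" "B \<subseteq> W" "fv.independent B" "fv.span B = W" "card B = fv.dim W"
    using subspace_finite_basis assms by (metis psubset_imp_subset subset_trans)
  obtain B' where B': "B \<subseteq> B'" "B' \<subseteq> W'" "fv.independent B'" "W' \<subseteq> fv.span B'"
    using fv.maximal_independent_subset_extend[of B W'] B assms by blast
  have "finite B'" using B' assms subspace_finite_basis
    by (metis fv.basis_card_eq_dim fv.independent_span_bound)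
  moreover have "card B' = fv.dim W'" using B' by (metis fv.basis_card_eq_dim)
  moreover have "B \<noteq> B'" using assms B B' by auto
  ultimately show ?thesis using B B' by (metis psubsetI psubset_card_mono)
qed

text \<open>A chart: A parametrises W by \<open>vecs m\<close> and B reads off coordinates, so
  \<open>A (B v)\<close> is a linear projection onto W. An operator T on W becomes
  \<open>B (T (A v))\<close> on \<open>vecs m\<close>, which is the form that inductions on the
  dimension and the coordinate-bound \<open>tr\<close> require.\<close>

lemma subspace_retract:
  assumes "fv.subspace W" "W \<subseteq> vecs n"
  obtains A B m where "lin A" "lin B" "m \<le> n" "m = fv.dim W" "\<And>v. A v \<in> W" "\<And>v. B v \<in> vecs m"
    "\<And>v. v \<in> vecs m \<Longrightarrow> B (A v) = v" "\<And>w. w \<in> W \<Longrightarrow> A (B w) = w"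
proof -
  obtain Bs where Bs: "finite Bs" "Bs \<subseteq> W" "fv.independent Bs" "fv.span Bs = W" "card Bs = fv.dim W" "card Bs \<le> n"
    using subspace_finite_basis[OF assms] by blast
  define m where "m = card Bs"
  obtain b where b: "bij_betw b {..<m} Bs"
    using ex_bij_betw_nat_finite[OF Bs(1)] by (auto simp: m_def lessThan_atLeast0)
  obtain g where g: "Vector_Spaces.linear smul smul g" "\<And>x. x \<in> Bs \<Longrightarrow> g x = evec (the_inv_into {..<m} b x)"
    using fvp.linear_independent_extend[OF Bs(3), of "\<lambda>x. evec (the_inv_into {..<m} b x)"] by auto
  have gb: "g (b j) = evec j" if "j < m" for j
    using that g(2) b by (metis bij_betwE bij_betw_imp_inj_on lessThan_iff the_inv_into_f_f)
  define A where "A = (\<lambda>v. \<Sum>j<m. smul (cf v j) (b j))"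
  define B where "B = (\<lambda>v. trunc m (g v))"
  have lA: "lin A" unfolding A_def
    by (rule linI) (auto simp: fv.scale_left_distrib sum.distrib fv.scale_sum_right)
  have lg: "lin g" by (rule lin_linear[OF g(1)])
  have lB: "lin B" unfolding B_def by (rule lin_comp[OF lin_trunc lg])
  have bW: "b j \<in> W" if "j < m" for j using that b Bs by (auto simp: bij_betw_def)
  have AW: "A v \<in> W" for v unfolding A_def
    by (intro fv.subspace_sum fv.subspace_scale assms) (auto simp: bW)
  have Aev: "A (evec j) = b j" if "j < m" for j unfolding A_def
    using that by (auto simp: evec_def fvec_eq_iff cf_sum if_distrib[of "\<lambda>x. x * _"] cong: if_cong)
  have BA: "B (A v) = v" if "v \<in> vecs m" for v
  proof (rule lin_eq_on_vecs[OF lin_comp[OF lB lA] lin_id _ that])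
    show "B (A (evec i)) = evec i" if "i < m" for i
      using that by (simp add: Aev B_def gb trunc_id)
  qed
  have AB: "A (B w) = w" if "w \<in> W" for w
  proof -
    have "w \<in> fv.span Bs" using that Bs by simp
    then show ?thesis
    proof (induction rule: fv.span_induct)
      case base
      show ?case by (auto simp: fv.subspace_def lin_add[OF lA] lin_add[OF lB] lin_smul[OF lA] lin_smul[OF lB] lin_0[OF lA] lin_0[OF lB])
    next
      case (step x)
      then obtain j where "j < m" "x = b j" using b by (auto simp: bij_betw_def)
      then show ?case by (simp add: B_def gb trunc_id Aev)
    qed
  qed
  show ?thesis using that[OF lA lB _ _ AW _ BA AB] Bs by (simp add: m_def B_def)
qed

lemma funpow_intertwine:
  assumes "\<And>v. v \<in> W \<Longrightarrow> A (U v) = T (A v)" "\<And>v. v \<in> W \<Longrightarrow> U v \<in> W" "v \<in> W"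
  shows "A ((U ^^ k) v) = (T ^^ k) (A v)"
  using assms by (induction k) (auto simp: funpow_invariant)

lemma image_nilpotent_shrinks:
  assumes "lin T" "\<And>v. v \<in> vecs n \<Longrightarrow> T v \<in> vecs n" "\<And>v. v \<in> vecs n \<Longrightarrow> (T ^^ k) v = 0" "T ` vecs n = vecs n"
  shows "n = 0"
proof (rule ccontr)
  assume "n \<noteq> 0"
  have "(T ^^ k) ` vecs n = vecs n"
    by (induction k) (simp_all only: funpow.simps image_comp[symmetric] assms(4) id_def image_ident)
  then have "vecs n \<subseteq> {0 :: 'a fvec}" using assms(3) by (metis image_subsetI insertI1)
  then have "evec 0 = (0 :: 'a fvec)" using \<open>n \<noteq> 0\<close> evec_in_vecs by blast
  then have "cf (evec 0) 0 = (0 :: 'a)" by simp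
  then show False by (simp add: evec_def)
qed

subsection \<open>Traces and the Fitting decomposition\<close>

definition tr :: "nat \<Rightarrow> ('f::field fvec \<Rightarrow> 'f fvec) \<Rightarrow> 'f" where
  "tr n T = (\<Sum>i<n. cf (T (evec i)) i)"

lemma tr_add: "tr n (\<lambda>v. S v + T v) = tr n S + tr n T"
  by (simp add: tr_def sum.distrib)

lemma tr_diff: "tr n (\<lambda>v. S v - T v) = tr n S - tr n T"
  by (simp add: tr_def sum_subtractf)

lemma tr_smul: "tr n (\<lambda>v. smul c (T v)) = c * tr n T"
  by (simp add: tr_def sum_distrib_left)

lemma tr_cong: "(\<And>v. v \<in> vecs n \<Longrightarrow> S v = T v) \<Longrightarrow> tr n S = tr n T"
  by (simp add: tr_def)

lemma tr_id: "tr n (\<lambda>v. v) = of_nat n"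
  by (simp add: tr_def evec_def)

text \<open>The two spaces may differ in dimension. This is how a trace is moved to the image W of
  an operator: with the chart of W, \<open>T v = A (B (T v))\<close> has the trace of
  \<open>B (T (A v))\<close> on the smaller space.\<close>

lemma tr_comm:
  assumes "lin A" "lin B"
    and "\<And>v. v \<in> vecs n \<Longrightarrow> B v \<in> vecs m" "\<And>v. v \<in> vecs m \<Longrightarrow> A v \<in> vecs n"
  shows "tr n (\<lambda>v. A (B v)) = tr m (\<lambda>v. B (A v))"
proof -
  have expand: "cf (A w) i = (\<Sum>j<k. cf w j * cf (A (evec j)) i)"
    if "lin A" "w \<in> vecs k" for A :: "'a fvec \<Rightarrow> 'a fvec" and w i k
    using that by (subst vecs_expand[OF that(2)]) (simp add: lin_sum lin_smul cf_sum)
  have "tr n (\<lambda>v. A (B v)) = (\<Sum>i<n. \<Sum>j<m. cf (B (evec i)) j * cf (A (evec j)) i)"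
    unfolding tr_def using assms by (intro sum.cong refl expand) auto
  also have "\<dots> = (\<Sum>j<m. \<Sum>i<n. cf (A (evec j)) i * cf (B (evec i)) j)"
    by (subst sum.swap) (simp add: mult.commute)
  also have "\<dots> = tr m (\<lambda>v. B (A v))"
    unfolding tr_def using assms by (intro sum.cong refl expand[symmetric]) auto
  finally show ?thesis .
qed

text \<open>Induction on the dimension: unless the space is 0, the image of a nilpotent operator is
  a proper subspace, the trace equals that of the operator induced on the image, and this one is
  nilpotent again.\<close>

lemma tr_nilpotent:
  assumes "lin T" "\<And>v. v \<in> vecs n \<Longrightarrow> T v \<in> vecs n" "\<And>v. v \<in> vecs n \<Longrightarrow> (T ^^ k) v = 0"
  shows "tr n T = 0"
  using assms
proof (induction n arbitrary: T rule: less_induct)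
  case (less n)
  define W where "W = T ` vecs n"
  have W: "fv.subspace W" "W \<subseteq> vecs n"
    using less.prems by (auto simp: W_def subspace_image subspace_vecs)
  obtain A B m where AB: "lin A" "lin B" "m \<le> n" "m = fv.dim W" "\<And>v. A v \<in> W" "\<And>v. B v \<in> vecs m"
    "\<And>v. v \<in> vecs m \<Longrightarrow> B (A v) = v" "\<And>w. w \<in> W \<Longrightarrow> A (B w) = w"
    using subspace_retract[OF W] by blast
  show ?case
  proof (cases "W = vecs n")
    case True
    then have "n = 0" using image_nilpotent_shrinks[OF less.prems] by (simp add: W_def)
    then show ?thesis by (simp add: tr_def)
  next
    case False
    then have "fv.dim W < fv.dim (vecs n :: 'a fvec set)"
      using W by (intro dim_strict_mono[of _ _ n]) (auto simp: subspace_vecs)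
    moreover have "fv.dim (vecs n :: 'a fvec set) \<le> n"
      using subspace_finite_basis[OF subspace_vecs subset_refl] by metis
    ultimately have "m < n" using AB by simp
    have TW: "T v \<in> W" if "v \<in> vecs n" for v using that by (simp add: W_def)
    have AV: "A v \<in> vecs n" for v using AB(5) W by blast
    have "tr n T = tr n (\<lambda>v. A (B (T v)))"
      by (rule tr_cong) (simp add: AB TW)
    also have "\<dots> = tr m (\<lambda>v. B (T (A v)))"
      by (rule tr_comm[OF AB(1) lin_comp[OF AB(2) less.prems(1)]]) (use AB AV in auto)
    also have "\<dots> = 0"
    proof (rule less.IH[OF \<open>m < n\<close>])
      show "lin (\<lambda>v. B (T (A v)))" by (rule lin_comp[OF AB(2) lin_comp[OF less.prems(1) AB(1)]])
      show "B (T (A v)) \<in> vecs m" for v using AB by simp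
      show "((\<lambda>v. B (T (A v))) ^^ k) v = 0" if "v \<in> vecs m" for v
      proof -
        have in_m: "((\<lambda>v. B (T (A v))) ^^ k) v \<in> vecs m"
          by (rule funpow_invariant[OF _ that]) (rule AB(6))
        have "A (((\<lambda>v. B (T (A v))) ^^ k) v) = (T ^^ k) (A v)"
        proof (rule funpow_intertwine[where W = "vecs m"])
          show "A (B (T (A v))) = T (A v)" for v by (rule AB(8)) (rule TW[OF AV])
          show "B (T (A v)) \<in> vecs m" for v by (rule AB(6))
        qed (rule that)
        also have "\<dots> = 0" using less.prems AV by simp
        finally show ?thesis using AB(7)[OF in_m] lin_0[OF AB(2)] by simp
      qed
    qed
    finally show ?thesis .
  qed
qed

text \<open>Moved to its image, an idempotent becomes the identity.\<close>

lemma tr_idempotent: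
  assumes "lin P" "\<And>v. v \<in> vecs n \<Longrightarrow> P v \<in> vecs n" "\<And>v. v \<in> vecs n \<Longrightarrow> P (P v) = P v"
  shows "tr n P = of_nat (fv.dim (P ` vecs n))"
proof -
  define W where "W = P ` vecs n"
  have W: "fv.subspace W" "W \<subseteq> vecs n"
    using assms by (auto simp: W_def subspace_image subspace_vecs)
  obtain A B m where AB: "lin A" "lin B" "m \<le> n" "m = fv.dim W" "\<And>v. A v \<in> W" "\<And>v. B v \<in> vecs m"
    "\<And>v. v \<in> vecs m \<Longrightarrow> B (A v) = v" "\<And>w. w \<in> W \<Longrightarrow> A (B w) = w"
    using subspace_retract[OF W] by blast
  have PW: "P w = w" if "w \<in> W" for w using that assms by (auto simp: W_def)
  have "tr n P = tr n (\<lambda>v. A (B (P v)))"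
    by (rule tr_cong) (simp add: AB W_def)
  also have "\<dots> = tr m (\<lambda>v. B (P (A v)))"
    by (rule tr_comm[OF AB(1) lin_comp[OF AB(2) assms(1)]]) (use AB W in auto)
  also have "\<dots> = tr m (\<lambda>v. v)"
    by (rule tr_cong) (simp add: AB PW)
  finally show ?thesis using AB by (simp add: tr_id W_def)
qed

lemma dim_eq_0: "fv.subspace W \<Longrightarrow> W \<subseteq> vecs n \<Longrightarrow> fv.dim W = 0 \<Longrightarrow> W = {0}"
  by (metis card_0_eq fv.span_empty subspace_finite_basis)

lemma pop_sum: "lin T \<Longrightarrow> pop T (\<Sum>i\<in>A. f i) v = (\<Sum>i\<in>A. pop T (f i) v)"
  by (induction A rule: infinite_finite_induct) (auto simp: pop_add)

lemma pop_monom: "lin T \<Longrightarrow> pop T (Polynomial.monom c k) v = smul c ((T ^^ k) v)"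
  by (induction k) (auto simp: monom_0 monom_Suc pop_const pop_pCons lin_0 lin_smul)

lemma vector_annihilator:
  assumes "lin T" "\<And>v. v \<in> vecs n \<Longrightarrow> T v \<in> vecs n" "v \<in> vecs n"
  shows "\<exists>p. p \<noteq> 0 \<and> pop T p v = 0"
\<comment> \<open>Coinciding powers form a separate case: dependence is a property of the set S,
  which has n + 1 elements only if the vectors \<open>(T ^^ i) v\<close> are distinct.\<close>
proof (cases "inj_on (\<lambda>i. (T ^^ i) v) {..n}")
  case False
  then obtain i j where ij: "i \<noteq> j" "(T ^^ i) v = (T ^^ j) v" by (auto simp: inj_on_def)
  have "Polynomial.coeff (Polynomial.monom 1 i - Polynomial.monom 1 j) i = (1 :: 'a)" using ij by simp
  then have "Polynomial.monom 1 i - Polynomial.monom 1 j \<noteq> (0 :: 'a poly)" by (metis coeff_0 zero_neq_one)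
  then show ?thesis using ij assms
    by (intro exI[of _ "Polynomial.monom 1 i - Polynomial.monom 1 j"]) (simp add: pop_diff pop_monom)
next
  case True
  define S where "S = (\<lambda>i. (T ^^ i) v) ` {..n}"
  have card: "card S = Suc n" using True by (simp add: S_def card_image)
  have "S \<subseteq> fv.span (evec ` {..<n})"
    using assms by (auto simp: S_def vecs_span[symmetric] intro: funpow_invariant)
  then have "fv.independent S \<Longrightarrow> card S \<le> card ((evec :: nat \<Rightarrow> 'a fvec) ` {..<n})"
    using fv.independent_span_bound[of "evec ` {..<n}" S] by simp
  moreover have "card ((evec :: nat \<Rightarrow> 'a fvec) ` {..<n}) \<le> n"
    by (metis card_image_le card_lessThan finite_lessThan)
  ultimately have "fv.dependent S" using card by linarith
  then obtain u where u: "\<exists>w\<in>S. u w \<noteq> 0" "(\<Sum>w\<in>S. smul (u w) w) = 0"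
    using fv.dependent_finite[of S] by (auto simp: S_def)
  define p where "p = (\<Sum>i\<le>n. Polynomial.monom (u ((T ^^ i) v)) i)"
  have "pop T p v = (\<Sum>i\<le>n. smul (u ((T ^^ i) v)) ((T ^^ i) v))"
    by (simp add: p_def pop_sum pop_monom assms)
  also have "\<dots> = (\<Sum>w\<in>S. smul (u w) w)"
    unfolding S_def by (subst sum.reindex[OF True]) simp
  finally have "pop T p v = 0" using u by simp
  moreover obtain i where i: "i \<le> n" "u ((T ^^ i) v) \<noteq> 0" using u by (auto simp: S_def)
  have "Polynomial.coeff p i = u ((T ^^ i) v)"
    using i by (simp add: p_def Polynomial.coeff_sum if_distrib cong: if_cong)
  then have "p \<noteq> 0" using i by auto
  ultimately show ?thesis by blast
qed

text \<open>The product of annihilators of the n basis vectors serves; it is not claimed to be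
  minimal.\<close>

lemma operator_annihilator:
  assumes "lin T" "\<And>v. v \<in> vecs n \<Longrightarrow> T v \<in> vecs n"
  obtains \<chi> where "\<chi> \<noteq> 0" "\<And>v. v \<in> vecs n \<Longrightarrow> pop T \<chi> v = 0"
proof -
  have "\<forall>i\<in>{..<n}. \<exists>p. p \<noteq> 0 \<and> pop T p (evec i) = 0"
    using vector_annihilator[OF assms] by simp
  then obtain p where p: "\<And>i. i < n \<Longrightarrow> p i \<noteq> 0" "\<And>i. i < n \<Longrightarrow> pop T (p i) (evec i) = 0"
    by (metis bchoice lessThan_iff)
  define \<chi> where "\<chi> = (\<Prod>i<n. p i)"
  have "pop T \<chi> (evec i) = 0" if "i < n" for i
    by (rule pop_dvd_zero[OF assms(1) _ p(2)[OF that]]) (use that in \<open>auto simp: \<chi>_def intro: dvd_prodI\<close>)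
  then have "pop T \<chi> v = 0" if "v \<in> vecs n" for v
    by (intro lin_eq_on_vecs[OF lin_pop[OF assms(1)] lin_zero _ that])
  moreover have "\<chi> \<noteq> 0" using p by (simp add: \<chi>_def)
  ultimately show ?thesis using that by blast
qed

text \<open>With \<open>\<chi> = X\<^sup>r g\<close> and \<open>g(0) = 1\<close>, the polynomial \<open>(1 - g)\<^sup>k\<close> for \<open>k > r\<close> acts as the
  projection onto the Fitting one-component.\<close>

lemma fitting_polynomial:
  assumes "lin T" "\<And>v. v \<in> vecs n \<Longrightarrow> T v \<in> vecs n"
  shows "\<exists>k p. k > 0 \<and> [:0, 1:] ^ k dvd p \<and>
    (\<forall>v\<in>vecs n. (T ^^ k) (v - pop T p v) = 0 \<and> pop T p (pop T p v) = pop T p v)"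
proof -
  obtain \<chi> where chi: "\<chi> \<noteq> 0" "\<And>v. v \<in> vecs n \<Longrightarrow> pop T \<chi> v = 0"
    using operator_annihilator[OF assms] by blast
  obtain g where g: "\<chi> = [:- 0, 1:] ^ order 0 \<chi> * g" "\<not> [:- 0, 1:] dvd g"
    using order_decomp[OF chi(1)] by blast
  \<comment> \<open>One more than the order, so that k is positive even for invertible T; later
    arguments split one factor T off \<open>T ^^ k\<close>.\<close>
  define k where "k = Suc (order 0 \<chi>)"
  have g0: "poly g 0 \<noteq> 0" using g(2) by (metis dvd_iff_poly_eq_0 minus_zero neg_equal_0_iff_equal)
  define h where "h = 1 - Polynomial.smult (inverse (poly g 0)) g"
  define p where "p = h ^ k"
  have "poly h 0 = 0" using g0 by (simp add: h_def)
  then have "[:0, 1:] dvd h" using dvd_iff_poly_eq_0[of 0 h] by simp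
  then have Xp: "[:0, 1:] ^ k dvd p" by (simp add: p_def dvd_power_same)
  have "1 - h dvd 1 - h ^ k" using diff_power_eq_sum[of 1 "k - 1" h] using dvd_triv_right[of "[:0, 1 :: 'a:] ^ Polynomial.order 0 \<chi>" "[:0, 1:]"] by (simp add: k_def)
  moreover have "g dvd 1 - h" by (simp add: h_def dvd_smult)
  ultimately have gp: "g dvd 1 - p" unfolding p_def by (rule dvd_trans[rotated])
  have "\<chi> dvd [:0, 1:] ^ k * (1 - p)"
  proof (subst g(1), rule mult_dvd_mono)
    show "[:- 0, 1 :: 'a:] ^ Polynomial.order 0 \<chi> dvd [:0, 1:] ^ k" using dvd_triv_right[of "[:0, 1 :: 'a:] ^ Polynomial.order 0 \<chi>" "[:0, 1:]"] by (simp add: k_def)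
  qed (rule gp)
  then have 1: "pop T ([:0, 1:] ^ k * (1 - p)) v = 0" if "v \<in> vecs n" for v
    using pop_dvd_zero[OF assms(1)] chi that by blast
  have "[:0, 1:] ^ k * (1 - p) dvd p * (1 - p)" using Xp by (rule mult_dvd_mono) simp
  then have "pop T (p * (1 - p)) v = 0" if "v \<in> vecs n" for v
    using pop_dvd_zero[OF assms(1)] 1 that by blast
  moreover have "k > 0" using dvd_triv_right[of "[:0, 1 :: 'a:] ^ Polynomial.order 0 \<chi>" "[:0, 1:]"] by (simp add: k_def)
  ultimately show ?thesis using 1 Xp assms(1)
    by (intro exI[of _ k] exI[of _ p]) (simp add: pop_mult pop_diff pop_1 pop_X_power lin_diff[OF lin_pop] lin_diff[OF lin_funpow])
qed

text \<open>In p = X^k r the factor r(T) preserves every invariant subspace, so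
  \<open>w = pop T r v\<close> stays in W and one k serves all W at once.\<close>

lemma fitting_decomposition:
  assumes "lin T" "\<And>v. v \<in> vecs n \<Longrightarrow> T v \<in> vecs n"
  shows "\<exists>k>0. \<forall>W. fv.subspace W \<longrightarrow> W \<subseteq> vecs n \<longrightarrow> (\<forall>v\<in>W. T v \<in> W) \<longrightarrow>
    (\<forall>v\<in>W. \<exists>w\<in>W. (T ^^ k) (v - (T ^^ k) w) = 0)"
proof -
  obtain k p where kp: "k > 0" "[:0, 1:] ^ k dvd p"
    "\<And>v. v \<in> vecs n \<Longrightarrow> (T ^^ k) (v - pop T p v) = 0"
    using fitting_polynomial[OF assms] by metis
  obtain r where r: "p = [:0, 1:] ^ k * r" using kp by auto
  have "\<exists>w\<in>W. (T ^^ k) (v - (T ^^ k) w) = 0"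
    if W: "fv.subspace W" "W \<subseteq> vecs n" "\<forall>v\<in>W. T v \<in> W" "v \<in> W" for W v
  proof -
    have "pop T r v \<in> W" by (rule pop_invariant[OF assms(1) W(3)[rule_format] W(1,4)])
    moreover have "(T ^^ k) (v - (T ^^ k) (pop T r v)) = 0"
      using kp(3)[of v] W assms(1) by (auto simp: r pop_mult pop_X_power)
    ultimately show ?thesis by blast
  qed
  then show ?thesis using kp(1) by blast
qed

lemma tr_pop_X_mult:
  assumes "lin T" "\<And>k. k > 0 \<Longrightarrow> tr n (T ^^ k) = 0"
  shows "k > 0 \<Longrightarrow> tr n (\<lambda>v. (T ^^ k) (pop T q v)) = 0"
proof (induction q arbitrary: k)
  case 0
  then show ?case using assms by (simp add: lin_0[OF lin_funpow] tr_def)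
next
  case (pCons a q)
  have "tr n (\<lambda>v. (T ^^ k) (pop T (pCons a q) v)) = tr n (\<lambda>v. smul a ((T ^^ k) v) + (T ^^ Suc k) (pop T q v))"
    using assms(1) by (simp add: pop_pCons lin_add[OF lin_funpow] lin_smul[OF lin_funpow] funpow_swap1)
  also have "\<dots> = 0" using pCons.IH[of "Suc k"] pCons.prems assms(2)
    by (simp add: tr_add tr_smul del: funpow.simps)
  finally show ?case .
qed

text \<open>The projection onto the Fitting one-component is a polynomial in T without constant
  term, so its trace vanishes. That trace is also the dimension of the component, which is therefore
  0 in characteristic 0.\<close>

lemma nilpotent_if_traces_zero:
  fixes T :: "'f::field_char_0 fvec \<Rightarrow> 'f fvec"
  assumes "lin T" "\<And>v. v \<in> vecs n \<Longrightarrow> T v \<in> vecs n" "\<And>k. k > 0 \<Longrightarrow> tr n (T ^^ k) = 0"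
  obtains k where "\<And>v. v \<in> vecs n \<Longrightarrow> (T ^^ k) v = 0"
proof -
  obtain k p where kp: "k > 0" "[:0, 1:] ^ k dvd p"
    "\<And>v. v \<in> vecs n \<Longrightarrow> (T ^^ k) (v - pop T p v) = 0"
    "\<And>v. v \<in> vecs n \<Longrightarrow> pop T p (pop T p v) = pop T p v"
    using fitting_polynomial[OF assms(1,2)] by metis
  obtain r where r: "p = [:0, 1:] ^ k * r" using kp by auto
  have inv: "pop T p v \<in> vecs n" if "v \<in> vecs n" for v
    using assms that by (intro pop_invariant) (auto simp: subspace_vecs)
  have "tr n (pop T p) = tr n (\<lambda>v. (T ^^ k) (pop T r v))"
    by (rule tr_cong) (simp add: r pop_mult pop_X_power assms)
  also have "\<dots> = 0" using tr_pop_X_mult assms kp by blast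
  finally have "of_nat (fv.dim (pop T p ` vecs n)) = (0 :: 'f)"
    using tr_idempotent[OF lin_pop[OF assms(1)] inv kp(4)] by simp
  then have "pop T p ` vecs n = {0}"
    using inv by (intro dim_eq_0[of _ n]) (auto intro!: subspace_image lin_pop assms simp: subspace_vecs)
  then have "pop T p v = 0" if "v \<in> vecs n" for v using that by blast
  then show ?thesis using that[of k] kp(3) by (metis diff_zero)
qed

subsection \<open>Semisimple operators and the Jordan-Chevalley decomposition\<close>

text \<open>Averaging a projection \<open>\<pi>\<close> over the powers of \<open>s\<close>: the operator is
  \<open>\<Delta>\<^sub>q(s\<^sub>l, s\<^sub>r) \<pi>\<close> where \<open>\<Delta>\<^sub>q(X, Y) = (q(X) - q(Y)) / (X - Y)\<close> and \<open>s\<^sub>l\<close>, \<open>s\<^sub>r\<close> are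
  left and right composition with \<open>s\<close>.\<close>

lemma averaged_operator:
  assumes s: "lin s" and \<pi>: "lin \<pi>"
    and W: "fv.subspace W" "\<And>v. v \<in> W \<Longrightarrow> s v \<in> W" "\<And>v. v \<in> W \<Longrightarrow> \<pi> v = v"
    and V: "fv.subspace V" "\<And>v. v \<in> V \<Longrightarrow> s v \<in> V" "\<And>v. v \<in> V \<Longrightarrow> \<pi> v \<in> W"
  shows "\<exists>\<Delta>. lin \<Delta> \<and> (\<forall>v. s (\<Delta> v) - \<Delta> (s v) = pop s q (\<pi> v) - \<pi> (pop s q v)) \<and>
    (\<forall>v\<in>W. \<Delta> v = pop s (pderiv q) v) \<and> (\<forall>v\<in>V. \<Delta> v \<in> W)"
proof (induction q)
  case 0
  show ?case by (rule exI[of _ "\<lambda>v. 0"]) (auto simp: lin_zero lin_0 assms fv.subspace_0)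
next
  case (pCons a q)
  then obtain \<Delta> where D: "lin \<Delta>" "\<forall>v. s (\<Delta> v) - \<Delta> (s v) = pop s q (\<pi> v) - \<pi> (pop s q v)"
    "\<forall>v\<in>W. \<Delta> v = pop s (pderiv q) v" "\<forall>v\<in>V. \<Delta> v \<in> W"
    by blast
  show ?case
  \<comment> \<open>From (X q(X) - Y q(Y)) / (X - Y) = q(Y) + X (q(X) - q(Y)) / (X - Y): the first
    term acts as \<pi> after q(s), the second as s after the previous operator.\<close>
  proof (intro exI[of _ "\<lambda>v. \<pi> (pop s q v) + s (\<Delta> v)"] conjI allI ballI)
    show "lin (\<lambda>v. \<pi> (pop s q v) + s (\<Delta> v))"
      by (rule lin_plus[OF lin_comp[OF \<pi> lin_pop[OF s]] lin_comp[OF s D(1)]])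
    fix v
    have "s (s (\<Delta> v)) - s (\<Delta> (s v)) = s (pop s q (\<pi> v)) - s (\<pi> (pop s q v))"
      using D(2) by (simp add: lin_diff[OF s, symmetric])
    then show "s (\<pi> (pop s q v) + s (\<Delta> v)) - (\<pi> (pop s q (s v)) + s (\<Delta> (s v))) =
      pop s (pCons a q) (\<pi> v) - \<pi> (pop s (pCons a q) v)"
      by (simp add: pop_pCons s \<pi> lin_add lin_smul pop_apply_commute algebra_simps)
  next
    fix v assume v: "v \<in> W"
    have "pop s q v \<in> W" by (rule pop_invariant[OF s W(2,1) v])
    then show "\<pi> (pop s q v) + s (\<Delta> v) = pop s (pderiv (pCons a q)) v"
      using D(3) v W by (simp add: pderiv_pCons pop_add pop_pCons s)
  next
    fix v assume v: "v \<in> V"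
    have "pop s q v \<in> V" by (rule pop_invariant[OF s V(2,1) v])
    then show "\<pi> (pop s q v) + s (\<Delta> v) \<in> W"
      using D(4) V(3) W v by (simp add: fv.subspace_add)
  qed
qed

text \<open>Average any projection onto W. Where q(s) = 0 the averaged operator commutes with s, and
  on W it is q'(s). Multiplying it by b(s) makes it the identity on W, since b q' is 1 modulo q. The
  kernel of the resulting projection is the complement.\<close>

lemma separable_complement:
  assumes s: "lin s" and W0: "fv.subspace W0" "\<And>v. v \<in> W0 \<Longrightarrow> s v \<in> W0"
    and q: "\<And>v. v \<in> W0 \<Longrightarrow> pop s q v = 0" "a * q + b * pderiv q = 1"
    and W: "fv.subspace W" "W \<subseteq> W0" "W \<subseteq> vecs n" "\<And>v. v \<in> W \<Longrightarrow> s v \<in> W"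
  shows "\<exists>W'. fv.subspace W' \<and> W' \<subseteq> W0 \<and> (\<forall>v\<in>W'. s v \<in> W') \<and> W \<inter> W' = {0} \<and>
    (\<forall>v\<in>W0. \<exists>w\<in>W. v - w \<in> W')"
proof -
  obtain A B m where AB: "lin A" "lin B" "\<And>v. A v \<in> W" "\<And>w. w \<in> W \<Longrightarrow> A (B w) = w"
    by (rule subspace_retract[OF W(1,3)]) (rule that)
  obtain \<Delta> where D: "lin \<Delta>" "\<And>v. s (\<Delta> v) - \<Delta> (s v) = pop s q (A (B v)) - A (B (pop s q v))"
    and D1: "\<And>v. v \<in> W \<Longrightarrow> \<Delta> v = pop s (pderiv q) v" and D2: "\<And>v. v \<in> W0 \<Longrightarrow> \<Delta> v \<in> W"
    using averaged_operator[OF s lin_comp[OF AB(1,2)] W(1,4) AB(4) W0 AB(3), of q] by blast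
  define P where "P = (\<lambda>v. pop s b (\<Delta> v))"
  have P: "lin P" unfolding P_def by (rule lin_comp[OF lin_pop[OF s] D(1)])
  have PW: "P v \<in> W" if "v \<in> W0" for v
    unfolding P_def by (rule pop_invariant[OF s W(4,1) D2[OF that]])
  have Pw: "P w = w" if "w \<in> W" for w
  proof -
    have "b * pderiv q = 1 - a * q" using q(2) by (simp add: algebra_simps)
    then have "P w = pop s (1 - a * q) w" using that D1 pop_mult[OF s, of b "pderiv q" w] by (simp add: P_def)
    also have "\<dots> = w" using that W q(1) by (auto simp: pop_diff pop_1 s pop_mult lin_0 lin_pop)
    finally show ?thesis .
  qed
  have comm: "s (P v) = P (s v)" if "v \<in> W0" for v
  proof -
    have "A (B v) \<in> W0" using AB(3) W(2) by blast
    then have "s (\<Delta> v) = \<Delta> (s v)" using D(2)[of v] q(1) that by (simp add: AB lin_0)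
    then show ?thesis by (simp add: P_def pop_apply_commute s)
  qed
  show ?thesis
  proof (intro exI[of _ "{v \<in> W0. P v = 0}"] conjI ballI)
    show "fv.subspace {v \<in> W0. P v = 0}" by (rule subspace_kernel[OF P W0(1)])
    show "s v \<in> {v \<in> W0. P v = 0}" if "v \<in> {v \<in> W0. P v = 0}" for v
      using that comm[of v] W0(2) by (auto simp: lin_0 s)
    show "W \<inter> {v \<in> W0. P v = 0} = {0}"
      using Pw W W0 fv.subspace_0 by (auto simp: lin_0 P)
    show "\<exists>w\<in>W. v - w \<in> {v \<in> W0. P v = 0}" if "v \<in> W0" for v
      using that PW[OF that] W W0 by (intro bexI[of _ "P v"]) (auto simp: lin_diff P Pw fv.subspace_diff)
  qed auto
qed

text \<open>The kernel of s has an s-stable complement; s is injective and nilpotent on it, so the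
  complement is 0.\<close>

lemma separable_nilpotent_zero:
  assumes s: "lin s" and U: "fv.subspace U" "U \<subseteq> vecs n" "\<And>v. v \<in> U \<Longrightarrow> s v \<in> U"
    and q: "\<And>v. v \<in> U \<Longrightarrow> pop s q v = 0" "a * q + b * pderiv q = 1"
    and nil: "\<And>v. v \<in> U \<Longrightarrow> (s ^^ k) v = 0" and v: "v \<in> U"
  shows "s v = 0"
proof -
  have "{v \<in> U. s v = 0} \<subseteq> U" "{v \<in> U. s v = 0} \<subseteq> vecs n" "\<And>v. v \<in> {v \<in> U. s v = 0} \<Longrightarrow> s v \<in> {v \<in> U. s v = 0}"
    using U fv.subspace_0[OF U(1)] by (auto simp: lin_0 s)
  from separable_complement[OF s U(1,3) q subspace_kernel[OF s U(1)] this]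
  obtain W' where W': "fv.subspace W'" "W' \<subseteq> U" "\<And>v. v \<in> W' \<Longrightarrow> s v \<in> W'"
    "{v \<in> U. s v = 0} \<inter> W' = {0}" "\<And>v. v \<in> U \<Longrightarrow> \<exists>w\<in>{v \<in> U. s v = 0}. v - w \<in> W'"
    by blast
  have zero: "w = 0" if "(s ^^ j) w = 0" "w \<in> W'" for j w
    using that
  proof (induction j arbitrary: w)
    case (Suc j)
    then have "s w = 0" using W'(3) by (simp add: funpow_swap1)
    then show ?case using Suc W' by blast
  qed simp
  obtain w where w: "w \<in> U" "s w = 0" "v - w \<in> W'" using W'(5)[OF v] by blast
  then have "v - w = 0" using zero nil W'(2) by blast
  then show ?thesis using w by simp
qed

text \<open>Taylor's formula for commuting operators. The remainder w has to commute with u and s,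
  so that the terms with a factor u are nilpotent whenever u is.\<close>

lemma pop_perturb:
  assumes s: "lin s" and u: "lin u"
    and G: "fv.subspace G" "\<And>v. v \<in> G \<Longrightarrow> s v \<in> G" "\<And>v. v \<in> G \<Longrightarrow> u v \<in> G"
    and comm: "\<And>v. v \<in> G \<Longrightarrow> s (u v) = u (s v)"
  shows "\<exists>w. lin w \<and> (\<forall>v\<in>G. w v \<in> G \<and> u (w v) = w (u v) \<and> s (w v) = w (s v) \<and>
    pop (\<lambda>v. s v + u v) q v = pop s q v + u (pop s (pderiv q) v) + u (u (w v)))"
proof (induction q)
  case 0
  then show ?case using assms by (intro exI[of _ "\<lambda>v. 0"]) (auto simp: lin_zero lin_0 fv.subspace_0)
next
  case (pCons a q)
  then obtain w where w: "lin w" "\<And>v. v \<in> G \<Longrightarrow> w v \<in> G" "\<And>v. v \<in> G \<Longrightarrow> u (w v) = w (u v)"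
    "\<And>v. v \<in> G \<Longrightarrow> s (w v) = w (s v)"
    "\<And>v. v \<in> G \<Longrightarrow> pop (\<lambda>v. s v + u v) q v = pop s q v + u (pop s (pderiv q) v) + u (u (w v))"
    by blast
  have inv: "pop s p v \<in> G" if "v \<in> G" for p v by (rule pop_invariant[OF s G(2,1) that])
  have com: "u (pop s p v) = pop s p (u v)" if "v \<in> G" for p v
    by (rule pop_commute[OF s u G(2,1) comm[symmetric] that])
  show ?case
  proof (intro exI[of _ "\<lambda>v. pop s (pderiv q) v + s (w v) + u (w v)"] conjI ballI)
    show "lin (\<lambda>v. pop s (pderiv q) v + s (w v) + u (w v))"
      by (intro lin_plus lin_pop[OF s] lin_comp[OF s w(1)] lin_comp[OF u w(1)])
    fix v assume v: "v \<in> G"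
    show "pop s (pderiv q) v + s (w v) + u (w v) \<in> G"
      using v by (intro fv.subspace_add G inv w)
    show "u (pop s (pderiv q) v + s (w v) + u (w v)) = pop s (pderiv q) (u v) + s (w (u v)) + u (w (u v))"
      using v by (simp add: lin_add u com) (metis comm w(2,3))
    show "s (pop s (pderiv q) v + s (w v) + u (w v)) = pop s (pderiv q) (s v) + s (w (s v)) + u (w (s v))"
      using v by (simp add: lin_add s pop_apply_commute) (metis comm w(2,4))
    show "pop (\<lambda>v. s v + u v) (pCons a q) v = pop s (pCons a q) v + u (pop s (pderiv (pCons a q)) v) +
          u (u (pop s (pderiv q) v + s (w v) + u (w v)))"
      using v by (simp add: pop_pCons lin_plus s u w(5) lin_add comm w inv pderiv_pCons pop_add G algebra_simps)
  qed
qed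

text \<open>The Jordan-Chevalley decomposition is \<open>T = P(T) + (T - P(T))\<close>.\<close>

lemma jordan_chevalley:
  fixes T :: "'f::field_char_0 fvec \<Rightarrow> 'f fvec"
  assumes T: "lin T" "\<And>v. v \<in> vecs n \<Longrightarrow> T v \<in> vecs n"
  shows "\<exists>\<chi> P q a b m. \<chi> \<noteq> 0 \<and> (\<forall>v\<in>vecs n. pop T \<chi> v = 0) \<and> a * q + b * pderiv q = 1 \<and>
    degree \<chi> \<le> m \<and> \<chi> dvd q ^ m \<and> q ^ m dvd pcompose q P \<and> q dvd P - [:0, 1:]"
proof -
  obtain \<chi> where chi: "\<chi> \<noteq> 0" "\<And>v. v \<in> vecs n \<Longrightarrow> pop T \<chi> v = 0"
    using operator_annihilator[OF assms] by blast
  obtain q m a b where q: "\<chi> dvd q ^ m" "a * q + b * pderiv q = 1"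
    using poly_separable_radical[OF chi(1)] by blast
  define m' where "m' = max m (degree \<chi>)"
  obtain P where P: "q ^ m' dvd pcompose q P" "q dvd P - [:0, 1:]"
    using poly_newton[OF q(2)] by blast
  have "\<chi> dvd q ^ m'" "degree \<chi> \<le> m'"
    using dvd_trans[OF q(1) le_imp_power_dvd[of m m' q]] by (auto simp: m'_def)
  then show ?thesis using chi q P by blast
qed

text \<open>The uniqueness of the Jordan decomposition stands behind this. Put T = s + u. Then q(T)
  is a multiple of u, hence nilpotent, and Newton's iteration gives y = P(T) with q(y) = 0. The
  difference d = s - y is again a multiple of u and commutes with y. Expanding q(y + d) = 0 shows d
  = d^2 g, and a nilpotent d of this kind is 0.\<close>

lemma semisimple_part_polynomial:
  assumes s: "lin s" and u: "lin u"
    and G: "\<And>v. v \<in> vecs n \<Longrightarrow> s v \<in> vecs n" "\<And>v. v \<in> vecs n \<Longrightarrow> u v \<in> vecs n"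
    and comm: "\<And>v. v \<in> vecs n \<Longrightarrow> s (u v) = u (s v)"
    and q: "\<And>v. v \<in> vecs n \<Longrightarrow> pop s q v = 0" "a * q + b * pderiv q = 1"
    and nil: "\<And>v. v \<in> vecs n \<Longrightarrow> (u ^^ k) v = 0"
  obtains P where "\<And>v. v \<in> vecs n \<Longrightarrow> pop (\<lambda>v. s v + u v) P v = s v"
proof -
  let ?G = "vecs n :: 'a fvec set"
  define T where "T = (\<lambda>v. s v + u v)"
  have T: "lin T" unfolding T_def by (rule lin_plus[OF s u])
  have TG: "T v \<in> ?G" if "v \<in> ?G" for v using that G by (simp add: T_def fv.subspace_add subspace_vecs)
  have invT: "pop T p v \<in> ?G" if "v \<in> ?G" for p v by (rule pop_invariant[OF T TG subspace_vecs that])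
  have invs: "pop s p v \<in> ?G" if "v \<in> ?G" for p v by (rule pop_invariant[OF s G(1) subspace_vecs that])
  have sT: "s (T v) = T (s v)" if "v \<in> ?G" for v using that comm by (simp add: T_def lin_add s)
  have uT: "u (T v) = T (u v)" if "v \<in> ?G" for v using that comm by (simp add: T_def lin_add u)
  have spop: "s (pop T p v) = pop T p (s v)" if "v \<in> ?G" for p v
    by (rule pop_commute[OF T s TG subspace_vecs sT that])
  \<comment> \<open>A commuting factor does not spoil nilpotency; this is applied to
    \<open>u (z v)\<close> and to \<open>u (e v)\<close>.\<close>
  have nilmul: "((\<lambda>v. u (w v)) ^^ j) v = (u ^^ j) ((w ^^ j) v)"
    if "\<And>v. v \<in> ?G \<Longrightarrow> w v \<in> ?G" "\<And>v. v \<in> ?G \<Longrightarrow> u (w v) = w (u v)" "v \<in> ?G" for w j v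
  proof (induction j)
    case (Suc j)
    have 1: "(w ^^ j) v \<in> ?G" using that by (intro funpow_invariant)
    have "w ((u ^^ j) x) = (u ^^ j) (w x)" if "x \<in> ?G" for x
    proof (induction j)
      case (Suc j)
      have "(u ^^ j) x \<in> ?G" using G that by (intro funpow_invariant)
      then show ?case using Suc \<open>\<And>v. v \<in> ?G \<Longrightarrow> u (w v) = w (u v)\<close>[of "(u ^^ j) x"] by simp
    qed simp
    then show ?case using Suc 1 by simp
  qed simp
  obtain P where P: "q ^ k dvd pcompose q P" "q dvd P - [:0, 1:]"
    using poly_newton[OF q(2)] by blast
  obtain c where c: "P = [:0, 1:] + q * c" using P(2) by (metis add_diff_cancel_left' diff_add_cancel dvdE add.commute)
  define y where "y = pop T P"
  have y: "lin y" unfolding y_def by (rule lin_pop[OF T])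
  obtain w where w: "lin w" "\<And>v. v \<in> ?G \<Longrightarrow> w v \<in> ?G" "\<And>v. v \<in> ?G \<Longrightarrow> u (w v) = w (u v)"
    "\<And>v. v \<in> ?G \<Longrightarrow> pop T q v = pop s q v + u (pop s (pderiv q) v) + u (u (w v))"
    using pop_perturb[OF s u subspace_vecs G comm, of q] unfolding T_def by blast
  have upop: "u (pop s p v) = pop s p (u v)" if "v \<in> ?G" for p v
    by (rule pop_commute[OF s u G(1) subspace_vecs comm[symmetric] that])
  define z where "z = (\<lambda>v. pop s (pderiv q) v + u (w v))"
  have zG: "z v \<in> ?G" if "v \<in> ?G" for v
    using that by (auto simp: z_def intro!: fv.subspace_add subspace_vecs invs G w)
  have uz: "u (z v) = z (u v)" if "v \<in> ?G" for v
    using that w by (simp add: z_def lin_add u upop)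
  have qz: "pop T q v = u (z v)" if "v \<in> ?G" for v
    using that w q by (simp add: z_def lin_add u)
  have qnil: "pop T (q ^ k) v = 0" if "v \<in> ?G" for v
  proof -
    have "(pop T q ^^ k) v = ((\<lambda>v. u (z v)) ^^ k) v"
      using funpow_intertwine[of ?G "\<lambda>v. v" "\<lambda>v. u (z v)" "pop T q" v k] G(2)[OF zG] qz that by simp
    also have "\<dots> = 0" using nilmul[of z v k, OF zG uz that] nil funpow_invariant[of ?G z, OF zG that] by simp
    finally show ?thesis by (simp add: pop_power T)
  qed
  have qy: "pop y q v = 0" if "v \<in> ?G" for v
    using pop_dvd_zero[OF T P(1) qnil[OF that]] by (simp add: y_def pop_pcompose T)
  define d where "d = (\<lambda>v. s v - y v)"
  have d: "lin d" unfolding d_def by (rule lin_sub[OF s y])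
  have yG: "y v \<in> ?G" if "v \<in> ?G" for v using invT that by (simp add: y_def)
  have dG: "d v \<in> ?G" if "v \<in> ?G" for v
    using that yG G by (simp add: d_def fv.subspace_diff subspace_vecs)
  define e where "e = (\<lambda>v. - v - z (pop T c v))"
  have uc: "u (pop T p v) = pop T p (u v)" if "v \<in> ?G" for p v
    by (rule pop_commute[OF T u TG subspace_vecs uT that])
  have de: "d v = u (e v)" if "v \<in> ?G" for v
  proof -
    have "y v = T v + u (z (pop T c v))"
      using that invT qz by (simp add: y_def c pop_add pop_X pop_mult T)
    then show ?thesis by (simp add: d_def e_def T_def lin_diff lin_minus u)
  qed
  have eG: "e v \<in> ?G" if "v \<in> ?G" for v
    using that zG invT by (auto simp: e_def intro!: fv.subspace_diff fv.subspace_neg subspace_vecs)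
  have ue: "u (e v) = e (u v)" if "v \<in> ?G" for v
    using that by (simp add: e_def lin_diff lin_minus u uz invT uc)
  have dnil: "(d ^^ k) v = 0" if "v \<in> ?G" for v
  proof -
    have "(d ^^ k) v = ((\<lambda>v. u (e v)) ^^ k) v"
      using funpow_intertwine[of ?G "\<lambda>v. v" "\<lambda>v. u (e v)" d v k] dG de that by simp
    also have "\<dots> = 0" using nilmul[of e v k, OF eG ue that] nil funpow_invariant[of ?G e, OF eG that] by simp
    finally show ?thesis .
  qed
  have yd: "y (d v) = d (y v)" if "v \<in> ?G" for v
    using spop[OF that] by (simp add: d_def lin_diff y) (simp add: y_def)
  obtain x where x: "lin x" "\<And>v. v \<in> ?G \<Longrightarrow> x v \<in> ?G" "\<And>v. v \<in> ?G \<Longrightarrow> d (x v) = x (d v)"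
    "\<And>v. v \<in> ?G \<Longrightarrow> pop (\<lambda>v. y v + d v) q v = pop y q v + d (pop y (pderiv q) v) + d (d (x v))"
    using pop_perturb[OF y d subspace_vecs yG dG yd, of q] by blast
  have ys: "(\<lambda>v. y v + d v) = s" by (auto simp: d_def)
  have eq0: "d (pop y (pderiv q) v) = - d (d (x v))" if "v \<in> ?G" for v
    using x(4)[OF that] q(1)[OF that] qy[OF that] unfolding ys by (simp add: eq_neg_iff_add_eq_0)
  have invy: "pop y p v \<in> ?G" if "v \<in> ?G" for p v by (rule pop_invariant[OF y yG subspace_vecs that])
  define g where "g = (\<lambda>v. - x (pop y b v))"
  have gG: "g v \<in> ?G" if "v \<in> ?G" for v
    using that x invy by (simp add: g_def fv.subspace_neg subspace_vecs)
  \<comment> \<open>Since q(y) = 0, b(y) inverts q'(y), so that \<open>eq0\<close> can be solved for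
    d.\<close>
  have dg: "d v = d (d (g v))" if "v \<in> ?G" for v
  proof -
    have "v = pop y (pderiv q * b + a * q) v" using q(2) by (simp add: algebra_simps pop_1 y)
    also have "\<dots> = pop y (pderiv q) (pop y b v)" using qy[OF that] by (simp add: pop_add pop_mult y lin_0 lin_pop)
    finally have "d v = d (pop y (pderiv q) (pop y b v))" by simp
    also have "\<dots> = d (d (g v))" using eq0[OF invy[OF that]] by (simp add: g_def lin_minus d)
    finally show ?thesis .
  qed
  have "\<exists>w\<in>?G. d v = (d ^^ Suc j) w" if "v \<in> ?G" for v j
  proof (induction j)
    case 0
    then show ?case using that by auto
  next
    case (Suc j)
    then obtain w where w: "w \<in> ?G" "d v = (d ^^ Suc j) w" by blast
    then have "d v = (d ^^ j) (d (d (g w)))" using dg by (simp add: funpow_swap1)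
    then show ?case using gG w by (intro bexI[of _ "g w"]) (simp_all add: funpow_swap1)
  qed
  then have "d v = 0" if "v \<in> ?G" for v
    using that dnil funpow_zero_mono[OF d, of k _ "Suc k"] by (metis le_add2 plus_1_eq_Suc)
  then show ?thesis using that[of P] by (simp add: d_def y_def T_def)
qed

subsection \<open>Spectral projections\<close>

text \<open>Up to the factor y(c), y is 1 - k with k(c) = 0; the geometric series inverts 1 - k
  modulo \<open>k ^ m\<close>.\<close>

lemma poly_inverse_mod_linear_power:
  fixes y :: "'f::field poly"
  assumes "poly y c \<noteq> 0"
  shows "\<exists>z. [:- c, 1:] ^ m dvd 1 - y * z"
proof -
  define k where "k = 1 - Polynomial.smult (inverse (poly y c)) y"
  have "poly k c = 0" using assms by (simp add: k_def)
  then have "[:- c, 1:] ^ m dvd k ^ m" by (simp add: poly_eq_0_iff_dvd dvd_power_same)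
  moreover have "1 - k dvd 1 - k ^ m"
    using diff_power_eq_sum[of 1 "m - 1" k] by (cases m) auto
  then have "y dvd 1 - k ^ m" using assms by (auto simp: k_def Polynomial.smult_dvd_iff)
  then obtain z where "1 - k ^ m = y * z" by auto
  ultimately show ?thesis by (intro exI[of _ z]) (metis diff_diff_eq2 add_diff_cancel_left')
qed

lemma linear_power_dvd_cancel:
  fixes y Q :: "'f::field poly"
  assumes "poly y c \<noteq> 0" "[:- c, 1:] ^ m dvd y * Q"
  shows "[:- c, 1:] ^ m dvd Q"
proof -
  obtain z where "[:- c, 1:] ^ m dvd 1 - y * z" using poly_inverse_mod_linear_power[OF assms(1)] by blast
  then have "[:- c, 1:] ^ m dvd (1 - y * z) * Q + y * Q * z"
    using assms(2) by (intro dvd_add dvd_mult2[of _ "1 - y * z"] dvd_mult2[of _ "y * Q"])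
  also have "(1 - y * z) * Q + y * Q * z = Q" by (simp add: algebra_simps)
  finally show ?thesis .
qed

lemma linear_powers_prod_dvd:
  fixes Q :: "'f::field poly"
  assumes "finite C" "\<And>c. c \<in> C \<Longrightarrow> [:- c, 1:] ^ m dvd Q"
  shows "(\<Prod>c\<in>C. [:- c, 1:] ^ m) dvd Q"
  using assms
proof (induction C)
  case (insert c C)
  then obtain R where R: "Q = (\<Prod>c\<in>C. [:- c, 1:] ^ m) * R" by (metis dvdE insertI2)
  have "poly (\<Prod>c\<in>C. [:- c, 1:] ^ m) c \<noteq> 0" using insert by (auto simp: poly_prod)
  then have "[:- c, 1:] ^ m dvd R"
    using linear_power_dvd_cancel insert.prems[of c] unfolding R by blast
  then show ?case using insert.hyps R by (simp add: mult_dvd_mono mult.commute)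
qed simp

text \<open>The idempotents of the Chinese remainder theorem.\<close>

lemma linear_powers_partition:
  fixes C :: "'f::field set"
  assumes "finite C"
  obtains e where "\<And>c d. c \<in> C \<Longrightarrow> d \<in> C \<Longrightarrow> d \<noteq> c \<Longrightarrow> [:- d, 1:] ^ m dvd e c"
    "\<And>c. c \<in> C \<Longrightarrow> [:- c, 1:] ^ m dvd e c - 1"
proof -
  define h where "h c = (\<Prod>d\<in>C - {c}. [:- d, 1:] ^ m)" for c :: 'f
  have "poly (h c) c \<noteq> 0" for c using assms by (auto simp: h_def poly_prod)
  then have "\<forall>c. \<exists>z. [:- c, 1:] ^ m dvd 1 - h c * z" using poly_inverse_mod_linear_power by blast
  then obtain z where z: "[:- c, 1:] ^ m dvd 1 - h c * z c" for c by metis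
  have 1: "[:- c, 1:] ^ m dvd h c * z c - 1" for c using z[of c] by (metis dvd_minus_iff minus_diff_eq)
  have "[:- d, 1:] ^ m dvd h c * z c" if "d \<in> C" "d \<noteq> c" for c d
    using assms that unfolding h_def by (intro dvd_mult2 dvd_prodI) auto
  with 1 show ?thesis using that[of "\<lambda>c. h c * z c"] by blast
qed

lemma linear_powers_interpolation:
  fixes C :: "'f::field set"
  assumes "finite C"
  shows "\<exists>p. \<forall>c\<in>C. [:- c, 1:] ^ m dvd p - [:f c:]"
proof -
  obtain e where e: "\<And>c d. c \<in> C \<Longrightarrow> d \<in> C \<Longrightarrow> d \<noteq> c \<Longrightarrow> [:- d, 1:] ^ m dvd e c"
    "\<And>c. c \<in> C \<Longrightarrow> [:- c, 1:] ^ m dvd e c - 1"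
    by (rule linear_powers_partition[OF assms, of m]) (rule that)
  define p where "p = (\<Sum>c\<in>C. Polynomial.smult (f c) (e c))"
  have "[:- c, 1:] ^ m dvd p - [:f c:]" if "c \<in> C" for c
  proof -
    have "p - [:f c:] = Polynomial.smult (f c) (e c - 1) + (\<Sum>d\<in>C - {c}. Polynomial.smult (f d) (e d))"
      using assms that by (simp add: p_def sum.remove smult_diff_right one_pCons)
    also have "[:- c, 1:] ^ m dvd \<dots>"
      using e that by (intro dvd_add dvd_smult dvd_sum) auto
    finally show ?thesis .
  qed
  then show ?thesis by blast
qed

text \<open>The common exponent m, at least the degree, stands in for the individual multiplicities
  of the roots.\<close>

lemma dvd_linear_powers_prod:
  fixes \<chi> :: "'k::alg_closed_field poly"
  assumes "\<chi> \<noteq> 0" "degree \<chi> \<le> m"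
  shows "\<chi> dvd (\<Prod>c\<in>{c. poly \<chi> c = 0}. [:- c, 1:] ^ m)"
proof -
  obtain A where A: "size A = degree \<chi>" "\<chi> = Polynomial.smult (Polynomial.lead_coeff \<chi>) (\<Prod>x\<in>#A. [:- x, 1:])"
    using alg_closed_imp_factorization[OF assms(1)] by blast
  have lc: "Polynomial.lead_coeff \<chi> \<noteq> 0" using assms by simp
  have set: "{c. poly \<chi> c = 0} = set_mset A"
    by (subst A(2)) (use lc in \<open>auto simp: poly_prod_mset\<close>)
  have "(\<Prod>x\<in>#A. [:- x, 1:]) = (\<Prod>x\<in>set_mset A. [:- x, 1:] ^ count A x)"
    by (rule image_prod_mset_multiplicity)
  also have "\<dots> dvd (\<Prod>x\<in>set_mset A. [:- x, 1:] ^ m)"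
    using A(1) assms(2) by (intro prod_dvd_prod le_imp_power_dvd) (metis count_le_size order_trans)
  finally show ?thesis unfolding set using lc by (subst A(2)) (simp add: Polynomial.smult_dvd_iff)
qed

lemma pop_dvd_diff_const:
  assumes "lin T" "q dvd p - [:c:]" "pop T q v = 0"
  shows "pop T p v = smul c v"
  using pop_dvd_zero[OF assms] assms(1) by (simp add: pop_diff pop_const)

locale split_operator =
  fixes T :: "'k::alg_closed_field fvec \<Rightarrow> 'k fvec" and n :: nat and \<chi> :: "'k poly" and m :: nat
  assumes lin_T: "lin T" and T_vecs: "\<And>v. v \<in> vecs n \<Longrightarrow> T v \<in> vecs n"
    and chi: "\<chi> \<noteq> 0" "degree \<chi> \<le> m" and annihilates: "\<And>v. v \<in> vecs n \<Longrightarrow> pop T \<chi> v = 0"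
begin

text \<open>The roots of the chosen annihilator. Among them may be numbers that are no eigenvalues;
  their \<open>multiplicity_of\<close> is 0.\<close>

definition spectrum :: "'k set" where
  "spectrum = {c. poly \<chi> c = 0}"

lemma finite_spectrum: "finite spectrum"
  using chi by (simp add: spectrum_def poly_roots_finite)

definition "eproj = (SOME e. (\<forall>c\<in>spectrum. \<forall>d\<in>spectrum. d \<noteq> c \<longrightarrow> [:- d, 1:] ^ m dvd e c) \<and>
  (\<forall>c\<in>spectrum. [:- c, 1:] ^ m dvd e c - 1))"

lemma eproj:
  "c \<in> spectrum \<Longrightarrow> d \<in> spectrum \<Longrightarrow> d \<noteq> c \<Longrightarrow> [:- d, 1:] ^ m dvd eproj c"
  "c \<in> spectrum \<Longrightarrow> [:- c, 1:] ^ m dvd eproj c - 1"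
proof -
  have "\<exists>e. (\<forall>c\<in>spectrum. \<forall>d\<in>spectrum. d \<noteq> c \<longrightarrow> [:- d, 1:] ^ m dvd e c) \<and>
    (\<forall>c\<in>spectrum. [:- c, 1:] ^ m dvd e c - 1)"
    by (rule linear_powers_partition[OF finite_spectrum, of m]) blast
  from someI_ex[OF this] show
    "c \<in> spectrum \<Longrightarrow> d \<in> spectrum \<Longrightarrow> d \<noteq> c \<Longrightarrow> [:- d, 1:] ^ m dvd eproj c"
    "c \<in> spectrum \<Longrightarrow> [:- c, 1:] ^ m dvd eproj c - 1"
    unfolding eproj_def by blast+
qed

lemma zero_if_local:
  assumes "\<And>c. c \<in> spectrum \<Longrightarrow> [:- c, 1:] ^ m dvd p" "v \<in> vecs n"
  shows "pop T p v = 0"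
proof -
  have "\<chi> dvd p"
    using dvd_linear_powers_prod[OF chi] linear_powers_prod_dvd[OF finite_spectrum assms(1)]
    unfolding spectrum_def by (meson dvd_trans)
  then show ?thesis using pop_dvd_zero[OF lin_T _ annihilates] assms(2) by blast
qed

lemma eproj_vecs: "v \<in> vecs n \<Longrightarrow> pop T p v \<in> vecs n"
  by (rule pop_invariant[OF lin_T T_vecs subspace_vecs])

lemma eproj_annihilated:
  assumes "c \<in> spectrum" "v \<in> vecs n"
  shows "pop T ([:- c, 1:] ^ m) (pop T (eproj c) v) = 0"
proof -
  have "pop T ([:- c, 1:] ^ m * eproj c) v = 0"
    using eproj(1)[OF assms(1)] by (intro zero_if_local assms) (metis dvd_mult dvd_triv_left)
  then show ?thesis by (simp add: pop_mult lin_T)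
qed

lemma eproj_orthogonal:
  assumes "c \<in> spectrum" "d \<in> spectrum" "c \<noteq> d" "v \<in> vecs n"
  shows "pop T (eproj c) (pop T (eproj d) v) = 0"
proof -
  have "pop T (eproj c * eproj d) v = 0"
    using eproj(1) assms by (intro zero_if_local assms) (metis dvd_mult dvd_mult2)
  then show ?thesis by (simp add: pop_mult lin_T)
qed

lemma eproj_sum:
  assumes "v \<in> vecs n"
  shows "v = (\<Sum>c\<in>spectrum. pop T (eproj c) v)"
proof -
  have "pop T ((\<Sum>c\<in>spectrum. eproj c) - 1) v = 0"
  proof (rule zero_if_local[OF _ assms])
    fix c assume c: "c \<in> spectrum"
    have "(\<Sum>c\<in>spectrum. eproj c) - 1 = (eproj c - 1) + (\<Sum>d\<in>spectrum - {c}. eproj d)"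
      using finite_spectrum c by (simp add: sum.remove)
    also have "[:- c, 1:] ^ m dvd \<dots>"
      using eproj c by (intro dvd_add dvd_sum) auto
    finally show "[:- c, 1:] ^ m dvd (\<Sum>c\<in>spectrum. eproj c) - 1" .
  qed
  then show ?thesis by (simp add: pop_diff pop_sum pop_1 lin_T)
qed

text \<open>The dimension of the generalised eigenspace of c, that is its algebraic
  multiplicity.\<close>

definition multiplicity_of :: "'k \<Rightarrow> nat" where
  "multiplicity_of c = fv.dim (pop T (eproj c) ` vecs n)"

lemma multiplicity_eq_0:
  assumes "multiplicity_of c = 0" "v \<in> vecs n"
  shows "pop T (eproj c) v = 0"
proof -
  have "pop T (eproj c) ` vecs n = {0}"
    using assms(1) unfolding multiplicity_of_def
    by (intro dim_eq_0[of _ n]) (auto intro!: subspace_image lin_pop lin_T subspace_vecs eproj_vecs)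
  then show ?thesis using assms(2) by blast
qed

text \<open>On the generalised eigenspace of c the operator p(T) - p(c) is nilpotent and contributes
  no trace.\<close>

lemma tr_pop_spectrum: "tr n (pop T p) = (\<Sum>c\<in>spectrum. poly p c * of_nat (multiplicity_of c))"
proof -
  have local: "tr n (\<lambda>v. pop T p (pop T (eproj c) v)) = poly p c * of_nat (multiplicity_of c)"
    if c: "c \<in> spectrum" for c
  proof -
    let ?E = "pop T (eproj c)" and ?N = "pop T ((p - [:poly p c:]) * eproj c)"
    have m0: "m > 0"
    proof (rule ccontr)
      assume "\<not> m > 0"
      then have "degree \<chi> = 0" using chi by simp
      then show False using c chi by (auto simp: spectrum_def elim!: degree_eq_zeroE)
    qed
    have idem: "?E (?E v) = ?E v" if v: "v \<in> vecs n" for v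
    proof -
      have "?E v = ?E (\<Sum>d\<in>spectrum. pop T (eproj d) v)" using eproj_sum[OF v] by simp
      also have "\<dots> = (\<Sum>d\<in>spectrum. ?E (pop T (eproj d) v))"
        by (rule lin_sum[OF lin_pop[OF lin_T]])
      also have "\<dots> = (\<Sum>d\<in>spectrum. if d = c then ?E (?E v) else 0)"
        by (rule sum.cong) (use eproj_orthogonal[OF c] v in auto)
      also have "\<dots> = ?E (?E v)" using finite_spectrum c by simp
      finally show ?thesis by simp
    qed
    have "[:- c, 1:] dvd p - [:poly p c:]" by (simp add: poly_eq_0_iff_dvd[symmetric])
    then have dvd: "[:- c, 1:] ^ m dvd (p - [:poly p c:]) ^ m" by (rule dvd_power_same)
    have "(?N ^^ m) v = 0" if v: "v \<in> vecs n" for v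
    proof -
      have "eproj c dvd eproj c ^ m" using m0 by (simp add: dvd_power)
      then have "[:- c, 1:] ^ m * eproj c dvd ((p - [:poly p c:]) * eproj c) ^ m"
        unfolding power_mult_distrib using dvd by (rule mult_dvd_mono[rotated])
      then show ?thesis
        using pop_dvd_zero[OF lin_T] eproj_annihilated[OF c v] by (simp add: pop_power[symmetric] pop_mult[symmetric] lin_T)
    qed
    then have "tr n ?N = 0"
      by (intro tr_nilpotent[where k = m] lin_pop lin_T eproj_vecs)
    have "tr n (\<lambda>v. pop T p (?E v)) = tr n (\<lambda>v. smul (poly p c) (?E v) + ?N v)"
      by (rule tr_cong) (simp add: pop_mult pop_diff pop_const lin_T)
    also have "\<dots> = poly p c * tr n ?E" using \<open>tr n ?N = 0\<close> by (simp add: tr_add tr_smul)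
    also have "tr n ?E = of_nat (multiplicity_of c)"
      unfolding multiplicity_of_def by (rule tr_idempotent) (auto intro: lin_pop lin_T eproj_vecs idem)
    finally show ?thesis .
  qed
  have "tr n (pop T p) = tr n (\<lambda>v. \<Sum>c\<in>spectrum. pop T p (pop T (eproj c) v))"
  proof (rule tr_cong)
    fix v :: "'k fvec" assume "v \<in> vecs n"
    have "pop T p v = pop T p (\<Sum>c\<in>spectrum. pop T (eproj c) v)" using eproj_sum[OF \<open>v \<in> vecs n\<close>] by simp
    then show "pop T p v = (\<Sum>c\<in>spectrum. pop T p (pop T (eproj c) v))"
      by (simp add: lin_sum[OF lin_pop[OF lin_T]])
  qed
  also have "\<dots> = (\<Sum>c\<in>spectrum. tr n (\<lambda>v. pop T p (pop T (eproj c) v)))"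
    unfolding tr_def by (simp add: cf_sum) (rule sum.swap)
  finally show ?thesis using local by simp
qed

lemma nilpotent_if_multiplicities_zero:
  assumes "\<And>c. c \<in> spectrum \<Longrightarrow> c \<noteq> 0 \<Longrightarrow> multiplicity_of c = 0" "v \<in> vecs n"
  shows "(T ^^ m) v = 0"
proof -
  have "pop T ([:0, 1:] ^ m) (pop T (eproj c) v) = 0" if "c \<in> spectrum" for c
    using eproj_annihilated[OF that assms(2)] assms multiplicity_eq_0[of c v] that
    by (cases "c = 0") (auto simp: lin_0 lin_pop lin_T)
  then have "pop T ([:0, 1:] ^ m) v = 0"
    by (subst eproj_sum[OF assms(2)]) (simp add: lin_sum[OF lin_pop[OF lin_T]])
  then show ?thesis by (simp add: pop_X_power lin_T)
qed

end

subsection \<open>Derivations and extension of scalars\<close>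

definition bilin :: "('f::field fvec \<Rightarrow> 'f fvec \<Rightarrow> 'f fvec) \<Rightarrow> bool" where
  "bilin br \<longleftrightarrow> (\<forall>v. lin (\<lambda>u. br u v)) \<and> (\<forall>u. lin (br u))"

lemma bilinD: "bilin br \<Longrightarrow> lin (\<lambda>u. br u v)" "bilin br \<Longrightarrow> lin (br u)"
  by (auto simp: bilin_def)

definition derivation_on :: "'f::field fvec set \<Rightarrow> ('f fvec \<Rightarrow> 'f fvec \<Rightarrow> 'f fvec) \<Rightarrow> ('f fvec \<Rightarrow> 'f fvec) \<Rightarrow> bool" where
  "derivation_on G br D \<longleftrightarrow> (\<forall>u\<in>G. \<forall>v\<in>G. D (br u v) = br (D u) v + br u (D v))"

text \<open>The binomial formula for an operator C that acts on products as A on the left factor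
  plus B on the right one. The three are kept apart because T - (a + b), T - a and T - b will play
  these roles.\<close>

lemma leibniz_nilpotent:
  assumes br: "bilin br" and C: "lin C"
    and G: "\<And>u. u \<in> G \<Longrightarrow> A u \<in> G" "\<And>u. u \<in> G \<Longrightarrow> B u \<in> G"
    and leib: "\<And>u v. u \<in> G \<Longrightarrow> v \<in> G \<Longrightarrow> C (br u v) = br (A u) v + br u (B v)"
  shows "u \<in> G \<Longrightarrow> v \<in> G \<Longrightarrow> (A ^^ i) u = 0 \<Longrightarrow> (B ^^ j) v = 0 \<Longrightarrow> (C ^^ (i + j)) (br u v) = 0"
proof (induction "i + j" arbitrary: i j u v)
  case 0
  then show ?case using lin_0[OF bilinD(1)[OF br]] by simp
next
  case (Suc k)
  show ?case
  proof (cases "i = 0 \<or> j = 0")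
    case True
    then have "u = 0 \<or> v = 0" using Suc.prems by auto
    then have "br u v = 0" using lin_0[OF bilinD(1)[OF br]] lin_0[OF bilinD(2)[OF br]] by auto
    then show ?thesis using lin_0[OF lin_funpow[OF C]] by simp
  next
    case False
    then obtain i' j' where ij: "i = Suc i'" "j = Suc j'" by (metis not0_implies_Suc)
    have "(C ^^ (i' + j)) (br (A u) v) = 0"
      using Suc.prems Suc.hyps G by (intro Suc.hyps(1)) (auto simp: ij funpow_swap1)
    moreover have "(C ^^ (i + j')) (br u (B v)) = 0"
      using Suc.prems Suc.hyps G by (intro Suc.hyps(1)) (auto simp: ij funpow_swap1)
    moreover have "(C ^^ (i + j)) (br u v) = (C ^^ (i' + j)) (C (br u v))"
      by (simp add: ij funpow_swap1)
    ultimately show ?thesis using leib Suc.prems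
      by (simp add: ij lin_add[OF C] lin_add[OF lin_funpow[OF C]])
  qed
qed

text \<open>The bracket sends the generalised eigenspaces for a and b into that for a + b, where the
  operator acts as the scalar f(a + b) = f(a) + f(b).\<close>

lemma (in split_operator) derivation_polynomial:
  assumes br: "bilin br" and closed: "\<And>u v. u \<in> vecs n \<Longrightarrow> v \<in> vecs n \<Longrightarrow> br u v \<in> vecs n"
    and D: "derivation_on (vecs n) br T"
    and f: "\<And>a b. f (a + b) = f a + f b"
    and p: "\<And>c. c \<in> spectrum \<Longrightarrow> [:- c, 1:] ^ m dvd p - [:f c:]"
  shows "derivation_on (vecs n) br (pop T p)"
proof -
  \<comment> \<open>A sum a + b need not be a root of \<chi>, and a product is only known to be
    killed by the power m + m of T - (a + b). So p is replaced by r, which interpolates f at the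
    sums too and with exponent m + m; by \<open>pr\<close> both polynomials act alike.\<close>
  define C where "C = spectrum \<union> (\<lambda>(a, b). a + b) ` (spectrum \<times> spectrum)"
  have "finite C" using finite_spectrum by (simp add: C_def)
  then obtain r where r: "\<And>c. c \<in> C \<Longrightarrow> [:- c, 1:] ^ (m + m) dvd r - [:f c:]"
    using linear_powers_interpolation[of C "m + m" f] by blast
  have pr: "pop T p v = pop T r v" if v: "v \<in> vecs n" for v
  proof -
    have "pop T (p - r) v = 0"
    proof (rule zero_if_local[OF _ v])
      fix c assume c: "c \<in> spectrum"
      have "[:- c, 1:] ^ m dvd r - [:f c:]"
        using r[of c] c by (auto simp: C_def power_add dest: dvd_mult_left)
      then have "[:- c, 1:] ^ m dvd (p - [:f c:]) - (r - [:f c:])" using p[OF c] by (rule dvd_diff[rotated])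
      then show "[:- c, 1:] ^ m dvd p - r" by simp
    qed
    then show ?thesis by (simp add: pop_diff lin_T)
  qed
  let ?N = "\<lambda>c. pop T [:- c, 1:]"
  have N: "?N c v = T v - smul c v" for c v by (simp add: pop_pCons lin_T lin_0)
  have scalar: "pop T r v = smul (f c) v" if "c \<in> C" "(?N c ^^ (m + m)) v = 0" for c v
    using that by (intro pop_dvd_diff_const[OF lin_T r]) (simp_all add: pop_power lin_T)
  have homog: "pop T r (br u v) = br (pop T r u) v + br u (pop T r v)"
    if a: "a \<in> spectrum" "u \<in> vecs n" "(?N a ^^ m) u = 0"
    and b: "b \<in> spectrum" "v \<in> vecs n" "(?N b ^^ m) v = 0" for a b u v
  proof -
    have "(?N (a + b) ^^ (m + m)) (br u v) = 0"
    proof (rule leibniz_nilpotent[OF br lin_pop[OF lin_T] _ _ _ a(2) b(2) a(3) b(3)])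
      show "?N (a + b) (br u v) = br (?N a u) v + br u (?N b v)" if "u \<in> vecs n" "v \<in> vecs n" for u v
        using D that unfolding N derivation_on_def
        by (simp add: lin_diff[OF bilinD(1)[OF br]] lin_diff[OF bilinD(2)[OF br]]
          lin_smul[OF bilinD(1)[OF br]] lin_smul[OF bilinD(2)[OF br]] fv.scale_left_distrib)
    qed (auto intro: eproj_vecs)
    moreover have "(?N a ^^ (m + m)) u = 0" "(?N b ^^ (m + m)) v = 0"
      using a b by (auto intro: funpow_zero_mono[OF lin_pop[OF lin_T], of m])
    moreover have "a \<in> C" "b \<in> C" "a + b \<in> C" using a b by (auto simp: C_def)
    ultimately show ?thesis
      by (simp add: scalar f lin_smul[OF bilinD(1)[OF br]] lin_smul[OF bilinD(2)[OF br]] fv.scale_left_distrib)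
  qed
  have ann: "(?N c ^^ m) (pop T (eproj c) v) = 0" if "c \<in> spectrum" "v \<in> vecs n" for c v
    using eproj_annihilated[OF that] by (simp add: pop_power lin_T)
  have br_sum: "br (\<Sum>a\<in>A. g a) (\<Sum>b\<in>B. h b) = (\<Sum>a\<in>A. \<Sum>b\<in>B. br (g a) (h b))" for g h and A B :: "'k set"
    by (simp add: lin_sum[OF bilinD(1)[OF br]]) (simp add: lin_sum[OF bilinD(2)[OF br]])
  note pop_sums = lin_sum[OF lin_pop[OF lin_T]]
  have "pop T r (br u v) = br (pop T r u) v + br u (pop T r v)" if "u \<in> vecs n" "v \<in> vecs n" for u v
  proof -
    let ?u = "\<lambda>c. pop T (eproj c) u" and ?v = "\<lambda>c. pop T (eproj c) v"
    have "pop T r (br (\<Sum>a\<in>spectrum. ?u a) (\<Sum>b\<in>spectrum. ?v b)) =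
        (\<Sum>a\<in>spectrum. \<Sum>b\<in>spectrum. br (pop T r (?u a)) (?v b) + br (?u a) (pop T r (?v b)))"
      unfolding br_sum pop_sums
      by (intro sum.cong refl) (rule homog[OF _ eproj_vecs ann _ eproj_vecs ann], use that in auto)
    also have "\<dots> = br (pop T r (\<Sum>a\<in>spectrum. ?u a)) (\<Sum>b\<in>spectrum. ?v b) + br (\<Sum>a\<in>spectrum. ?u a) (pop T r (\<Sum>b\<in>spectrum. ?v b))"
      unfolding pop_sums br_sum by (simp add: sum.distrib)
    finally show ?thesis using eproj_sum that by metis
  qed
  then show ?thesis using pr closed by (simp add: derivation_on_def)
qed

section \<open>Base change of vectors, operators and brackets to the algebraic closure\<close>

definition ac_vec :: "'f::field fvec \<Rightarrow> 'f alg_closure fvec" where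
  "ac_vec v = mkv (\<lambda>i. to_ac (cf v i))"

text \<open>The matrix of T on \<open>vecs n\<close>, read over the closure.\<close>

definition ac_op :: "nat \<Rightarrow> ('f::field fvec \<Rightarrow> 'f fvec) \<Rightarrow> 'f alg_closure fvec \<Rightarrow> 'f alg_closure fvec" where
  "ac_op n T v = (\<Sum>j<n. smul (cf v j) (ac_vec (T (evec j))))"

definition ac_br :: "nat \<Rightarrow> ('f::field fvec \<Rightarrow> 'f fvec \<Rightarrow> 'f fvec) \<Rightarrow>
    'f alg_closure fvec \<Rightarrow> 'f alg_closure fvec \<Rightarrow> 'f alg_closure fvec" where
  "ac_br n br u v = (\<Sum>j<n. \<Sum>k<n. smul (cf u j * cf v k) (ac_vec (br (evec j) (evec k))))"

lemma cf_ac_vec [simp]: "cf (ac_vec v) i = to_ac (cf v i)"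
  by (simp add: ac_vec_def)

lemma ac_vec_add: "ac_vec (u + v) = ac_vec u + ac_vec v"
  by (simp add: fvec_eq_iff)

lemma ac_vec_smul: "ac_vec (smul c v) = smul (to_ac c) (ac_vec v)"
  by (simp add: fvec_eq_iff)

lemma ac_vec_sum: "ac_vec (\<Sum>i\<in>A. f i) = (\<Sum>i\<in>A. ac_vec (f i))"
  by (simp add: fvec_eq_iff cf_sum to_ac_sum)

lemma ac_vec_0 [simp]: "ac_vec 0 = 0"
  by (simp add: fvec_eq_iff)

lemma ac_vec_evec [simp]: "ac_vec (evec i) = evec i"
  by (simp add: fvec_eq_iff evec_def)

lemma ac_vec_inj: "ac_vec u = ac_vec v \<longleftrightarrow> u = v"
  by (simp add: fvec_eq_iff)

lemma ac_vec_vecs: "ac_vec v \<in> vecs n \<longleftrightarrow> v \<in> vecs n"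
  by (simp add: vecs_def)

lemma lin_ac_op: "lin (ac_op n T)"
  unfolding ac_op_def by (rule linI) (simp_all add: fv.scale_left_distrib sum.distrib fv.scale_sum_right)

lemma ac_op_vecs:
  assumes "\<And>v. v \<in> vecs n \<Longrightarrow> T v \<in> vecs n"
  shows "ac_op n T v \<in> vecs n"
  unfolding ac_op_def using assms
  by (intro fv.subspace_sum fv.subspace_scale subspace_vecs) (auto simp: ac_vec_vecs)

lemma ac_op_ac_vec:
  assumes "lin T" "v \<in> vecs n"
  shows "ac_op n T (ac_vec v) = ac_vec (T v)"
proof -
  have "ac_vec (T v) = ac_vec (\<Sum>j<n. smul (cf v j) (T (evec j)))"
    using vecs_expand[OF assms(2)] by (metis (no_types, lifting) assms(1) lin_smul lin_sum sum.cong)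
  then show ?thesis by (simp add: ac_op_def ac_vec_sum ac_vec_smul)
qed

lemma bilin_ac_br: "bilin (ac_br n br)"
  unfolding bilin_def ac_br_def
  by (intro conjI allI linI) (simp_all add: fv.scale_left_distrib ring_distribs sum.distrib fv.scale_sum_right mult.assoc mult.left_commute)

lemma ac_br_vecs:
  assumes "\<And>u v. u \<in> vecs n \<Longrightarrow> v \<in> vecs n \<Longrightarrow> br u v \<in> vecs n"
  shows "ac_br n br u v \<in> vecs n"
  unfolding ac_br_def using assms
  by (intro fv.subspace_sum fv.subspace_scale subspace_vecs) (auto simp: ac_vec_vecs)

lemma bilin_expand:
  assumes "bilin br" "u \<in> vecs n" "v \<in> vecs n"
  shows "br u v = (\<Sum>j<n. \<Sum>k<n. smul (cf u j * cf v k) (br (evec j) (evec k)))"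
proof -
  have "br u v = (\<Sum>j<n. smul (cf u j) (br (evec j) v))"
    by (subst vecs_expand[OF assms(2)]) (simp add: lin_sum[OF bilinD(1)[OF assms(1)]] lin_smul[OF bilinD(1)[OF assms(1)]])
  also have "\<dots> = (\<Sum>j<n. smul (cf u j) (\<Sum>k<n. smul (cf v k) (br (evec j) (evec k))))"
    by (subst vecs_expand[OF assms(3)]) (simp add: lin_sum[OF bilinD(2)[OF assms(1)]] lin_smul[OF bilinD(2)[OF assms(1)]])
  finally show ?thesis by (simp add: fv.scale_sum_right)
qed

lemma ac_br_ac_vec:
  assumes "bilin br" "u \<in> vecs n" "v \<in> vecs n"
  shows "ac_br n br (ac_vec u) (ac_vec v) = ac_vec (br u v)"
  by (subst bilin_expand[OF assms]) (simp add: ac_br_def ac_vec_sum ac_vec_smul)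

text \<open>Both sides of the product rule are bilinear, so it is checked on basis vectors, where it
  comes from the ground field.\<close>

lemma derivation_ac:
  assumes br: "bilin br" and closed: "\<And>u v. u \<in> vecs n \<Longrightarrow> v \<in> vecs n \<Longrightarrow> br u v \<in> vecs n"
    and T: "lin T" "\<And>v. v \<in> vecs n \<Longrightarrow> T v \<in> vecs n"
    and D: "derivation_on (vecs n) br T"
  shows "derivation_on (vecs n) (ac_br n br) (ac_op n T)"
  unfolding derivation_on_def
proof (intro ballI)
  let ?D = "ac_op n T" and ?br = "ac_br n br"
  note b = bilinD[OF bilin_ac_br]
  have basis: "?D (?br (evec i) (evec j)) = ?br (?D (evec i)) (evec j) + ?br (evec i) (?D (evec j))"
    if ij: "i < n" "j < n" for i j
  proof -
    have "?D (?br (ac_vec (evec i)) (ac_vec (evec j))) =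
      ?br (?D (ac_vec (evec i))) (ac_vec (evec j)) + ?br (ac_vec (evec i)) (?D (ac_vec (evec j)))"
      using ij D by (simp only: ac_br_ac_vec ac_op_ac_vec br T closed evec_in_vecs derivation_on_def ac_vec_add[symmetric])
    then show ?thesis by simp
  qed
  fix u v :: "'a alg_closure fvec" assume uv: "u \<in> vecs n" "v \<in> vecs n"
  have 1: "?D (?br (evec i) v) = ?br (?D (evec i)) v + ?br (evec i) (?D v)" if "i < n" for i
    by (rule lin_eq_on_vecs[OF lin_comp[OF lin_ac_op b(2)] lin_plus[OF b(2) lin_comp[OF b(2) lin_ac_op]] basis[OF that] uv(2)])
  show "?D (?br u v) = ?br (?D u) v + ?br u (?D v)"
    by (rule lin_eq_on_vecs[OF lin_comp[OF lin_ac_op b(1)] lin_plus[OF lin_comp[OF b(1) lin_ac_op] b(1)] 1 uv(1)])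
qed

lemma pop_ac:
  assumes "lin T" "\<And>v. v \<in> vecs n \<Longrightarrow> T v \<in> vecs n" "v \<in> vecs n"
  shows "pop (ac_op n T) (map_poly to_ac p) (ac_vec v) = ac_vec (pop T p v)"
proof (induction p)
  case (pCons a p)
  have "pop T p v \<in> vecs n" by (rule pop_invariant[OF assms(1,2) subspace_vecs assms(3)])
  then show ?case using pCons assms
    by (simp add: map_poly_pCons pop_pCons lin_ac_op ac_vec_add ac_vec_smul ac_op_ac_vec)
qed simp

text \<open>An \<open>F\<close>-linear functional \<open>l\<close> on the algebraic closure, applied coordinatewise, brings
  derivations that are polynomials over the closure back to polynomials over \<open>F\<close>.\<close>

definition vmap :: "('k \<Rightarrow> 'f) \<Rightarrow> 'k fvec \<Rightarrow> 'f fvec" where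
  "vmap l v = mkv (\<lambda>i. l (cf v i))"

lemma cf_vmap [simp]: "cf (vmap l v) i = l (cf v i)"
  by (simp add: vmap_def)

definition ac_functional :: "('f::field alg_closure \<Rightarrow> 'f) \<Rightarrow> bool" where
  "ac_functional l \<longleftrightarrow> (\<forall>x y. l (x + y) = l x + l y) \<and> (\<forall>c x. l (x * to_ac c) = l x * c)"

lemma ac_functional_0: "ac_functional l \<Longrightarrow> l 0 = 0"
  unfolding ac_functional_def by (metis add_cancel_right_right)

lemma ac_functional_sum: "ac_functional l \<Longrightarrow> l (\<Sum>i\<in>A. f i) = (\<Sum>i\<in>A. l (f i))"
  by (induction A rule: infinite_finite_induct) (auto simp: ac_functional_0 ac_functional_def)

lemma vmap_ac_op:
  assumes l: "ac_functional l" and T: "lin T" "\<And>v. v \<in> vecs n \<Longrightarrow> T v \<in> vecs n" and w: "w \<in> vecs n"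
  shows "vmap l (ac_op n T w) = T (vmap l w)"
proof -
  have "vmap l w \<in> vecs n" using w by (simp add: vecs_def ac_functional_0[OF l])
  then have "T (vmap l w) = (\<Sum>j<n. smul (l (cf w j)) (T (evec j)))"
    by (subst vecs_expand) (auto simp: lin_sum lin_smul T(1))
  moreover have "vmap l (ac_op n T w) = (\<Sum>j<n. smul (l (cf w j)) (T (evec j)))"
    using l by (simp add: fvec_eq_iff ac_op_def cf_sum ac_functional_sum) (simp add: ac_functional_def)
  ultimately show ?thesis by simp
qed

lemma vmap_pop:
  assumes l: "ac_functional l" and T: "lin T" "\<And>v. v \<in> vecs n \<Longrightarrow> T v \<in> vecs n" and v: "v \<in> vecs n"
  shows "vmap l (pop (ac_op n T) p (ac_vec v)) = pop T (map_poly l p) v"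
proof (induction p)
  case 0
  then show ?case by (simp add: fvec_eq_iff ac_functional_0[OF l])
next
  case (pCons a p)
  have "pop (ac_op n T) p (ac_vec v) \<in> vecs n"
    by (rule pop_invariant[OF lin_ac_op ac_op_vecs[OF T(2)] subspace_vecs]) (auto simp: ac_vec_vecs v)
  from vmap_ac_op[OF l T this]
  have "vmap l (ac_op n T (pop (ac_op n T) p (ac_vec v))) = T (pop T (map_poly l p) v)" using pCons by simp
  moreover have "vmap l (smul a (ac_vec v) + w) = smul (l a) v + vmap l w" for w
    using l by (simp add: fvec_eq_iff ac_functional_def)
  ultimately show ?case
    by (simp add: map_poly_pCons ac_functional_0[OF l] pop_pCons lin_ac_op T)
qed

lemma vmap_br:
  assumes l: "ac_functional l" and br: "bilin br" and w: "w \<in> vecs n" and v: "v \<in> vecs n"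
  shows "vmap l (ac_br n br w (ac_vec v)) = br (vmap l w) v" (is ?L)
    and "vmap l (ac_br n br (ac_vec v) w) = br v (vmap l w)" (is ?R)
proof -
  have lw: "vmap l w \<in> vecs n" using w by (simp add: vecs_def ac_functional_0[OF l])
  have l3: "l (x * to_ac a * to_ac b) = l x * a * b" "l (to_ac a * x * to_ac b) = a * l x * b" for x a b
    using l unfolding ac_functional_def by (simp_all add: mult.commute[of "to_ac a" x] mult.commute[of a])
  show ?L by (subst bilin_expand[OF br lw v]) (simp add: fvec_eq_iff ac_br_def cf_sum ac_functional_sum[OF l] l3)
  show ?R by (subst bilin_expand[OF br v lw]) (simp add: fvec_eq_iff ac_br_def cf_sum ac_functional_sum[OF l] l3)
qed

lemma derivation_vmap:
  assumes br: "bilin br" and closed: "\<And>u v. u \<in> vecs n \<Longrightarrow> v \<in> vecs n \<Longrightarrow> br u v \<in> vecs n"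
    and T: "lin T" "\<And>v. v \<in> vecs n \<Longrightarrow> T v \<in> vecs n"
    and D: "derivation_on (vecs n) (ac_br n br) (pop (ac_op n T) p)" and l: "ac_functional l"
  shows "derivation_on (vecs n) br (pop T (map_poly l p))"
  unfolding derivation_on_def
proof (intro ballI)
  fix u v :: "'a fvec" assume uv: "u \<in> vecs n" "v \<in> vecs n"
  let ?P = "pop (ac_op n T) p"
  have P: "?P (ac_vec w) \<in> vecs n" if "w \<in> vecs n" for w
    by (rule pop_invariant[OF lin_ac_op ac_op_vecs[OF T(2)] subspace_vecs]) (auto simp: ac_vec_vecs that)
  have "vmap l (?P (ac_br n br (ac_vec u) (ac_vec v))) =
      vmap l (ac_br n br (?P (ac_vec u)) (ac_vec v) + ac_br n br (ac_vec u) (?P (ac_vec v)))"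
    using D uv by (simp add: derivation_on_def ac_vec_vecs)
  also have "\<dots> = vmap l (ac_br n br (?P (ac_vec u)) (ac_vec v)) + vmap l (ac_br n br (ac_vec u) (?P (ac_vec v)))"
    using l by (simp add: fvec_eq_iff ac_functional_def)
  finally show "pop T (map_poly l p) (br u v) = br (pop T (map_poly l p) u) v + br u (pop T (map_poly l p) v)"
    using uv by (simp add: ac_br_ac_vec br vmap_pop[OF l T] closed vmap_br[OF l br P] )
qed

section \<open>Linear functionals on field extensions\<close>

lemma ac_functional_separates:
  fixes x :: "'f::field alg_closure"
  assumes "x \<noteq> 0"
  shows "\<exists>l :: 'f alg_closure \<Rightarrow> 'f. ac_functional l \<and> l x \<noteq> 0"
proof -
  interpret K: vector_space "\<lambda>c (x :: 'f alg_closure). to_ac c * x"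
    by unfold_locales (auto simp: algebra_simps)
  interpret F: vector_space "(*) :: 'f \<Rightarrow> 'f \<Rightarrow> 'f"
    by unfold_locales (auto simp: algebra_simps)
  interpret KF: vector_space_pair "\<lambda>c (x :: 'f alg_closure). to_ac c * x" "(*) :: 'f \<Rightarrow> 'f \<Rightarrow> 'f" ..
  have "K.independent {x}" using assms by simp
  from KF.linear_independent_extend[OF this, of "\<lambda>_. 1"]
  obtain l where l: "Vector_Spaces.linear (\<lambda>c (x :: 'f alg_closure). to_ac c * x) (*) l" "l x = 1" by auto
  interpret l: Vector_Spaces.linear "\<lambda>c (x :: 'f alg_closure). to_ac c * x" "(*)" l by (rule l(1))
  have "ac_functional l"
    unfolding ac_functional_def by (metis l.add l.scale mult.commute)
  then show ?thesis using l by auto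
qed

text \<open>The order of the rationals is the purpose: it will turn a vanishing sum of squares into
  vanishing summands.\<close>

lemma rational_functional:
  fixes x :: "'k::field_char_0"
  assumes "x \<noteq> 0"
  shows "\<exists>g :: 'k \<Rightarrow> rat. (\<forall>a b. g (a + b) = g a + g b) \<and> (\<forall>q a. g (of_rat q * a) = q * g a) \<and> g x \<noteq> 0"
proof -
  interpret K: vector_space "\<lambda>c (x :: 'k). of_rat c * x"
    by unfold_locales (auto simp: algebra_simps of_rat_add of_rat_mult)
  interpret F: vector_space "(*) :: rat \<Rightarrow> rat \<Rightarrow> rat"
    by unfold_locales (auto simp: algebra_simps)
  interpret KF: vector_space_pair "\<lambda>c (x :: 'k). of_rat c * x" "(*) :: rat \<Rightarrow> rat \<Rightarrow> rat" ..
  have "K.independent {x}" using assms by simp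
  from KF.linear_independent_extend[OF this, of "\<lambda>_. 1"]
  obtain g where g: "Vector_Spaces.linear (\<lambda>c (x :: 'k). of_rat c * x) (*) g" "g x = 1" by auto
  interpret g: Vector_Spaces.linear "\<lambda>c (x :: 'k). of_rat c * x" "(*)" g by (rule g(1))
  show ?thesis using g.add g.scale g(2) by (intro exI[of _ g]) auto
qed

lemma split_operator_ac:
  assumes T: "lin T" "\<And>v. v \<in> vecs n \<Longrightarrow> T v \<in> vecs n"
    and chi: "\<chi> \<noteq> 0" "degree \<chi> \<le> m" "\<And>v. v \<in> vecs n \<Longrightarrow> pop T \<chi> v = 0"
  shows "split_operator (ac_op n T) n (map_poly to_ac \<chi>) m"
proof
  show "lin (ac_op n T)" by (rule lin_ac_op)
  show "ac_op n T v \<in> vecs n" for v by (rule ac_op_vecs[OF T(2)])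
  show "map_poly to_ac \<chi> \<noteq> 0" using chi(1) by (simp add: map_poly_eq_0_iff)
  show "degree (map_poly to_ac \<chi>) \<le> m" using chi(2) by (meson map_poly_degree_leq order_trans)
  show "pop (ac_op n T) (map_poly to_ac \<chi>) v = 0" if "v \<in> vecs n" for v
  proof (rule lin_eq_on_vecs[OF lin_pop[OF lin_ac_op] lin_zero _ that])
    show "pop (ac_op n T) (map_poly to_ac \<chi>) (evec i) = 0" if "i < n" for i
      using pop_ac[OF T, of "evec i" \<chi>] that chi(3) by simp
  qed
qed

text \<open>Chevalley's lemma, the core of Cartan's criterion: additive maps of the eigenvalues to the
  rationals produce enough derivations to force all eigenvalues to vanish.\<close>

lemma derivation_nilpotent_if_trace_orthogonal:
  fixes D :: "'f::field_char_0 fvec \<Rightarrow> 'f fvec"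
  assumes br: "bilin br" and closed: "\<And>u v. u \<in> vecs n \<Longrightarrow> v \<in> vecs n \<Longrightarrow> br u v \<in> vecs n"
    and D: "lin D" "\<And>v. v \<in> vecs n \<Longrightarrow> D v \<in> vecs n" "derivation_on (vecs n) br D"
    and orth: "\<And>p. derivation_on (vecs n) br (pop D p) \<Longrightarrow> tr n (\<lambda>v. D (pop D p v)) = 0"
  shows "\<exists>k. \<forall>v\<in>vecs n. (D ^^ k) v = 0"
proof -
  obtain \<chi> where chi: "\<chi> \<noteq> 0" "\<And>v. v \<in> vecs n \<Longrightarrow> pop D \<chi> v = 0"
    using operator_annihilator[OF D(1,2)] by blast
  define m where "m = degree \<chi>"
  interpret split_operator "ac_op n D" n "map_poly to_ac \<chi>" m
    by (rule split_operator_ac) (use D chi m_def in auto)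
  have mult0: "multiplicity_of c = 0" if c: "c \<in> spectrum" "c \<noteq> 0" for c
  proof -
    obtain g :: "'f alg_closure \<Rightarrow> rat" where g: "\<And>a b. g (a + b) = g a + g b"
      "\<And>q a. g (of_rat q * a) = q * g a" "g c \<noteq> 0"
      using rational_functional[OF c(2)] by blast
    \<comment> \<open>This is g embedded into the closure. It is additive, so interpolating it at
      the eigenvalues gives a derivation.\<close>
    define f :: "'f alg_closure \<Rightarrow> 'f alg_closure" where "f x = of_rat (g x)" for x
    obtain p where p: "\<And>c. c \<in> spectrum \<Longrightarrow> [:- c, 1:] ^ m dvd p - [:f c:]"
      using linear_powers_interpolation[OF finite_spectrum, of m f] by blast
    have der: "derivation_on (vecs n) (ac_br n br) (pop (ac_op n D) p)"
      by (rule derivation_polynomial[OF bilin_ac_br ac_br_vecs[OF closed] derivation_ac[OF br closed D] _ p])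
        (auto simp: f_def g of_rat_add)
    have m0: "m > 0"
    proof (rule ccontr)
      assume "\<not> m > 0"
      then have "degree (map_poly to_ac \<chi>) = 0" unfolding m_def by (metis map_poly_degree_leq le_0_eq neq0_conv)
      then show False using c(1) split_operator.chi(1)[OF split_operator_axioms]
        by (auto simp: spectrum_def elim!: degree_eq_zeroE)
    qed
    have fp: "poly p c = f c" if "c \<in> spectrum" for c
    proof -
      have "[:- c, 1:] dvd p - [:f c:]" using p[OF that] m0 by (meson dvd_power dvd_trans)
      then show ?thesis by (simp add: poly_eq_0_iff_dvd[symmetric])
    qed
    \<comment> \<open>The hypothesis \<open>orth\<close> concerns polynomials over the ground field.
      A functional that is nonzero at this trace would send it to such a trace over the ground
      field, which is 0.\<close>
    have "tr n (\<lambda>v. ac_op n D (pop (ac_op n D) p v)) = 0"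
    proof (rule ccontr)
      assume "tr n (\<lambda>v. ac_op n D (pop (ac_op n D) p v)) \<noteq> 0"
      then obtain l :: "'f alg_closure \<Rightarrow> 'f" where l: "ac_functional l"
        "l (tr n (\<lambda>v. ac_op n D (pop (ac_op n D) p v))) \<noteq> 0"
        using ac_functional_separates by blast
      have "l (tr n (\<lambda>v. ac_op n D (pop (ac_op n D) p v)))
          = tr n (\<lambda>v. D (pop D (map_poly l p) v))"
        unfolding tr_def ac_functional_sum[OF l(1)]
      proof (rule sum.cong[OF refl])
        fix i assume "i \<in> {..<n}"
        then have i: "evec i \<in> vecs n" by simp
        have w: "pop (ac_op n D) p (ac_vec (evec i)) \<in> vecs n" by (rule eproj_vecs) (use i ac_vec_vecs in auto)
        have "vmap l (ac_op n D (pop (ac_op n D) p (ac_vec (evec i)))) = D (pop D (map_poly l p) (evec i))"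
          using vmap_ac_op[OF l(1) D(1,2) w] vmap_pop[OF l(1) D(1,2) i, of p] by simp
        then show "l (cf (ac_op n D (pop (ac_op n D) p (evec i))) i) = cf (D (pop D (map_poly l p) (evec i))) i"
          by (metis ac_vec_evec cf_vmap)
      qed
      also have "\<dots> = 0" by (rule orth[OF derivation_vmap[OF br closed D(1,2) der l(1)]])
      finally show False using l by simp
    qed
    also have "tr n (\<lambda>v. ac_op n D (pop (ac_op n D) p v)) = tr n (pop (ac_op n D) (pCons 0 p))"
      by (rule tr_cong) (simp add: pop_pCons lin_ac_op)
    also have "\<dots> = (\<Sum>c\<in>spectrum. of_rat (of_nat (multiplicity_of c) * g c) * c)"
      unfolding tr_pop_spectrum by (rule sum.cong) (simp_all add: fp f_def of_rat_mult algebra_simps)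
    \<comment> \<open>Applying g to the sum of the terms m(c) g(c) c, with m the multiplicity,
      leaves a sum of m(c) g(c)^2 in the rationals, whose summands are nonnegative.\<close>
    finally have "g (\<Sum>c\<in>spectrum. of_rat (of_nat (multiplicity_of c) * g c) * c) = g 0" by simp
    moreover have g0: "g 0 = 0" using g(1)[of 0 0] by simp
    have "g (\<Sum>c\<in>A. h c) = (\<Sum>c\<in>A. g (h c))" if "finite A" for A and h :: "'f alg_closure \<Rightarrow> 'f alg_closure"
      using that by induction (auto simp: g0 g)
    ultimately have "(\<Sum>c\<in>spectrum. of_nat (multiplicity_of c) * (g c)\<^sup>2) = 0"
      using finite_spectrum g0 by (simp add: g(2) power2_eq_square mult.assoc)
    then have "of_nat (multiplicity_of c) * (g c)\<^sup>2 = 0"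
      using finite_spectrum c(1) by (subst (asm) sum_nonneg_eq_0_iff) auto
    then show ?thesis using g(3) by simp
  qed
  have "(D ^^ m) v = 0" if v: "v \<in> vecs n" for v
  proof -
    have "ac_vec ((D ^^ k) v) = (ac_op n D ^^ k) (ac_vec v)" for k
    proof (induction k)
      case (Suc k)
      have "(D ^^ k) v \<in> vecs n" using D(2) v by (intro funpow_invariant)
      then show ?case using ac_op_ac_vec[OF D(1)] by (simp add: Suc[symmetric])
    qed simp
    then have "ac_vec ((D ^^ m) v) = 0"
      using nilpotent_if_multiplicities_zero[OF mult0] v by (simp add: ac_vec_vecs)
    then show ?thesis using ac_vec_inj[of "(D ^^ m) v" 0] by simp
  qed
  then show ?thesis by blast
qed

section \<open>The semisimple part of a derivation\<close>

lemma ac_poly_add: "map_poly to_ac (p + q) = map_poly to_ac p + map_poly to_ac q"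
  by (simp add: poly_eq_iff coeff_map_poly)

lemma ac_poly_diff: "map_poly to_ac (p - q) = map_poly to_ac p - map_poly to_ac q"
  by (simp add: poly_eq_iff coeff_map_poly)

lemma ac_poly_mult: "map_poly to_ac (p * q) = map_poly to_ac p * map_poly to_ac q"
proof (induction p)
  case (pCons a p)
  have "map_poly to_ac (Polynomial.smult a q) = Polynomial.smult (to_ac a) (map_poly to_ac q)"
    by (simp add: poly_eq_iff coeff_map_poly)
  then show ?case using pCons by (simp add: ac_poly_add map_poly_pCons)
qed simp

lemma ac_poly_power: "map_poly to_ac (p ^ k) = map_poly to_ac p ^ k"
  by (induction k) (simp_all add: ac_poly_mult)

lemma ac_poly_dvd: "p dvd q \<Longrightarrow> map_poly to_ac p dvd map_poly to_ac q"
  by (auto simp: ac_poly_mult)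

lemma ac_poly_pcompose: "map_poly to_ac (pcompose p q) = pcompose (map_poly to_ac p) (map_poly to_ac q)"
  by (induction p) (simp_all add: pcompose_pCons ac_poly_add ac_poly_mult map_poly_pCons)

lemma ac_poly_pderiv: "map_poly to_ac (pderiv p) = pderiv (map_poly to_ac p)"
  by (simp add: poly_eq_iff coeff_map_poly coeff_pderiv del: of_nat_Suc)

text \<open>Over the closure a root c of \<chi> is a simple root of q, say q = (X - c) r with r(c)
  nonzero, and P(c) = c. As (X - c)^m divides q(P) = (P - c) r(P) and r(P) does not vanish at c, it
  divides P - c. So P interpolates the identity, which is an additive map.\<close>

lemma semisimple_part_derivation:
  fixes D :: "'f::field_char_0 fvec \<Rightarrow> 'f fvec"
  assumes br: "bilin br" and closed: "\<And>u v. u \<in> vecs n \<Longrightarrow> v \<in> vecs n \<Longrightarrow> br u v \<in> vecs n"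
    and D: "lin D" "\<And>v. v \<in> vecs n \<Longrightarrow> D v \<in> vecs n" "derivation_on (vecs n) br D"
    and ch: "\<chi> \<noteq> 0" "\<And>v. v \<in> vecs n \<Longrightarrow> pop D \<chi> v = 0" "degree \<chi> \<le> m" "\<chi> dvd q ^ m"
    and q: "a * q + b * pderiv q = 1" "q ^ m dvd pcompose q P" "q dvd P - [:0, 1:]"
  shows "derivation_on (vecs n) br (pop D P)"
proof -
  interpret split_operator "ac_op n D" n "map_poly to_ac \<chi>" m
    by (rule split_operator_ac) (use D ch in auto)
  let ?h = "map_poly to_ac :: 'f poly \<Rightarrow> 'f alg_closure poly"
  have bez: "?h a * ?h q + ?h b * pderiv (?h q) = 1"
    using arg_cong[OF q(1), of ?h] by (simp add: ac_poly_add ac_poly_mult ac_poly_pderiv)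
  have P: "[:- c, 1:] ^ m dvd ?h P - [:c:]" if c: "c \<in> spectrum" for c
  proof -
    obtain w where "?h q ^ m = ?h \<chi> * w" using ac_poly_dvd[OF ch(4)] by (auto simp: ac_poly_power)
    then have "poly (?h q ^ m) c = poly (?h \<chi>) c * poly w c" by simp
    then have "poly (?h q ^ m) c = 0" using c by (simp add: spectrum_def)
    then have qc: "poly (?h q) c = 0" by (simp add: poly_power)
    then obtain r where r: "?h q = [:- c, 1:] * r" by (auto simp: poly_eq_0_iff_dvd)
    have "pderiv (?h q) = r + [:- c, 1:] * pderiv r"
      unfolding r by (simp add: pderiv_mult pderiv_pCons algebra_simps del: mult_pCons_left mult_pCons_right)
    then have "poly (pderiv (?h q)) c = poly r c" by simp
    then have rc: "poly r c \<noteq> 0" using arg_cong[OF bez, of "\<lambda>p. poly p c"] qc by auto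
    obtain w where "?h P - [:0, 1:] = ?h q * w"
      using ac_poly_dvd[OF q(3)] by (auto simp: ac_poly_diff map_poly_pCons)
    then have "poly (?h P - [:0, 1:]) c = poly (?h q) c * poly w c" by simp
    then have Pc: "poly (?h P) c = c" using qc by simp
    have X: "pcompose [:- c, 1:] (?h P) = ?h P - [:c:]" by (simp add: pcompose_pCons)
    have "?h q ^ m dvd pcompose (?h q) (?h P)"
      using ac_poly_dvd[OF q(2)] by (simp add: ac_poly_power ac_poly_pcompose)
    also have "\<dots> = pcompose r (?h P) * (?h P - [:c:])"
      by (subst r) (simp add: pcompose_mult X del: mult_pCons_left mult_pCons_right)
    finally have "[:- c, 1:] ^ m dvd pcompose r (?h P) * (?h P - [:c:])"
      unfolding r by (simp add: power_mult_distrib del: mult_pCons_left mult_pCons_right) (meson dvd_mult_left)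
    then show ?thesis by (rule linear_power_dvd_cancel[rotated]) (simp add: poly_pcompose Pc rc)
  qed
  have der: "derivation_on (vecs n) (ac_br n br) (pop (ac_op n D) (?h P))"
    by (rule derivation_polynomial[OF bilin_ac_br ac_br_vecs[OF closed] derivation_ac[OF br closed D] _ P]) auto
  show ?thesis unfolding derivation_on_def
  proof (intro ballI)
    fix u v :: "'f fvec" assume uv: "u \<in> vecs n" "v \<in> vecs n"
    have inv: "pop D P w \<in> vecs n" if "w \<in> vecs n" for w
      by (rule pop_invariant[OF D(1,2) subspace_vecs that])
    have "ac_vec (pop D P (br u v)) = pop (ac_op n D) (?h P) (ac_br n br (ac_vec u) (ac_vec v))"
      using uv by (simp add: ac_br_ac_vec br pop_ac D closed)
    also have "\<dots> = ac_br n br (pop (ac_op n D) (?h P) (ac_vec u)) (ac_vec v)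
        + ac_br n br (ac_vec u) (pop (ac_op n D) (?h P) (ac_vec v))"
      using der uv by (simp add: derivation_on_def ac_vec_vecs)
    also have "\<dots> = ac_vec (br (pop D P u) v + br u (pop D P v))"
      using uv inv by (simp add: ac_br_ac_vec br pop_ac D ac_vec_add)
    finally show "pop D P (br u v) = br (pop D P u) v + br u (pop D P v)"
      by (simp add: ac_vec_inj)
  qed
qed

subsection \<open>Lie algebras in coordinates\<close>

text \<open>The closure condition is imposed on all sequences, not only on \<open>vecs n\<close>,
  and so are the identities in the locales below. A bracket given on \<open>vecs n\<close> is
  extended by truncation, and calculations then carry no membership conditions.\<close>

locale coord_algebra =
  fixes n :: nat and br :: "'f::field_char_0 fvec \<Rightarrow> 'f fvec \<Rightarrow> 'f fvec"
  assumes br_bilin: "bilin br" and br_vecs: "br u v \<in> vecs n"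
begin

lemmas lin_br_left = bilinD(1)[OF br_bilin] and lin_br = bilinD(2)[OF br_bilin]
lemmas br_add_left = lin_add[OF lin_br_left] and br_add_right = lin_add[OF lin_br]
lemmas br_diff_left = lin_diff[OF lin_br_left] and br_diff_right = lin_diff[OF lin_br]
lemmas br_minus_left = lin_minus[OF lin_br_left] and br_minus_right = lin_minus[OF lin_br]
lemmas br_smul_left = lin_smul[OF lin_br_left] and br_smul_right = lin_smul[OF lin_br]
lemmas br_0_left [simp] = lin_0[OF lin_br_left] and br_0_right [simp] = lin_0[OF lin_br]
lemmas br_simps = br_add_left br_add_right br_diff_left br_diff_right br_minus_left br_minus_right
  br_smul_left br_smul_right

definition subalg :: "'f fvec set \<Rightarrow> bool" where
  "subalg B \<longleftrightarrow> fv.subspace B \<and> B \<subseteq> vecs n \<and> (\<forall>x\<in>B. \<forall>y\<in>B. br x y \<in> B)"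

definition ideal_of :: "'f fvec set \<Rightarrow> 'f fvec set \<Rightarrow> bool" where
  "ideal_of B J \<longleftrightarrow> fv.subspace J \<and> J \<subseteq> B \<and> (\<forall>x\<in>J. \<forall>y\<in>B. br x y \<in> J \<and> br y x \<in> J)"

definition maxsub :: "'f fvec set \<Rightarrow> 'f fvec set \<Rightarrow> bool" where
  "maxsub B M \<longleftrightarrow> subalg M \<and> M \<subseteq> B \<and> M \<noteq> B \<and> (\<forall>T. subalg T \<and> M \<subseteq> T \<and> T \<subseteq> B \<longrightarrow> T = M \<or> T = B)"

definition frattini_sub :: "'f fvec set \<Rightarrow> 'f fvec set \<Rightarrow> bool" where
  "frattini_sub B J \<longleftrightarrow> ideal_of B J \<and> (\<forall>M. maxsub B M \<longrightarrow> J \<subseteq> M)"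

text \<open>Stated for all candidates, so that it makes sense before a largest one is known to
  exist.\<close>

definition frattini_free :: "'f fvec set \<Rightarrow> bool" where
  "frattini_free B \<longleftrightarrow> (\<forall>J. frattini_sub B J \<longrightarrow> J = {0})"

primrec lcs :: "'f fvec set \<Rightarrow> nat \<Rightarrow> 'f fvec set" where
  "lcs J 0 = J"
| "lcs J (Suc k) = fv.span {br a b | a b. a \<in> lcs J k \<and> b \<in> J}"

definition nilpotent_set :: "'f fvec set \<Rightarrow> bool" where
  "nilpotent_set J \<longleftrightarrow> (\<exists>k. lcs J k = {0})"

lemma subalgD: "subalg B \<Longrightarrow> fv.subspace B" "subalg B \<Longrightarrow> B \<subseteq> vecs n"
  "subalg B \<Longrightarrow> x \<in> B \<Longrightarrow> y \<in> B \<Longrightarrow> br x y \<in> B"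
  by (auto simp: subalg_def)

lemma ideal_ofD: "ideal_of B J \<Longrightarrow> fv.subspace J" "ideal_of B J \<Longrightarrow> J \<subseteq> B"
  "ideal_of B J \<Longrightarrow> x \<in> J \<Longrightarrow> y \<in> B \<Longrightarrow> br x y \<in> J" "ideal_of B J \<Longrightarrow> x \<in> J \<Longrightarrow> y \<in> B \<Longrightarrow> br y x \<in> J"
  by (auto simp: ideal_of_def)

lemma ideal_subalg: "ideal_of B J \<Longrightarrow> B \<subseteq> vecs n \<Longrightarrow> subalg J"
  by (auto simp: ideal_of_def subalg_def)

lemma maxsubD: "maxsub B M \<Longrightarrow> subalg T \<Longrightarrow> M \<subseteq> T \<Longrightarrow> T \<subseteq> B \<Longrightarrow> T \<noteq> M \<Longrightarrow> T = B"
  unfolding maxsub_def by blast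

lemma subalg_vecs: "subalg (vecs n)"
  by (simp add: subalg_def subspace_vecs br_vecs)

lemma subalg_inter: "subalg A \<Longrightarrow> subalg B \<Longrightarrow> subalg (A \<inter> B)"
  by (auto simp: subalg_def fv.subspace_inter)

lemma ad_invariant: "subalg B \<Longrightarrow> x \<in> B \<Longrightarrow> v \<in> B \<Longrightarrow> (br x ^^ k) v \<in> B"
  by (intro funpow_invariant) (auto simp: subalg_def)

lemma exists_maxsub:
  assumes B: "subalg B" and C: "subalg C" "C \<subseteq> B" "C \<noteq> B"
  shows "\<exists>M. maxsub B M \<and> C \<subseteq> M"
proof -
  let ?P = "\<lambda>M. subalg M \<and> C \<subseteq> M \<and> M \<subseteq> B \<and> M \<noteq> B"
  have "\<forall>M. ?P M \<longrightarrow> fv.dim M \<le> n" using dim_le_vecs subalgD by blast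
  moreover have "?P C" using C by blast
  ultimately have "\<exists>M. ?P M \<and> (\<forall>M'. ?P M' \<longrightarrow> fv.dim M' \<le> fv.dim M)"
    using ex_has_greatest_nat[of ?P C fv.dim "Suc n"] by (metis (no_types, lifting) le_imp_less_Suc le_SucI)
  then obtain M where M: "?P M" "\<And>M'. ?P M' \<Longrightarrow> fv.dim M' \<le> fv.dim M" by blast
  have "T = M \<or> T = B" if T: "subalg T" "M \<subseteq> T" "T \<subseteq> B" for T
  proof (rule ccontr)
    assume *: "\<not> (T = M \<or> T = B)"
    then have "fv.dim M < fv.dim T"
      using T M(1) by (intro dim_strict_mono[of _ _ n]) (auto simp: subalg_def)
    moreover have "fv.dim T \<le> fv.dim M" using T M * by blast
    ultimately show False by simp
  qed
  then show ?thesis using M(1) unfolding maxsub_def by blast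
qed

lemma subset_sum_left: "0 \<in> B \<Longrightarrow> (A :: 'f fvec set) \<subseteq> {a + b | a b. a \<in> A \<and> b \<in> B}"
  by (metis (mono_tags, lifting) add.right_neutral mem_Collect_eq subsetI)

lemma subset_sum_right: "0 \<in> A \<Longrightarrow> (B :: 'f fvec set) \<subseteq> {a + b | a b. a \<in> A \<and> b \<in> B}"
  by (metis (mono_tags, lifting) add.left_neutral mem_Collect_eq subsetI)

lemma subspace_sum: "fv.subspace A \<Longrightarrow> fv.subspace B \<Longrightarrow> fv.subspace {a + b | a b. a \<in> A \<and> b \<in> B}"
  by (rule fv.subspace_sums)

lemma subalg_sum:
  assumes B: "subalg B" and M: "subalg M" "M \<subseteq> B" and J: "ideal_of B J"
  shows "subalg {a + b | a b. a \<in> M \<and> b \<in> J}"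
  unfolding subalg_def
proof (intro conjI ballI)
  note JD = ideal_ofD[OF J] and MD = subalgD[OF M(1)]
  show "fv.subspace {a + b |a b. a \<in> M \<and> b \<in> J}" using JD MD by (intro subspace_sum)
  show "{a + b |a b. a \<in> M \<and> b \<in> J} \<subseteq> vecs n"
    using JD MD subalgD(2)[OF B] by (auto intro!: fv.subspace_add subspace_vecs)
  fix x y assume "x \<in> {a + b |a b. a \<in> M \<and> b \<in> J}" "y \<in> {a + b |a b. a \<in> M \<and> b \<in> J}"
  then obtain a b a' b' where xy: "x = a + b" "y = a' + b'" "a \<in> M" "a' \<in> M" "b \<in> J" "b' \<in> J" by auto
  have "br x y = br a a' + (br a b' + br b a' + br b b')" by (simp add: xy br_simps)
  moreover have "br a b' + br b a' + br b b' \<in> J"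
    using xy M(2) JD by (intro fv.subspace_add) auto
  ultimately show "br x y \<in> {a + b |a b. a \<in> M \<and> b \<in> J}"
    using MD(3)[OF xy(3,4)] by blast
qed

end

locale coord_lie = coord_algebra n br
  for n and br :: "'f::field_char_0 fvec \<Rightarrow> 'f fvec \<Rightarrow> 'f fvec" +
  assumes br_alt: "br u u = 0"
    and br_jacobi: "br u (br v w) = br (br u v) w + br v (br u w)"
begin

lemma br_anti: "br u v = - br v u"
proof -
  have "br (u + v) (u + v) = br u u + br v v + (br u v + br v u)"
    by (simp only: br_add_left br_add_right ac_simps)
  then have "br u v + br v u = 0" by (simp add: br_alt)
  then show ?thesis by (simp add: eq_neg_iff_add_eq_0)
qed

lemma ideal_ofI:
  assumes "fv.subspace J" "J \<subseteq> B" "\<And>x y. x \<in> B \<Longrightarrow> y \<in> J \<Longrightarrow> br x y \<in> J"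
  shows "ideal_of B J"
  unfolding ideal_of_def
proof (intro conjI ballI assms(1,2))
  show "br x y \<in> J" if "x \<in> J" "y \<in> B" for x y
    using fv.subspace_neg[OF assms(1) assms(3)[OF that(2,1)]] br_anti[of x y] by simp
qed (rule assms(3))

lemma derivation_br: "derivation_on G br (br x)"
  unfolding derivation_on_def using br_jacobi by blast

section \<open>Engel's theorem\<close>

text \<open>The theorem is about the action on W/U, phrased with pairs of subspaces instead of
  quotients. The induction on dim J is applied twice to a maximal subalgebra M of J: to J/M and to
  W/U. For the first use J has to lie in the set H on which the operators are nilpotent.\<close>

lemma engel_vector:
  assumes H: "H \<subseteq> vecs n" and nil: "\<And>x v. x \<in> J \<Longrightarrow> v \<in> H \<Longrightarrow> \<exists>k. (br x ^^ k) v = 0"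
    and J: "subalg J" "J \<subseteq> H" and UW: "fv.subspace U" "fv.subspace W" "U \<subset> W" "W \<subseteq> H"
    and inv: "\<And>x v. x \<in> J \<Longrightarrow> v \<in> U \<Longrightarrow> br x v \<in> U" "\<And>x v. x \<in> J \<Longrightarrow> v \<in> W \<Longrightarrow> br x v \<in> W"
  shows "\<exists>w\<in>W - U. \<forall>x\<in>J. br x w \<in> U"
  using nil J UW inv
proof (induction "fv.dim J" arbitrary: J U W rule: less_induct)
  case less
  note Jn = subalgD[OF less.prems(2)]
  show ?case
  proof (cases "J = {0}")
    case True
    then show ?thesis using less.prems(4,6) by (auto simp: fv.subspace_0)
  next
    case False
    have zero: "subalg {0}" by (auto simp: subalg_def fv.subspace_def vecs_def)
    have "{0} \<subseteq> J" using fv.subspace_0[OF Jn(1)] by simp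
    then obtain M where M: "maxsub J M" using exists_maxsub[OF less.prems(2) zero] False by blast
    then have Mn: "subalg M" "M \<subseteq> J" "M \<noteq> J" by (auto simp: maxsub_def)
    have dim: "fv.dim M < fv.dim J"
      using Mn Jn by (intro dim_strict_mono[of _ _ n]) (auto simp: subalg_def)
    have "\<exists>w\<in>J - M. \<forall>x\<in>M. br x w \<in> M"
      using Mn less.prems Jn by (intro less.hyps[OF dim]) (auto dest: subalgD)
    then obtain y where y: "y \<in> J" "y \<notin> M" "\<And>x. x \<in> M \<Longrightarrow> br x y \<in> M" by blast
    \<comment> \<open>As y normalises M, the sum M + F y is a subalgebra larger than M, hence all of
      J.\<close>
    define M' where "M' = {m + smul c y | m c. m \<in> M}"
    have "fv.subspace M'" unfolding fv.subspace_def
    proof (intro conjI ballI allI)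
      show "0 \<in> M'" unfolding M'_def using fv.subspace_0[OF subalgD(1)[OF Mn(1)]]
        by (auto intro!: exI[of _ 0])
      show "u + v \<in> M'" if "u \<in> M'" "v \<in> M'" for u v
      proof -
        from that obtain m c m' c' where "u = m + smul c y" "v = m' + smul c' y" "m \<in> M" "m' \<in> M"
          by (auto simp: M'_def)
        then have "u + v = (m + m') + smul (c + c') y" "m + m' \<in> M"
          using fv.subspace_add[OF subalgD(1)[OF Mn(1)]] by (auto simp: fv.scale_left_distrib)
        then show ?thesis unfolding M'_def by blast
      qed
      show "smul d u \<in> M'" if "u \<in> M'" for d u
      proof -
        from that obtain m c where "u = m + smul c y" "m \<in> M" by (auto simp: M'_def)
        then have "smul d u = smul d m + smul (d * c) y" "smul d m \<in> M"
          using fv.subspace_scale[OF subalgD(1)[OF Mn(1)]] by (auto simp: fv.scale_right_distrib)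
        then show ?thesis unfolding M'_def by blast
      qed
    qed
    moreover have "M' \<subseteq> J" unfolding M'_def using Mn(2) y(1)
      by (auto intro!: fv.subspace_add[OF Jn(1)] fv.subspace_scale[OF Jn(1)])
    moreover have "br u v \<in> M'" if "u \<in> M'" "v \<in> M'" for u v
    proof -
      from that obtain m c m' c' where *: "u = m + smul c y" "v = m' + smul c' y" "m \<in> M" "m' \<in> M"
        by (auto simp: M'_def)
      have "br u v = br m m' + smul c' (br m y) - smul c (br m' y) + smul 0 y"
        by (simp add: * br_simps br_alt br_anti[of y])
      moreover have "br m m' + smul c' (br m y) - smul c (br m' y) \<in> M"
        using * y(3) subalgD[OF Mn(1)] by (intro fv.subspace_diff fv.subspace_add fv.subspace_scale) auto
      ultimately show ?thesis unfolding M'_def by blast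
    qed
    ultimately have M's: "subalg M'" using Jn(2) by (auto simp: subalg_def)
    have "m = m + smul 0 y" for m by simp
    then have MM': "M \<subseteq> M'" unfolding M'_def by blast
    have "y = 0 + smul 1 y" by simp
    then have "y \<in> M'" unfolding M'_def using fv.subspace_0[OF subalgD(1)[OF Mn(1)]] by blast
    then have JM': "J = M'" using M M's MM' \<open>M' \<subseteq> J\<close> y(2) by (auto simp: maxsub_def)
    \<comment> \<open>The vectors of W that M kills modulo U. They are stable under y because y
      normalises M.\<close>
    define W' where "W' = {w \<in> W. \<forall>x\<in>M. br x w \<in> U}"
    have "\<exists>w\<in>W - U. \<forall>x\<in>M. br x w \<in> U"
      using Mn less.prems by (intro less.hyps[OF dim]) auto
    then obtain w1 where w1: "w1 \<in> W'" "w1 \<notin> U" by (auto simp: W'_def)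
    have W'inv: "br y w \<in> W'" if "w \<in> W'" for w
    proof -
      have "br x (br y w) \<in> U" if "x \<in> M" for x
        unfolding br_jacobi[of x y w] using that y \<open>w \<in> W'\<close> less.prems(4,8)
        by (auto simp: W'_def intro!: fv.subspace_add)
      then show ?thesis using that y(1) less.prems(9) by (auto simp: W'_def)
    qed
    have "w1 \<in> H" using w1(1) less.prems(7) by (auto simp: W'_def)
    then obtain k where k: "(br y ^^ k) w1 = 0" using less.prems(1)[OF y(1)] by blast
    then have "(br y ^^ k) w1 \<in> U" using less.prems(4) by (simp add: fv.subspace_0)
    \<comment> \<open>The string w1, [y, w1], [y, [y, w1]], ... first enters U at step j; the vector
      just before that is the one sought.\<close>
    then obtain j where j: "(br y ^^ j) w1 \<in> U" "\<And>i. i < j \<Longrightarrow> (br y ^^ i) w1 \<notin> U"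
      using exists_least_iff[of "\<lambda>k. (br y ^^ k) w1 \<in> U"] by blast
    then obtain i where i: "j = Suc i" using w1(2) by (cases j) auto
    define w0 where "w0 = (br y ^^ i) w1"
    have w0: "w0 \<in> W'" "w0 \<notin> U" "br y w0 \<in> U"
      using j i w1(1) W'inv by (auto simp: w0_def intro: funpow_invariant)
    have "br x w0 \<in> U" if "x \<in> J" for x
    proof -
      from that JM' obtain m c where "x = m + smul c y" "m \<in> M" by (auto simp: M'_def)
      then show ?thesis using w0 less.prems(4)
        by (auto simp: br_simps W'_def intro!: fv.subspace_add fv.subspace_scale)
    qed
    then show ?thesis using w0 by (auto simp: W'_def)
  qed
qed

text \<open>Z is the upper central series. By \<open>engel_vector\<close> it grows strictly until it
  reaches J, and the lower central series descends through it.\<close>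

lemma engel:
  assumes J: "subalg J" and nil: "\<And>x v. x \<in> J \<Longrightarrow> v \<in> J \<Longrightarrow> \<exists>k. (br x ^^ k) v = 0"
  shows "nilpotent_set J"
proof -
  define Z where "Z = rec_nat {0} (\<lambda>_ Z. {v \<in> J. \<forall>x\<in>J. br x v \<in> Z})"
  have Z0: "Z 0 = {0}" and ZS: "Z (Suc k) = {v \<in> J. \<forall>x\<in>J. br x v \<in> Z k}" for k
    by (simp_all add: Z_def)
  have sub: "fv.subspace (Z k) \<and> Z k \<subseteq> J" for k
  proof (induction k)
    case 0
    then show ?case using fv.subspace_0[OF subalgD(1)[OF J]] by (auto simp: Z0 fv.subspace_def)
  next
    case (Suc k)
    then show ?case using subalgD(1)[OF J] by (auto simp: ZS fv.subspace_def br_simps)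
  qed
  have mono: "Z k \<subseteq> Z (Suc k)" for k
  proof (induction k)
    case 0
    then show ?case using sub[of 1] by (auto simp: Z0 fv.subspace_0)
  next
    case (Suc k)
    then show ?case using ZS[of k] ZS[of "Suc k"] by blast
  qed
  have grow: "Z k = J \<or> k \<le> fv.dim (Z k)" for k
  proof (induction k)
    case (Suc k)
    show ?case
    proof (cases "Z k = J")
      case True
      then show ?thesis using mono[of k] sub[of "Suc k"] by auto
    next
      case False
      have "\<exists>w\<in>J - Z k. \<forall>x\<in>J. br x w \<in> Z k"
      proof (rule engel_vector[OF subalgD(2)[OF J] nil J subset_refl])
        show "Z k \<subset> J" using sub False by auto
        show "br x v \<in> Z k" if "x \<in> J" "v \<in> Z k" for x v
          using mono[of k] that by (auto simp: ZS)
      qed (use sub J in \<open>auto simp: subalg_def\<close>)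
      then have "Z k \<subset> Z (Suc k)" using mono[of k] by (auto simp: ZS)
      then have "fv.dim (Z k) < fv.dim (Z (Suc k))"
        using sub subalgD(2)[OF J] by (intro dim_strict_mono[of _ _ n]) blast+
      then show ?thesis using Suc False by auto
    qed
  qed simp
  \<comment> \<open>Growth for n + 1 steps would exceed the dimension n.\<close>
  have "Z (Suc n) = J"
  proof -
    have "fv.dim (Z (Suc n)) \<le> n"
      using dim_le_vecs[of "Z (Suc n)" n] sub subalgD(2)[OF J] by blast
    then show ?thesis using grow[of "Suc n"] by auto
  qed
  have "lcs J i \<subseteq> Z (Suc n - i)" if "i \<le> Suc n" for i
    using that
  proof (induction i)
    case 0
    then show ?case using \<open>Z (Suc n) = J\<close> by simp
  next
    case (Suc i)
    then have eq: "Suc n - i = Suc (Suc n - Suc i)" by simp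
    have "br a b \<in> Z (Suc n - Suc i)" if "a \<in> lcs J i" "b \<in> J" for a b
    proof -
      have "a \<in> Z (Suc (Suc n - Suc i))" using Suc that eq by auto
      then have "br b a \<in> Z (Suc n - Suc i)" using that by (auto simp: ZS simp del: diff_Suc_Suc)
      then show ?thesis using sub fv.subspace_neg br_anti by metis
    qed
    then show ?case unfolding lcs.simps using sub by (intro fv.span_minimal) auto
  qed
  from this[of "Suc n"] have "lcs J (Suc n) \<subseteq> {0}" by (simp add: Z0)
  moreover have "0 \<in> lcs J (Suc n)" by (simp add: fv.span_zero)
  ultimately show ?thesis unfolding nilpotent_set_def by blast
qed

section \<open>Frattini ideals of Lie algebras and complements of abelian ideals\<close>

lemma ad_funpow_lcs:
  assumes "subalg J" "x \<in> J" "v \<in> J"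
  shows "(br x ^^ k) v \<in> lcs J k"
proof (induction k)
  case (Suc k)
  have "br ((br x ^^ k) v) x \<in> {br a b | a b. a \<in> lcs J k \<and> b \<in> J}" using Suc assms by blast
  then have "- br ((br x ^^ k) v) x \<in> lcs J (Suc k)" by (simp add: fv.span_neg fv.span_base)
  then show ?case using br_anti[of x "(br x ^^ k) v"] by simp
qed (simp add: assms)

text \<open>For x in K the Fitting null component B0 of ad x on B is a subalgebra, and B = B0 + K,
  because a positive power of ad x maps B into K. A maximal subalgebra containing B0 would contain K
  as well and hence B. So ad x is nilpotent on B, and Engel's theorem applies to K.\<close>

lemma frattini_nilpotent:
  assumes B: "subalg B" and K: "frattini_sub B K"
  shows "nilpotent_set K"
proof -
  have KB: "ideal_of B K" using K by (simp add: frattini_sub_def)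
  note KD = ideal_ofD[OF KB] and BD = subalgD[OF B]
  have nil: "\<exists>k. (br x ^^ k) v = 0" if x: "x \<in> K" and v: "v \<in> B" for x v
  proof -
    define B0 where "B0 = {v \<in> B. \<exists>j. (br x ^^ j) v = 0}"
    have "fv.subspace B0" unfolding fv.subspace_def
    proof (intro conjI ballI allI)
      show "0 \<in> B0" using fv.subspace_0[OF BD(1)] by (auto simp: B0_def intro: exI[of _ 0])
      show "u + v \<in> B0" if "u \<in> B0" "v \<in> B0" for u v
      proof -
        from that obtain i j where ij: "u \<in> B" "v \<in> B" "(br x ^^ i) u = 0" "(br x ^^ j) v = 0" by (auto simp: B0_def)
        then have "(br x ^^ max i j) (u + v) = 0"
          using funpow_zero_mono[OF lin_br, of i x u "max i j"] funpow_zero_mono[OF lin_br, of j x v "max i j"]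
          by (simp add: lin_add[OF lin_funpow[OF lin_br]])
        then show ?thesis using ij fv.subspace_add[OF BD(1)] by (auto simp: B0_def)
      qed
      show "smul c u \<in> B0" if "u \<in> B0" for c u
        using that fv.subspace_scale[OF BD(1)] by (auto simp: B0_def lin_smul[OF lin_funpow[OF lin_br]])
    qed
    moreover have "br u v \<in> B0" if "u \<in> B0" "v \<in> B0" for u v
    proof -
      from that obtain i j where ij: "u \<in> B" "v \<in> B" "(br x ^^ i) u = 0" "(br x ^^ j) v = 0" by (auto simp: B0_def)
      have "(br x ^^ (i + j)) (br u v) = 0"
      proof (rule leibniz_nilpotent[where G = UNIV and br = br and C = "br x" and A = "br x" and B = "br x"])
        show "br x (br u v) = br (br x u) v + br u (br x v)" for u v by (rule br_jacobi)
      qed (use ij in \<open>auto simp: br_bilin lin_br\<close>)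
      then show ?thesis using ij BD(3) by (auto simp: B0_def)
    qed
    ultimately have B0: "subalg B0" "B0 \<subseteq> B" using BD(2) by (auto simp: subalg_def B0_def)
    have "B0 = B"
    proof (rule ccontr)
      assume "B0 \<noteq> B"
      then obtain M where M: "maxsub B M" "B0 \<subseteq> M" using exists_maxsub[OF B B0] by blast
      then have KM: "K \<subseteq> M" using K by (simp add: frattini_sub_def)
      have xB: "\<forall>v\<in>B. br x v \<in> B" using BD(3) x KD(2) by blast
      obtain k where k: "k > 0" and fit: "\<forall>W. fv.subspace W \<longrightarrow> W \<subseteq> vecs n \<longrightarrow> (\<forall>v\<in>W. br x v \<in> W) \<longrightarrow>
          (\<forall>v\<in>W. \<exists>w\<in>W. (br x ^^ k) (v - (br x ^^ k) w) = 0)"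
        using fitting_decomposition[where T = "br x" and n = n, OF lin_br br_vecs] by (elim exE conjE) (rule that)
      have "v \<in> M" if v: "v \<in> B" for v
      proof -
        obtain w where w: "w \<in> B" "(br x ^^ k) (v - (br x ^^ k) w) = 0" using fit BD(1,2) xB v by blast
        obtain k' where k': "k = Suc k'" using k by (cases k) auto
        have "(br x ^^ k') w \<in> B" using w x KD(2) by (intro ad_invariant[OF B]) auto
        then have "(br x ^^ k) w \<in> K" unfolding k' using KD(3) x by simp
        moreover have "v - (br x ^^ k) w \<in> B0"
          using w v calculation KD(2) fv.subspace_diff[OF BD(1)] by (auto simp: B0_def)
        ultimately have "(v - (br x ^^ k) w) + (br x ^^ k) w \<in> M"
          using M KM by (intro fv.subspace_add) (auto simp: maxsub_def subalg_def)
        then show ?thesis by simp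
      qed
      then show False using M by (auto simp: maxsub_def)
    qed
    then show ?thesis using v by (auto simp: B0_def)
  qed
  show ?thesis using nil KD(2) by (intro engel ideal_subalg[OF KB BD(2)]) blast
qed

text \<open>C is a supplement of K of least dimension. As K is abelian, K \<inter> C is normalised
  by K as well as by C, so it is an ideal of B. If a maximal subalgebra M did not contain it, C
  \<inter> M would be a smaller supplement. So K \<inter> C lies in all maximal subalgebras.\<close>

lemma abelian_ideal_complement:
  assumes B: "subalg B" "frattini_free B" and K: "ideal_of B K" "\<And>x y. x \<in> K \<Longrightarrow> y \<in> K \<Longrightarrow> br x y = 0"
  obtains C where "subalg C" "C \<subseteq> B" "\<And>v. v \<in> B \<Longrightarrow> \<exists>k\<in>K. v - k \<in> C" "K \<inter> C = {0}"
proof -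
  note KD = ideal_ofD[OF K(1)] and BD = subalgD[OF B(1)]
  let ?P = "\<lambda>C. subalg C \<and> C \<subseteq> B \<and> (\<forall>v\<in>B. \<exists>k\<in>K. v - k \<in> C)"
  have "?P B" using B(1) fv.subspace_0[OF KD(1)] by (auto intro!: bexI[of _ 0])
  then obtain C where C: "?P C" "\<And>C'. ?P C' \<Longrightarrow> fv.dim C \<le> fv.dim C'"
    using ex_has_least_nat[of ?P B fv.dim] by blast
  then have CD: "subalg C" "C \<subseteq> B" "\<And>v. v \<in> B \<Longrightarrow> \<exists>k\<in>K. v - k \<in> C" by blast+
  have I: "ideal_of B (K \<inter> C)"
  proof (rule ideal_ofI)
    show "fv.subspace (K \<inter> C)" using KD CD by (intro fv.subspace_inter) (auto simp: subalg_def)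
    show "br x y \<in> K \<inter> C" if x: "x \<in> B" and y: "y \<in> K \<inter> C" for x y
    proof -
      obtain k where k: "k \<in> K" "x - k \<in> C" using CD(3)[OF x] by blast
      have "br x y = br (x - k) y" using K(2) k y by (simp add: br_simps)
      then show ?thesis using x y k KD(4) CD subalgD(3)[OF CD(1)] by (metis IntD1 IntD2 IntI)
    qed
  qed (use CD in auto)
  have "K \<inter> C \<subseteq> M" if M: "maxsub B M" for M
  proof (rule ccontr)
    assume *: "\<not> K \<inter> C \<subseteq> M"
    have Ms: "subalg M" "M \<subseteq> B" using M by (auto simp: maxsub_def)
    let ?T = "{a + b | a b. a \<in> M \<and> b \<in> K \<inter> C}"
    have T: "subalg ?T" by (rule subalg_sum[OF B(1) Ms I])
    have "M \<subseteq> ?T" using fv.subspace_0[OF ideal_ofD(1)[OF I]] by (rule subset_sum_left)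
    moreover have "K \<inter> C \<subseteq> ?T" using fv.subspace_0[OF subalgD(1)[OF Ms(1)]] by (rule subset_sum_right)
    then have "?T \<noteq> M" using * by blast
    moreover have "?T \<subseteq> B" using Ms CD(2) fv.subspace_add[OF BD(1)] by auto
    ultimately have TB: "?T = B" using maxsubD[OF M T] by simp
    have "\<exists>k\<in>K. v - k \<in> C \<inter> M" if v: "v \<in> B" for v
    proof -
      obtain k where k: "k \<in> K" "v - k \<in> C" using CD(3)[OF v] by blast
      then have "v - k \<in> ?T" using TB CD(2) by auto
      then obtain a b where ab: "v - k = a + b" "a \<in> M" "b \<in> K" "b \<in> C" by blast
      then have "v - (k + b) = a" "a = (v - k) - b" by (simp_all add: algebra_simps)
      moreover have "(v - k) - b \<in> C" by (rule fv.subspace_diff[OF subalgD(1)[OF CD(1)] k(2) ab(4)])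
      ultimately show ?thesis using ab k fv.subspace_add[OF KD(1)] by (metis IntI)
    qed
    then have "fv.dim C \<le> fv.dim (C \<inter> M)"
      using C(2)[of "C \<inter> M"] subalg_inter[OF CD(1) Ms(1)] CD(2) by auto
    then have "C \<inter> M = C"
      using dim_strict_mono[of "C \<inter> M" C n] subalgD[OF CD(1)] subalgD(1)[OF subalg_inter[OF CD(1) Ms(1)]]
      by (metis inf_le1 not_le psubsetI)
    then show False using * by auto
  qed
  then have "K \<inter> C = {0}" using B(2) I by (simp add: frattini_free_def frattini_sub_def)
  then show ?thesis using that CD by blast
qed

section \<open>Almost algebraic and nilpotent subalgebras\<close>

definition complemented_in :: "'f fvec set \<Rightarrow> ('f fvec \<Rightarrow> 'f fvec) \<Rightarrow> bool" where
  "complemented_in B s \<longleftrightarrow> (\<forall>W. fv.subspace W \<and> W \<subseteq> B \<and> (\<forall>w\<in>W. s w \<in> W) \<longrightarrow>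
    (\<exists>W'. fv.subspace W' \<and> W' \<subseteq> B \<and> (\<forall>w\<in>W'. s w \<in> W') \<and> W \<inter> W' = {0} \<and> (\<forall>v\<in>B. \<exists>w\<in>W. v - w \<in> W')))"

text \<open>Only the actions on B are compared: x may differ from s + u by an element that
  centralises B.\<close>

definition almost_alg :: "'f fvec set \<Rightarrow> bool" where
  "almost_alg B \<longleftrightarrow> (\<forall>x\<in>B. \<exists>s\<in>B. \<exists>u\<in>B. (\<forall>v\<in>B. br x v = br s v + br u v) \<and>
    (\<forall>v\<in>B. br s (br u v) = br u (br s v)) \<and> (\<exists>k. \<forall>v\<in>B. (br u ^^ k) v = 0) \<and> complemented_in B (br s))"

lemma separable_complemented:
  assumes "lin s" "fv.subspace B" "B \<subseteq> vecs n" "\<And>v. v \<in> B \<Longrightarrow> s v \<in> B"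
    and "\<And>v. v \<in> B \<Longrightarrow> pop s q v = 0" "a * q + b * pderiv q = 1"
  shows "complemented_in B s"
  unfolding complemented_in_def
proof (intro allI impI)
  fix W assume W: "fv.subspace W \<and> W \<subseteq> B \<and> (\<forall>w\<in>W. s w \<in> W)"
  then show "\<exists>W'. fv.subspace W' \<and> W' \<subseteq> B \<and> (\<forall>w\<in>W'. s w \<in> W') \<and> W \<inter> W' = {0} \<and> (\<forall>v\<in>B. \<exists>w\<in>W. v - w \<in> W')"
    using separable_complement[OF assms(1,2,4,5,6), of W n] assms(3) by auto
qed

text \<open>On a nilpotent U every ad x is its own nilpotent part, so U is almost algebraic and
  hence \<open>frattini_free\<close>. If a maximal subalgebra M did not contain [U, U], then U = M +
  [U, U]; substituting this into itself gives U = M + \<open>lcs U i\<close> for all positive i, and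
  so U = M.\<close>

lemma nilpotent_subalg_abelian:
  assumes H: "\<And>B. subalg B \<Longrightarrow> almost_alg B \<Longrightarrow> frattini_free B"
    and U: "subalg U" "nilpotent_set U" and xy: "x \<in> U" "y \<in> U"
  shows "br x y = 0"
proof -
  note UD = subalgD[OF U(1)]
  obtain k where k: "lcs U k = {0}" using U(2) by (auto simp: nilpotent_set_def)
  have br0: "br 0 = (\<lambda>v. 0)" by auto
  have "almost_alg U" unfolding almost_alg_def
  proof (intro ballI)
    fix x assume x: "x \<in> U"
    have 1: "\<exists>k. \<forall>v\<in>U. (br x ^^ k) v = 0" using ad_funpow_lcs[OF U(1) x] k by auto
    have 2: "complemented_in U (br 0)"
    proof (rule separable_complemented[where q = "[:0, 1:]" and a = 0 and b = 1])
      show "pop (br 0) [:0, 1:] v = 0" if "v \<in> U" for v unfolding br0 by (simp add: pop_X lin_zero)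
    qed (use UD in \<open>auto simp: br0 lin_zero fv.subspace_0 pderiv_pCons\<close>)
    show "\<exists>s\<in>U. \<exists>u\<in>U. (\<forall>v\<in>U. br x v = br s v + br u v) \<and> (\<forall>v\<in>U. br s (br u v) = br u (br s v)) \<and>
      (\<exists>k. \<forall>v\<in>U. (br u ^^ k) v = 0) \<and> complemented_in U (br s)"
      using x 1 2 fv.subspace_0[OF UD(1)] by (intro bexI[of _ 0] bexI[of _ x]) auto
  qed
  then have free: "frattini_free U" using H U by blast
  have lcsU: "fv.subspace (lcs U i) \<and> lcs U i \<subseteq> U" for i
  proof (induction i)
    case (Suc i)
    then show ?case unfolding lcs.simps using UD(3)
      by (intro conjI fv.subspace_span fv.span_minimal UD(1)) blast
  qed (simp add: UD)
  have I: "ideal_of U (lcs U 1)"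
  proof (rule ideal_ofI)
    show "br x y \<in> lcs U 1" if "x \<in> U" "y \<in> lcs U 1" for x y
      unfolding One_nat_def lcs.simps by (rule fv.span_base) (use that lcsU[of 1] in blast)
  qed (use lcsU[of 1] in blast)+
  have "lcs U 1 \<subseteq> M" if M: "maxsub U M" for M
  proof (rule ccontr)
    assume *: "\<not> lcs U 1 \<subseteq> M"
    have Ms: "subalg M" "M \<subseteq> U" using M by (auto simp: maxsub_def)
    note MD = subalgD[OF Ms(1)]
    let ?T = "\<lambda>i. {a + b | a b. a \<in> M \<and> b \<in> lcs U i}"
    have T1: "?T 1 = U"
    proof -
      have T: "subalg (?T 1)" by (rule subalg_sum[OF U(1) Ms I])
      have "M \<subseteq> ?T 1" using fv.subspace_0[OF ideal_ofD(1)[OF I]] by (rule subset_sum_left)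
      moreover have "lcs U 1 \<subseteq> ?T 1" using fv.subspace_0[OF MD(1)] by (rule subset_sum_right)
      then have "?T 1 \<noteq> M" using * by blast
      moreover have "?T 1 \<subseteq> U" using Ms lcsU[of 1] fv.subspace_add[OF UD(1)] by blast
      ultimately show "?T 1 = U" using maxsubD[OF M T] by simp
    qed
    have "U \<subseteq> ?T (Suc i)" for i
    proof (induction i)
      case 0
      then show ?case using T1 by simp
    next
      case (Suc i)
      have sub: "fv.subspace (?T (Suc (Suc i)))" using MD lcsU by (intro subspace_sum) auto
      have MT: "M \<subseteq> ?T (Suc (Suc i))"
        by (rule subset_sum_left) (use fv.subspace_0 lcsU in blast)
      have mem: "br c d \<in> lcs U (Suc (Suc i))" if "c \<in> lcs U (Suc i)" "d \<in> U" for c d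
        unfolding lcs.simps(2)[of U "Suc i"] by (rule fv.span_base) (use that in blast)
      have "br a b \<in> ?T (Suc (Suc i))" if "a \<in> U" "b \<in> U" for a b
      proof -
        from that Suc obtain m c m' c' where ab: "a = m + c" "b = m' + c'" "m \<in> M" "m' \<in> M"
          "c \<in> lcs U (Suc i)" "c' \<in> lcs U (Suc i)" by blast
        have "br a b = br m m' + (br c b - br c' m)"
          by (simp add: ab br_simps br_anti[of m c'])
        moreover have "br c b - br c' m \<in> lcs U (Suc (Suc i))"
        proof (rule fv.subspace_diff)
          show "br c b \<in> lcs U (Suc (Suc i))" by (rule mem[OF ab(5) that(2)])
          show "br c' m \<in> lcs U (Suc (Suc i))" by (rule mem[OF ab(6)]) (use ab(3) Ms in blast)
        qed (use lcsU in blast)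
        ultimately show ?thesis using MD(3) ab by blast
      qed
      then have "{br a b | a b. a \<in> lcs U 0 \<and> b \<in> U} \<subseteq> ?T (Suc (Suc i))" by auto
      then have "lcs U 1 \<subseteq> ?T (Suc (Suc i))"
        unfolding One_nat_def lcs.simps(2)[of U 0] by (rule fv.span_minimal[OF _ sub])
      then have "a + b \<in> ?T (Suc (Suc i))" if "a \<in> M" "b \<in> lcs U 1" for a b
        using that MT by (intro fv.subspace_add[OF sub]) blast+
      then have "?T 1 \<subseteq> ?T (Suc (Suc i))" by blast
      then show ?case unfolding T1 .
    qed
    then have "U \<subseteq> ?T (Suc k)" .
    moreover have "lcs U (Suc k) \<subseteq> {0}"
      unfolding lcs.simps k by (rule fv.span_minimal) auto
    ultimately have "U \<subseteq> M" by (force simp del: lcs.simps)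
    then show False using M by (auto simp: maxsub_def)
  qed
  then have "lcs U 1 = {0}" using free I unfolding frattini_free_def frattini_sub_def by blast
  moreover have "br x y \<in> lcs U 1"
    unfolding One_nat_def lcs.simps by (rule fv.span_base) (use xy in blast)
  ultimately show ?thesis by auto
qed

end

subsection \<open>Lie algebras with an abelian completely reducible nilradical\<close>

lemma funpow_comp_commute:
  assumes w: "\<And>v. v \<in> G \<Longrightarrow> w v \<in> G" and u: "\<And>v. v \<in> G \<Longrightarrow> u v \<in> G"
    and comm: "\<And>v. v \<in> G \<Longrightarrow> u (w v) = w (u v)" and v: "v \<in> G"
  shows "((\<lambda>v. u (w v)) ^^ j) v = (u ^^ j) ((w ^^ j) v)"
proof (induction j)
  case (Suc j)
  have 1: "(w ^^ j) v \<in> G" by (rule funpow_invariant[OF w v])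
  have "w ((u ^^ j) x) = (u ^^ j) (w x)" if "x \<in> G" for x
  proof (induction j)
    case (Suc j)
    have "(u ^^ j) x \<in> G" by (rule funpow_invariant[OF u that])
    then show ?case using Suc comm[of "(u ^^ j) x"] by simp
  qed simp
  then show ?case using Suc 1 by simp
qed simp

lemma nilpotent_commuting_sum:
  assumes AB: "lin A" "lin B" "\<And>v. v \<in> G \<Longrightarrow> A v \<in> G" "\<And>v. v \<in> G \<Longrightarrow> B v \<in> G"
    and comm: "\<And>v. v \<in> G \<Longrightarrow> A (B v) = B (A v)" and D_def: "D = (\<lambda>v. A v - B v)"
  shows "v \<in> G \<Longrightarrow> (A ^^ i) v = 0 \<Longrightarrow> (B ^^ j) v = 0 \<Longrightarrow> (D ^^ (i + j)) v = 0"
proof (induction "i + j" arbitrary: i j v)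
  case (Suc k)
  have D: "lin D" unfolding D_def by (rule lin_sub[OF AB(1,2)])
  show ?case
  proof (cases "i = 0 \<or> j = 0")
    case True
    then have "v = 0" using Suc.prems by auto
    then show ?thesis by (simp add: lin_0[OF lin_funpow[OF D]])
  next
    case False
    then obtain i' j' where ij: "i = Suc i'" "j = Suc j'" by (metis not0_implies_Suc)
    have pw: "(f ^^ l) (g v) = g ((f ^^ l) v)"
      if "\<And>v. v \<in> G \<Longrightarrow> f v \<in> G" "\<And>v. v \<in> G \<Longrightarrow> f (g v) = g (f v)" for f g :: "'a fvec \<Rightarrow> 'a fvec" and l
      using funpow_intertwine[of G g f f v l] that Suc.prems(1) by simp
    have "(D ^^ (i' + j)) (A v) = 0"
    proof (rule Suc.hyps(1))
      show "(B ^^ j) (A v) = 0" using pw[of B A j, OF AB(4) comm[symmetric]] Suc.prems(3) lin_0[OF AB(1)] by simp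
    qed (use Suc.prems Suc.hyps(2) AB in \<open>auto simp: ij funpow_swap1\<close>)
    moreover have "(D ^^ (i + j')) (B v) = 0"
    proof (rule Suc.hyps(1))
      show "(A ^^ i) (B v) = 0" using pw[of A B i, OF AB(3) comm] Suc.prems(2) lin_0[OF AB(2)] by simp
    qed (use Suc.prems Suc.hyps(2) AB in \<open>auto simp: ij funpow_swap1\<close>)
    moreover have "(D ^^ (i + j)) v = (D ^^ (i' + j)) (D v)" "i + j' = i' + j"
      by (simp_all add: ij funpow_swap1)
    moreover have "D v = A v - B v" by (simp add: D_def)
    ultimately show ?thesis by (simp add: lin_diff[OF lin_funpow[OF D]])
  qed
qed simp

lemma pop_intertwine:
  assumes "lin A" "lin U" "lin T" "fv.subspace W"
    and "\<And>v. v \<in> W \<Longrightarrow> A (U v) = T (A v)" "\<And>v. v \<in> W \<Longrightarrow> U v \<in> W" "v \<in> W"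
  shows "A (pop U p v) = pop T p (A v)"
proof (induction p)
  case (pCons a p)
  have "pop U p v \<in> W" by (rule pop_invariant[OF assms(2,6,4,7)])
  then show ?case using pCons assms by (simp add: pop_pCons lin_add lin_smul)
qed (simp add: lin_0 assms)

text \<open>By the Fitting decomposition \<open>v - (M ^^ k) w\<close> is killed by
  \<open>M ^^ k\<close>, so it is 0, and k > 0.\<close>

lemma injective_surjective:
  assumes M: "lin M" "\<And>v. v \<in> vecs m \<Longrightarrow> M v \<in> vecs m" and inj: "\<And>v. v \<in> vecs m \<Longrightarrow> M v = 0 \<Longrightarrow> v = 0"
    and v: "v \<in> vecs m"
  shows "\<exists>w\<in>vecs m. M w = v"
proof -
  have "\<exists>k>0. \<forall>W. fv.subspace W \<longrightarrow> W \<subseteq> vecs m \<longrightarrow> (\<forall>v\<in>W. M v \<in> W) \<longrightarrow>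
      (\<forall>v\<in>W. \<exists>w\<in>W. (M ^^ k) (v - (M ^^ k) w) = 0)"
    by (rule fitting_decomposition[OF M])
  then obtain k where k: "k > 0" and fit: "\<forall>W. fv.subspace W \<longrightarrow> W \<subseteq> vecs m \<longrightarrow> (\<forall>v\<in>W. M v \<in> W) \<longrightarrow>
      (\<forall>v\<in>W. \<exists>w\<in>W. (M ^^ k) (v - (M ^^ k) w) = 0)"
    by (elim exE conjE) (rule that)
  obtain w where w: "w \<in> vecs m" "(M ^^ k) (v - (M ^^ k) w) = 0"
    using fit[rule_format, OF subspace_vecs subset_refl M(2) v] by blast
  have inj': "x = 0" if "x \<in> vecs m" "(M ^^ j) x = 0" for x j
    using that
  proof (induction j)
    case (Suc j)
    then show ?case using inj[of "(M ^^ j) x"] funpow_invariant[of "vecs m" M x j, OF M(2) Suc.prems(1)] by simp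
  qed simp
  have Mk: "(M ^^ j) w \<in> vecs m" for j using w M(2) by (intro funpow_invariant)
  have "v - (M ^^ k) w = 0" by (rule inj'[OF fv.subspace_diff[OF subspace_vecs v Mk] w(2)])
  moreover obtain k' where "k = Suc k'" using k by (cases k) auto
  ultimately show ?thesis using Mk[of k'] by (intro bexI[of _ "(M ^^ k') w"]) auto
qed

text \<open>The matrix of f in a basis of W acts injectively, hence surjectively; solving it for the
  values of l at the basis gives d.\<close>

lemma nondegenerate_representation:
  assumes W: "fv.subspace W" "W \<subseteq> vecs n"
    and f: "\<And>x y z. f (x + y) z = f x z + f y z" "\<And>c x z. f (smul c x) z = c * f x z"
      "\<And>x y z. f x (y + z) = f x y + f x z" "\<And>c x z. f x (smul c z) = c * f x z"
    and nondeg: "\<And>w. w \<in> W \<Longrightarrow> (\<And>t. t \<in> W \<Longrightarrow> f w t = 0) \<Longrightarrow> w = 0"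
    and l: "\<And>x y. l (x + y) = l x + l y" "\<And>c x. l (smul c x) = c * l x"
  shows "\<exists>d\<in>W. \<forall>t\<in>W. f d t = l t"
proof -
  obtain A B m where AB: "lin A" "lin B" "m \<le> n" "m = fv.dim W" "\<And>v. A v \<in> W" "\<And>v. B v \<in> vecs m"
    "\<And>v. v \<in> vecs m \<Longrightarrow> B (A v) = v" "\<And>w. w \<in> W \<Longrightarrow> A (B w) = w"
    using subspace_retract[OF W] by blast
  have f0: "f x 0 = 0" for x using f(4)[of x 0 0] by simp
  have l0: "l 0 = 0" using l(2)[of 0 0] by simp
  have fsum: "f x (\<Sum>i\<in>I. g i) = (\<Sum>i\<in>I. f x (g i))" if "finite I" for x I and g :: "nat \<Rightarrow> 'a fvec"
    using that by induction (auto simp: f f0)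
  have lsum: "l (\<Sum>i\<in>I. g i) = (\<Sum>i\<in>I. l (g i))" if "finite I" for I and g :: "nat \<Rightarrow> 'a fvec"
    using that by induction (auto simp: l l0)
  have A_expand: "A (B t) = (\<Sum>j<m. smul (cf (B t) j) (A (evec j)))" for t
    by (subst vecs_expand[OF AB(6)]) (simp add: lin_sum lin_smul AB(1))
  have f_expand: "f d t = (\<Sum>j<m. cf (B t) j * f d (A (evec j)))" if "t \<in> W" for d t
    by (subst AB(8)[OF that, symmetric], subst A_expand) (simp add: fsum f(4))
  have l_expand: "l t = (\<Sum>j<m. cf (B t) j * l (A (evec j)))" if "t \<in> W" for t
    by (subst AB(8)[OF that, symmetric], subst A_expand) (simp add: lsum l(2))
  define M where "M = (\<lambda>v. mkv (\<lambda>j. if j < m then f (A v) (A (evec j)) else 0))"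
  have M: "lin M" unfolding M_def by (rule linI) (auto simp: fvec_eq_iff lin_add lin_smul AB(1) f)
  have Mv: "M v \<in> vecs m" for v by (simp add: M_def vecs_def)
  have inj: "v = 0" if "v \<in> vecs m" "M v = 0" for v
  proof -
    have "f (A v) (A (evec j)) = 0" if "j < m" for j
      using arg_cong[OF \<open>M v = 0\<close>, of "\<lambda>v. cf v j"] that by (simp add: M_def)
    then have "f (A v) t = 0" if "t \<in> W" for t
      by (simp add: f_expand[OF that])
    then have "A v = 0" using nondeg AB(5) by blast
    then show ?thesis using AB(7)[OF that(1)] lin_0[OF AB(2)] by simp
  qed
  have "mkv (\<lambda>j. if j < m then l (A (evec j)) else 0) \<in> vecs m" by (simp add: vecs_def)
  then obtain v where v: "M v = mkv (\<lambda>j. if j < m then l (A (evec j)) else 0)"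
    using injective_surjective[OF M Mv inj] by blast
  have "f (A v) (A (evec j)) = l (A (evec j))" if "j < m" for j
    using arg_cong[OF v, of "\<lambda>v. cf v j"] that by (simp add: M_def)
  then have "f (A v) t = l t" if "t \<in> W" for t by (simp add: f_expand[OF that] l_expand[OF that])
  then show ?thesis using AB(5) by blast
qed

lemma pop_kernel:
  assumes "lin T" "T z = 0"
  shows "pop T p z = smul (Polynomial.coeff p 0) z"
  by (cases p) (simp add: pop_pCons assms pop_apply_commute lin_0 lin_pop)

locale reductive_lie = coord_lie n br
  for n and br :: "'f::field_char_0 fvec \<Rightarrow> 'f fvec \<Rightarrow> 'f fvec" +
  fixes N S :: "'f fvec set"
  assumes N: "ideal_of (vecs n) N" and N_abelian: "\<And>x y. x \<in> N \<Longrightarrow> y \<in> N \<Longrightarrow> br x y = 0"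
    and S: "subalg S" and decomposition: "\<And>v. v \<in> vecs n \<Longrightarrow> \<exists>a\<in>N. v - a \<in> S" and NS: "N \<inter> S = {0}"
    and complete: "\<And>W. fv.subspace W \<Longrightarrow> W \<subseteq> N \<Longrightarrow> (\<And>s w. s \<in> S \<Longrightarrow> w \<in> W \<Longrightarrow> br s w \<in> W) \<Longrightarrow>
      \<exists>W'. fv.subspace W' \<and> W' \<subseteq> N \<and> (\<forall>s\<in>S. \<forall>w\<in>W'. br s w \<in> W') \<and> W \<inter> W' = {0} \<and> (\<forall>v\<in>N. \<exists>w\<in>W. v - w \<in> W')"
    and nilmax: "\<And>J. ideal_of (vecs n) J \<Longrightarrow> nilpotent_set J \<Longrightarrow> J \<subseteq> N"
begin

lemmas ND = ideal_ofD[OF N] and SD = subalgD[OF S]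

lemma S_vecs: "s \<in> S \<Longrightarrow> s \<in> vecs n"
  using SD(2) by blast

lemma N_vecs: "a \<in> N \<Longrightarrow> a \<in> vecs n"
  using ND(2) by blast

lemma br_N: "a \<in> N \<Longrightarrow> x \<in> vecs n \<Longrightarrow> br x a \<in> N" "a \<in> N \<Longrightarrow> x \<in> vecs n \<Longrightarrow> br a x \<in> N"
  using ND by auto

lemma br_br: "br (br x y) v = br x (br y v) - br y (br x v)"
  using br_jacobi[of x y v] by simp

text \<open>The kernel of T has a complementary submodule. T preserves it by \<open>sub\<close> and
  is injective and nilpotent on it, so it is 0. Without \<open>sub\<close> the claim fails, since T
  could map one summand onto an isomorphic one; the operators met below are built from ad of
  elements of S and polynomials in them.\<close>

lemma nilpotent_endomorphism_zero:
  assumes T: "lin T" and sub: "\<And>W v. fv.subspace W \<Longrightarrow> W \<subseteq> N \<Longrightarrow> (\<And>s w. s \<in> S \<Longrightarrow> w \<in> W \<Longrightarrow> br s w \<in> W) \<Longrightarrow> v \<in> W \<Longrightarrow> T v \<in> W"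
    and nil: "\<And>v. v \<in> N \<Longrightarrow> (T ^^ k) v = 0" and comm: "\<And>s v. s \<in> S \<Longrightarrow> v \<in> N \<Longrightarrow> T (br s v) = br s (T v)"
    and v: "v \<in> N"
  shows "T v = 0"
proof -
  have "\<And>s w. s \<in> S \<Longrightarrow> w \<in> {v \<in> N. T v = 0} \<Longrightarrow> br s w \<in> {v \<in> N. T v = 0}"
    using comm br_N S_vecs by simp
  from complete[OF subspace_kernel[OF T ND(1)] _ this]
  obtain W' where W': "fv.subspace W'" "W' \<subseteq> N" "\<And>s w. s \<in> S \<Longrightarrow> w \<in> W' \<Longrightarrow> br s w \<in> W'"
    "{v \<in> N. T v = 0} \<inter> W' = {0}" "\<And>v. v \<in> N \<Longrightarrow> \<exists>w\<in>{v \<in> N. T v = 0}. v - w \<in> W'" by blast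
  have zero: "w = 0" if "(T ^^ j) w = 0" "w \<in> W'" for j w
    using that
  proof (induction j arbitrary: w)
    case (Suc j)
    then have "T w = 0" using sub[OF W'(1,2,3)] by (simp add: funpow_swap1)
    then show ?case using Suc W' by blast
  qed simp
  obtain w where w: "w \<in> N" "T w = 0" "v - w \<in> W'" using W'(5)[OF v] by blast
  then have "v - w = 0" using zero nil W'(2) by blast
  then show ?thesis using w by simp
qed

section \<open>The Killing form and the structure of S\<close>

definition kap :: "'f fvec \<Rightarrow> 'f fvec \<Rightarrow> 'f" where
  "kap x y = tr n (\<lambda>v. br x (br y v))"

lemma kap_linear:
  "kap (x + y) z = kap x z + kap y z" "kap (smul c x) z = c * kap x z"
  "kap x (y + z) = kap x y + kap x z" "kap x (smul c z) = c * kap x z"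
  by (simp_all add: kap_def br_simps tr_add tr_smul)

lemma kap_sym: "kap x y = kap y x"
  unfolding kap_def by (rule tr_comm[OF lin_br lin_br br_vecs br_vecs])

lemma kap_invariant: "kap (br x y) z = kap x (br y z)"
proof -
  have "tr n (\<lambda>v. br y (br x (br z v))) = tr n (\<lambda>v. br x (br z (br y v)))"
    by (rule tr_comm[OF lin_br lin_comp[OF lin_br lin_br] br_vecs br_vecs])
  then show ?thesis by (simp add: kap_def br_br tr_diff br_diff_right)
qed

lemma kap_N:
  assumes "a \<in> N" "g \<in> vecs n"
  shows "kap a g = 0"
proof -
  have "tr n (\<lambda>v. br a (br g v)) = 0"
  proof (rule tr_nilpotent[OF lin_comp[OF lin_br lin_br] br_vecs])
    \<comment> \<open>The operator maps everything into N, and it maps N to 0.\<close>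
    show "((\<lambda>v. br a (br g v)) ^^ 2) v = 0" for v
      using N_abelian[OF assms(1)] assms br_N br_vecs by (simp add: numeral_2_eq_2)
  qed
  then show ?thesis by (simp add: kap_def)
qed

definition rad :: "'f fvec set" where
  "rad = {x \<in> vecs n. \<forall>y\<in>vecs n. kap x y = 0}"

lemma kap_0: "kap 0 y = 0" "kap x 0 = 0"
  by (simp_all add: kap_def tr_def)

lemma rad_subspace: "fv.subspace rad"
  using subspace_vecs[of n] by (auto simp: rad_def fv.subspace_def kap_linear kap_0)

lemma br_rad: "r \<in> rad \<Longrightarrow> br r g \<in> rad"
  by (auto simp: rad_def kap_invariant br_vecs)

text \<open>The span of [rad, G] is an ideal. For x = [r, g] and a derivation Y the trace of ad x
  after Y is, up to sign, the Killing form of r and Y g, which vanishes. By Chevalley's lemma ad x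
  is nilpotent, by Engel's theorem the ideal is, and \<open>nilmax\<close> puts it into N.\<close>

lemma rad_br_N:
  assumes "r \<in> rad" "g \<in> vecs n"
  shows "br r g \<in> N"
proof -
  define J where "J = fv.span {br r g | r g. r \<in> rad \<and> g \<in> vecs n}"
  have J: "fv.subspace J" by (simp add: J_def)
  have Jrad: "J \<subseteq> rad" unfolding J_def by (rule fv.span_minimal) (auto simp: br_rad rad_subspace)
  have rad_vecs: "rad \<subseteq> vecs n" by (auto simp: rad_def)
  have I: "ideal_of (vecs n) J"
  proof (rule ideal_ofI[OF J])
    show "J \<subseteq> vecs n" using Jrad rad_vecs by blast
    show "br x y \<in> J" if "x \<in> vecs n" "y \<in> J" for x y
    proof -
      have "br y x \<in> J" unfolding J_def by (rule fv.span_base) (use that Jrad in blast)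
      then show ?thesis using fv.subspace_neg[OF J] br_anti[of x y] by simp
    qed
  qed
  have orth: "tr n (\<lambda>v. br x (Y v)) = 0"
    if Y: "lin Y" "\<And>v. v \<in> vecs n \<Longrightarrow> Y v \<in> vecs n" "derivation_on (vecs n) br Y" and x: "x \<in> J" for x Y
    using x unfolding J_def
  proof (induction rule: fv.span_induct)
    case base
    show ?case by (auto simp: fv.subspace_def br_simps tr_add tr_smul) (simp add: tr_def)
  next
    case (step x)
    then obtain r g where rg: "x = br r g" "r \<in> rad" "g \<in> vecs n" by blast
    have "tr n (\<lambda>v. br g (br r (Y v))) = tr n (\<lambda>v. br r (Y (br g v)))"
      by (rule tr_comm[OF lin_br lin_comp[OF lin_br Y(1)] br_vecs br_vecs])
    moreover have "tr n (\<lambda>v. br r (Y (br g v))) = tr n (\<lambda>v. br r (br (Y g) v) + br r (br g (Y v)))"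
      using Y(3) rg by (intro tr_cong) (simp add: derivation_on_def br_add_right)
    ultimately have "tr n (\<lambda>v. br x (Y v)) = - kap r (Y g)"
      by (simp add: rg br_br tr_diff tr_add kap_def)
    then show ?case using rg Y(2) by (simp add: rad_def)
  qed
  have nil: "\<exists>k. \<forall>v\<in>vecs n. (br x ^^ k) v = 0" if x: "x \<in> J" for x
  proof (rule derivation_nilpotent_if_trace_orthogonal[OF br_bilin br_vecs lin_br br_vecs derivation_br])
    fix p assume "derivation_on (vecs n) br (pop (br x) p)"
    then show "tr n (\<lambda>v. br x (pop (br x) p v)) = 0"
      by (intro orth x lin_pop lin_br pop_invariant[OF lin_br br_vecs subspace_vecs])
  qed
  have "nilpotent_set J"
    using nil ideal_ofD(2)[OF I] by (intro engel ideal_subalg[OF I]) blast+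
  then have "J \<subseteq> N" using nilmax I by blast
  moreover have "br r g \<in> J" unfolding J_def by (rule fv.span_base) (use assms in blast)
  ultimately show ?thesis by blast
qed

definition centre :: "'f fvec set" where
  "centre = {z \<in> S. \<forall>s\<in>S. br z s = 0}"

definition derived :: "'f fvec set" where
  "derived = fv.span {br a b | a b. a \<in> S \<and> b \<in> S}"

lemma derived_subspace: "fv.subspace derived"
  by (simp add: derived_def)

lemma derived_S: "derived \<subseteq> S"
  unfolding derived_def by (rule fv.span_minimal) (auto simp: SD)

lemma br_derived: "a \<in> S \<Longrightarrow> b \<in> S \<Longrightarrow> br a b \<in> derived"
  unfolding derived_def by (rule fv.span_base) blast

lemma rad_S_centre: "c \<in> rad \<Longrightarrow> c \<in> S \<Longrightarrow> c \<in> centre"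
  using rad_br_N S_vecs SD(3) NS unfolding centre_def by blast

text \<open>Writing a, b for ad a, ad b: tr(E a b) = tr(E b a), because E commutes with a and the
  trace is cyclic.\<close>

lemma tr_commutant_derived:
  assumes E: "lin E" "\<And>v. v \<in> vecs n \<Longrightarrow> E v \<in> vecs n"
    and comm: "\<And>s v. s \<in> S \<Longrightarrow> v \<in> vecs n \<Longrightarrow> E (br s v) = br s (E v)" and t: "t \<in> derived"
  shows "tr n (\<lambda>v. E (br t v)) = 0"
  using t unfolding derived_def
proof (induction rule: fv.span_induct)
  case base
  show ?case by (auto simp: fv.subspace_def br_simps lin_add lin_smul E tr_add tr_smul lin_0) (simp add: tr_def)
next
  case (step t)
  then obtain a b where ab: "t = br a b" "a \<in> S" "b \<in> S" by blast
  have "tr n (\<lambda>v. E (br b (br a v))) = tr n (\<lambda>v. br a (E (br b v)))"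
    by (rule tr_comm[OF lin_comp[OF E(1) lin_br] lin_br br_vecs E(2)[OF br_vecs]])
  also have "\<dots> = tr n (\<lambda>v. E (br a (br b v)))"
    using comm ab br_vecs by (intro tr_cong) simp
  finally show ?case by (simp add: ab br_br lin_diff E tr_diff)
qed

text \<open>All traces of powers of ad c vanish, so ad c is nilpotent. It commutes with S, so it is
  0 on N by complete reducibility, and it is 0 on S by centrality. Hence c spans a central ideal;
  this lies in N, while c lies in S.\<close>

lemma centre_derived:
  assumes c: "c \<in> centre" "c \<in> derived"
  shows "c = 0"
proof -
  have cS: "c \<in> S" using c by (simp add: centre_def)
  have comm: "br c (br s v) = br s (br c v)" if "s \<in> S" for s v
    using br_jacobi[of c s v] c that by (simp add: centre_def)
  have "tr n (br c ^^ k) = 0" if k: "k > 0" for k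
  proof -
    obtain k' where k': "k = Suc k'" using k by (cases k) auto
    have "tr n (\<lambda>v. (br c ^^ k') (br c v)) = 0"
    proof (rule tr_commutant_derived[OF lin_funpow[OF lin_br] _ _ c(2)])
      show "(br c ^^ k') v \<in> vecs n" if "v \<in> vecs n" for v by (rule funpow_invariant[OF br_vecs that])
      show "(br c ^^ k') (br s v) = br s ((br c ^^ k') v)" if "s \<in> S" for s v
        using funpow_intertwine[of UNIV "br s" "br c" "br c" v k'] comm[OF that] by simp
    qed
    then show ?thesis by (simp add: k' funpow_Suc_right comp_def del: funpow.simps)
  qed
  then obtain k where k: "\<And>v. v \<in> vecs n \<Longrightarrow> (br c ^^ k) v = 0"
    using nilpotent_if_traces_zero[OF lin_br br_vecs] by blast
  have cN: "br c v = 0" if "v \<in> N" for v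
    by (rule nilpotent_endomorphism_zero[OF lin_br _ k _ that]) (use cS N_vecs comm in auto)
  have c0: "br c v = 0" if v: "v \<in> vecs n" for v
  proof -
    obtain a where a: "a \<in> N" "v - a \<in> S" using decomposition[OF v] by blast
    have "br c v = br c a + br c (v - a)" by (simp add: br_simps)
    then show ?thesis using cN a c by (simp add: centre_def)
  qed
  define J where "J = fv.span {c}"
  have cv: "{c} \<subseteq> vecs n" using cS S_vecs by simp
  have Jv: "J \<subseteq> vecs n" unfolding J_def by (rule fv.span_minimal[OF cv subspace_vecs])
  have "J \<subseteq> {y. \<forall>x\<in>vecs n. br x y = 0}" unfolding J_def
    by (rule fv.span_minimal) (auto simp: fv.subspace_def br_simps br_anti[of _ c] c0)
  then have J0: "br x y = 0" if "x \<in> vecs n" "y \<in> J" for x y using that by blast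
  have I: "ideal_of (vecs n) J"
    by (rule ideal_ofI[OF _ Jv]) (auto simp: J0 J_def fv.span_zero)
  have "lcs J 1 \<subseteq> {0}" unfolding One_nat_def lcs.simps
    by (rule fv.span_minimal) (use J0 Jv in auto)
  then have "nilpotent_set J" unfolding nilpotent_set_def using fv.span_zero by (intro exI[of _ 1]) auto
  then have "c \<in> N" using nilmax[OF I] fv.span_base[of c "{c}"] by (auto simp: J_def)
  then show ?thesis using cS NS by blast
qed

text \<open>For a in S the element [z, a] is orthogonal to N, and to S by invariance. So it lies in
  the radical of the form and is central in S; being in [S, S] as well, it is 0.\<close>

lemma orthogonal_derived_centre:
  assumes z: "z \<in> S" "\<And>t. t \<in> derived \<Longrightarrow> kap z t = 0"
  shows "z \<in> centre"
proof -
  have "br z a = 0" if a: "a \<in> S" for a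
  proof -
    have "kap (br z a) y = 0" if y: "y \<in> vecs n" for y
    proof -
      obtain b where b: "b \<in> N" "y - b \<in> S" using decomposition[OF y] by blast
      have "kap (br z a) y = kap (br z a) b + kap (br z a) (y - b)"
        using kap_linear(3)[of "br z a" b "y - b"] by simp
      also have "kap (br z a) b = 0" using kap_N[OF b(1) br_vecs] kap_sym by simp
      also have "kap (br z a) (y - b) = 0" using z(2)[OF br_derived[OF a b(2)]] by (simp add: kap_invariant)
      finally show ?thesis by simp
    qed
    then have "br z a \<in> rad" by (simp add: rad_def br_vecs)
    then have "br z a \<in> centre" using rad_S_centre SD(3)[OF z(1) a] by blast
    then show ?thesis using centre_derived br_derived[OF z(1) a] by blast
  qed
  then show ?thesis using z by (simp add: centre_def)
qed

text \<open>The form is nondegenerate on [S, S], since an element of S orthogonal to [S, S] is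
  central.\<close>

lemma derived_representation:
  assumes l: "\<And>x y. l (x + y) = l x + l y" "\<And>c x. l (smul c x) = c * l x"
  shows "\<exists>d\<in>derived. \<forall>t\<in>derived. kap d t = l t"
proof (rule nondegenerate_representation[OF derived_subspace _ kap_linear _ l])
  show "derived \<subseteq> vecs n" using derived_S SD(2) by blast
  show "w = 0" if "w \<in> derived" "\<And>t. t \<in> derived \<Longrightarrow> kap w t = 0" for w
    using orthogonal_derived_centre[OF _ that(2)] that(1) derived_S centre_derived by blast
qed

text \<open>The element d represents the functional \<open>kap s\<close> on [S, S], so s - d is
  orthogonal to [S, S].\<close>

lemma S_centre_derived:
  assumes "s \<in> S"
  obtains d z where "d \<in> derived" "z \<in> centre" "s = d + z"
proof -
  obtain d where d: "d \<in> derived" "\<And>t. t \<in> derived \<Longrightarrow> kap d t = kap s t"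
    using derived_representation[of "kap s"] by (auto simp: kap_linear)
  have "kap (s - d) t = 0" if "t \<in> derived" for t
    using kap_linear(1)[of "s - d" d t] d(2)[OF that] by simp
  then have "s - d \<in> centre"
    using orthogonal_derived_centre[of "s - d"] fv.subspace_diff[OF SD(1) assms] d(1) derived_S by blast
  then show ?thesis using that[OF d(1), of "s - d"] by simp
qed

text \<open>The nilpotent part \<open>u\<close> of \<open>ad \<sigma>\<close> is a derivation, and the invariant form yields \<open>d\<close> such that
  \<open>E = u - ad d\<close> is orthogonal to \<open>ad [S, S]\<close>. Then \<open>E\<close> vanishes on \<open>S\<close>, so that it is a nilpotent
  endomorphism of the \<open>S\<close>-module \<open>N\<close>, hence zero.\<close>

lemma jordan_S:
  assumes \<sigma>: "\<sigma> \<in> S"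
  shows "\<exists>s\<in>S. \<exists>d\<in>S. \<exists>q a b k. \<sigma> = s + d \<and> a * q + b * pderiv q = 1 \<and>
    (\<forall>v\<in>vecs n. pop (br s) q v = 0 \<and> (br d ^^ k) v = 0) \<and> br s d = 0"
proof -
  let ?G = "vecs n :: 'f fvec set"
  define T where "T = br \<sigma>"
  have T: "lin T" "\<And>v. T v \<in> ?G" by (simp_all add: T_def lin_br br_vecs)
  obtain \<chi> P q a b m where jc: "\<chi> \<noteq> 0" "\<And>v. v \<in> ?G \<Longrightarrow> pop T \<chi> v = 0" "a * q + b * pderiv q = 1"
    "degree \<chi> \<le> m" "\<chi> dvd q ^ m" "q ^ m dvd pcompose q P" "q dvd P - [:0, 1:]"
    using jordan_chevalley[OF T] by blast
  define u where "u = pop T ([:0, 1:] - P)"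
  have u: "lin u" by (simp add: u_def lin_pop T)
  have u_eq: "u v = T v - pop T P v" for v by (simp add: u_def pop_diff pop_X T)
  have u_inv: "u v \<in> W" if "fv.subspace W" "\<And>v. v \<in> W \<Longrightarrow> T v \<in> W" "v \<in> W" for v W
    unfolding u_def by (rule pop_invariant[OF T(1) that(2,1,3)])
  have uG: "u v \<in> ?G" if "v \<in> ?G" for v by (rule u_inv[OF subspace_vecs T(2) that])
  have "q dvd [:0, 1:] - P" using jc(7) by (metis dvd_minus_iff minus_diff_eq)
  then have "\<chi> dvd ([:0, 1:] - P) ^ m" using jc(5) by (meson dvd_power_same dvd_trans)
  then have u_nil: "(u ^^ m) v = 0" if "v \<in> ?G" for v
    using pop_dvd_zero[OF T(1) _ jc(2)[OF that]] by (simp add: u_def pop_power[symmetric] T)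
  have "derivation_on ?G br (pop T P)"
    by (rule semisimple_part_derivation[OF br_bilin br_vecs T _ jc(1,2,4,5,3,6,7)]) (simp_all add: T_def derivation_br)
  then have u_der: "u (br x y) = br (u x) y + br x (u y)" if "x \<in> ?G" "y \<in> ?G" for x y
    using that br_jacobi[of \<sigma> x y] by (simp add: u_eq derivation_on_def br_simps) (simp add: T_def)
  \<comment> \<open>On the kernel of T the operator u is a scalar, the constant coefficient of its
    polynomial, and nilpotency makes it 0.\<close>
  have u_kernel: "u z = 0" if "z \<in> ?G" "T z = 0" for z
  proof -
    have uz: "u z = smul (Polynomial.coeff ([:0, 1:] - P) 0) z"
      unfolding u_def by (rule pop_kernel[OF T(1) that(2)])
    have "(u ^^ k) z = smul (Polynomial.coeff ([:0, 1:] - P) 0 ^ k) z" for k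
      by (induction k) (simp_all add: lin_smul[OF u] uz mult.commute del: coeff_diff)
    then have "Polynomial.coeff ([:0, 1:] - P) 0 ^ m = 0 \<or> z = 0"
      using u_nil[OF that(1)] fv.scale_eq_0_iff by metis
    then show ?thesis by (auto simp: uz simp del: coeff_diff)
  qed
  obtain d where d: "d \<in> derived" "\<And>t. t \<in> derived \<Longrightarrow> kap d t = tr n (\<lambda>v. u (br t v))"
    using derived_representation[of "\<lambda>t. tr n (\<lambda>v. u (br t v))"]
    by (auto simp: br_simps lin_add lin_smul u tr_add tr_smul)
  have dS: "d \<in> S" using d derived_S by blast
  define E where "E = (\<lambda>v. u v - br d v)"
  have E: "lin E" unfolding E_def by (rule lin_sub[OF u lin_br])
  have E_eq: "E v = u v - br d v" for v by (simp add: E_def)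
  have EG: "E v \<in> ?G" if "v \<in> ?G" for v
    unfolding E_def by (rule fv.subspace_diff[OF subspace_vecs uG[OF that] br_vecs])
  have E_der: "E (br x y) = br (E x) y + br x (E y)" if "x \<in> ?G" "y \<in> ?G" for x y
    using br_jacobi[of d x y] by (simp add: E_def u_der[OF that] br_simps)
  \<comment> \<open>E is a derivation, and the choice of d makes it trace-orthogonal to ad [S, S].
    Invariance then makes E t orthogonal to [S, S], hence central, while E t lies in [S, S].\<close>
  have E_derived: "E t = 0" if t: "t \<in> derived" for t
  proof -
    have tG: "t \<in> ?G" using t derived_S S_vecs by blast
    have inv: "br s t' \<in> derived" if "s \<in> S" "t' \<in> derived" for s t' using that derived_S br_derived by blast
    have Et: "E t \<in> derived" unfolding E_def
      by (rule fv.subspace_diff[OF derived_subspace u_inv[OF derived_subspace _ t] inv[OF dS t]])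
        (simp add: T_def inv \<sigma>)
    have "kap (E t) t' = 0" if t': "t' \<in> derived" for t'
    proof -
      have tt': "br t t' \<in> derived" using inv t t' derived_S by blast
      have "tr n (\<lambda>v. E (br (br t t') v)) = 0"
        using d(2)[OF tt'] by (simp add: E_def tr_diff kap_def)
      moreover have "tr n (\<lambda>v. br t (E (br t' v))) = tr n (\<lambda>v. E (br t' (br t v)))"
        by (rule tr_comm[OF lin_br lin_comp[OF E lin_br] EG[OF br_vecs] br_vecs])
      moreover have "kap (E t) t' = tr n (\<lambda>v. E (br t (br t' v)) - br t (E (br t' v)))"
        unfolding kap_def by (rule tr_cong) (simp add: E_der tG br_vecs)
      ultimately show ?thesis by (simp add: br_br lin_diff E tr_diff)
    qed
    then have "E t \<in> centre" using orthogonal_derived_centre Et derived_S by blast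
    then show ?thesis using centre_derived Et by blast
  qed
  have E_S: "E s = 0" if s: "s \<in> S" for s
  proof -
    obtain t z where tz: "t \<in> derived" "z \<in> centre" "s = t + z" using S_centre_derived[OF s] by blast
    have zS: "z \<in> S" and z: "\<And>s. s \<in> S \<Longrightarrow> br s z = 0"
      using tz br_anti[of _ z] by (auto simp: centre_def)
    have "E z = 0" using u_kernel[OF S_vecs[OF zS]] z \<sigma> dS by (simp add: E_def T_def)
    then show ?thesis using E_derived tz by (simp add: lin_add E)
  qed
  have E_comm: "E (br s v) = br s (E v)" if "s \<in> S" "v \<in> ?G" for s v
    using E_der[OF S_vecs[OF that(1)] that(2)] E_S[OF that(1)] by simp
  have Eu: "u (E v) = E (u v)" if "v \<in> ?G" for v
    unfolding u_def by (rule pop_commute[OF T(1) E T(2) subspace_vecs _ that, symmetric])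
      (simp add: T_def E_comm \<sigma>)
  \<comment> \<open>One factor E is written as u - ad d. The part with u is nilpotent, as u commutes
    with E; the part with ad d has trace 0, since d lies in [S, S] and E commutes with ad S.\<close>
  have "tr n (E ^^ k) = 0" if k: "k > 0" for k
  proof -
    obtain k' where k': "k = Suc k'" using k by (cases k) auto
    let ?F = "E ^^ k'"
    have F: "lin ?F" by (rule lin_funpow[OF E])
    have FG: "?F v \<in> ?G" if "v \<in> ?G" for v by (rule funpow_invariant[OF EG that])
    have uF: "u (?F v) = ?F (u v)" if "v \<in> ?G" for v
      using funpow_intertwine[of ?G u E E v k'] Eu EG that by simp
    have "tr n (\<lambda>v. ?F (br d v)) = 0"
    proof (rule tr_commutant_derived[OF F FG _ d(1)])
      show "?F (br s v) = br s (?F v)" if "s \<in> S" "v \<in> ?G" for s v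
        using funpow_intertwine[of ?G "br s" E E v k'] E_comm EG that by simp
    qed
    moreover have "tr n (\<lambda>v. u (?F v)) = 0"
    proof (rule tr_nilpotent[OF lin_comp[OF u F] uG[OF FG]])
      show "((\<lambda>v. u (?F v)) ^^ m) v = 0" if v: "v \<in> ?G" for v
        using funpow_comp_commute[of ?G ?F u v m, OF FG uG uF v] u_nil funpow_invariant[of ?G ?F v m, OF FG v] by simp
    qed
    moreover have "tr n (E ^^ k) = tr n (\<lambda>v. u (?F v) - ?F (br d v))"
      unfolding k' funpow_Suc_right comp_def
      by (rule tr_cong) (simp add: E_eq lin_diff[OF F] uF)
    ultimately show ?thesis by (simp add: tr_diff)
  qed
  then obtain k where k: "\<And>v. v \<in> ?G \<Longrightarrow> (E ^^ k) v = 0"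
    using nilpotent_if_traces_zero[OF E EG] by blast
  have E_N: "E v = 0" if v: "v \<in> N" for v
  proof (rule nilpotent_endomorphism_zero[OF E _ _ _ v])
    show "E v \<in> W" if W: "fv.subspace W" "W \<subseteq> N" "\<And>s w. s \<in> S \<Longrightarrow> w \<in> W \<Longrightarrow> br s w \<in> W" "v \<in> W" for W v
      unfolding E_def by (rule fv.subspace_diff[OF W(1) u_inv[OF W(1) _ W(4)] W(3)[OF dS W(4)]]) (simp add: T_def W \<sigma>)
  qed (use k N_vecs E_comm in auto)
  have E0: "E v = 0" if v: "v \<in> ?G" for v
  proof -
    obtain x where x: "x \<in> N" "v - x \<in> S" using decomposition[OF v] by blast
    have "E v = E x + E (v - x)" by (simp add: lin_diff E)
    then show ?thesis using E_N E_S x by simp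
  qed
  have ud: "u v = br d v" if "v \<in> ?G" for v using E0[OF that] by (simp add: E_def)
  define s where "s = \<sigma> - d"
  have sS: "s \<in> S" unfolding s_def by (rule fv.subspace_diff[OF SD(1) \<sigma> dS])
  have sP: "br s v = pop T P v" if "v \<in> ?G" for v
  proof -
    have "br s v = T v - u v" using ud[OF that] by (simp add: s_def br_simps T_def)
    then show ?thesis using u_eq[of v] by simp
  qed
  have "pop (br s) q v = 0" if v: "v \<in> ?G" for v
  proof -
    have "pop (br s) q v = pop (pop T P) q v"
      by (rule pop_cong[OF lin_pop[OF T(1)] lin_br pop_invariant[OF T(1) T(2) subspace_vecs] subspace_vecs sP v])
    also have "\<dots> = pop T (pcompose q P) v" by (simp add: pop_pcompose T)
    also have "\<dots> = 0" using pop_dvd_zero[OF T(1) _ jc(2)[OF v]] jc(5,6) by (meson dvd_trans)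
    finally show ?thesis .
  qed
  moreover have "(br d ^^ m) v = 0" if v: "v \<in> ?G" for v
    using funpow_intertwine[of ?G "\<lambda>v. v" u "br d" v m] ud uG u_nil v by simp
  moreover have "br s d = 0"
  proof -
    \<comment> \<open>T kills \<sigma>, hence so does u, and u acts as ad d.\<close>
    have "br d \<sigma> = 0" using u_kernel[of \<sigma>] ud[of \<sigma>] S_vecs[OF \<sigma>] br_alt by (simp add: T_def)
    then show ?thesis using br_anti[of \<sigma> d] br_alt by (simp add: s_def br_simps)
  qed
  moreover have "\<sigma> = s + d" by (simp add: s_def)
  ultimately show ?thesis using jc(3) sS dS by blast
qed

text \<open>Write x = e + \<sigma> and split e by the Fitting decomposition of ad \<sigma> on N. The
  part in the image of a power of ad \<sigma> has the form [c, \<sigma>] with c in N and is removed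
  by conjugation. The rest e0 is killed by a power of ad \<sigma>, which suffices for [s, e0] =
  0.\<close>

lemma jordan_inner:
  assumes x: "x \<in> vecs n"
  shows "\<exists>s\<in>vecs n. \<exists>u\<in>vecs n. \<exists>q a b k. x = s + u \<and> a * q + b * pderiv q = 1 \<and>
    (\<forall>v\<in>vecs n. pop (br s) q v = 0 \<and> (br u ^^ k) v = 0) \<and> br s u = 0"
proof -
  let ?G = "vecs n :: 'f fvec set"
  obtain e where e: "e \<in> N" "x - e \<in> S" using decomposition[OF x] by blast
  define \<sigma> where "\<sigma> = x - e"
  obtain s d q a b k where J: "s \<in> S" "d \<in> S" "\<sigma> = s + d" "a * q + b * pderiv q = 1"
    "\<And>v. v \<in> ?G \<Longrightarrow> pop (br s) q v = 0" "\<And>v. v \<in> ?G \<Longrightarrow> (br d ^^ k) v = 0" "br s d = 0"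
    using jordan_S[of \<sigma>] e(2) unfolding \<sigma>_def by blast
  have G: "s \<in> ?G" "d \<in> ?G" "\<sigma> \<in> ?G" using J(1,2) e(2) S_vecs by (auto simp: \<sigma>_def)
  obtain l where l: "l > 0" and fit: "\<forall>W. fv.subspace W \<longrightarrow> W \<subseteq> ?G \<longrightarrow> (\<forall>v\<in>W. br \<sigma> v \<in> W) \<longrightarrow>
      (\<forall>v\<in>W. \<exists>w\<in>W. (br \<sigma> ^^ l) (v - (br \<sigma> ^^ l) w) = 0)"
    using fitting_decomposition[where T = "br \<sigma>" and n = n, OF lin_br br_vecs] by (elim exE conjE) (rule that)
  obtain w where w: "w \<in> N" "(br \<sigma> ^^ l) (e - (br \<sigma> ^^ l) w) = 0"
    using fit[rule_format, OF ND(1,2) br_N(1)[OF _ G(3)] e(1)] by blast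
  obtain l' where l': "l = Suc l'" using l by (cases l) auto
  \<comment> \<open>Chosen so that [c, \<sigma>] = \<open>(br \<sigma> ^^ l) w\<close>; the sign
    comes from antisymmetry, and l > 0 leaves one factor ad \<sigma> to spare.\<close>
  define c where "c = - (br \<sigma> ^^ l') w"
  have lw: "(br \<sigma> ^^ l') w \<in> N" by (rule funpow_invariant[OF br_N(1)[OF _ G(3)] w(1)])
  then have c: "c \<in> N" by (simp add: c_def fv.subspace_neg ND)
  have cG: "c \<in> ?G" using c N_vecs by blast
  define e0 where "e0 = e - br c \<sigma>"
  have c\<sigma>: "br c \<sigma> = (br \<sigma> ^^ l) w" using br_anti[of c \<sigma>] by (simp add: c_def l' br_simps)
  have e0: "e0 \<in> N" unfolding e0_def by (rule fv.subspace_diff[OF ND(1) e(1) br_N(2)[OF c G(3)]])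
  have e0_nil: "(br \<sigma> ^^ l) e0 = 0" using w(2) by (simp add: e0_def c\<sigma>)
  have sd: "br s (br d v) = br d (br s v)" for v using br_jacobi[of s d v] J(7) by simp
  have s\<sigma>: "br \<sigma> v = br s v + br d v" for v by (simp add: J(3) br_simps)
  \<comment> \<open>On the null component of ad \<sigma> the operator ad s = ad \<sigma> - ad d is a
    difference of commuting nilpotent operators, so nilpotent; being semisimple as well, it is
    0.\<close>
  have se0: "br s e0 = 0"
  proof -
    define U where "U = {v \<in> N. (br \<sigma> ^^ l) v = 0}"
    have pw: "(br \<sigma> ^^ i) (br s v) = br s ((br \<sigma> ^^ i) v)" for i v
      using funpow_intertwine[of UNIV "br s" "br \<sigma>" "br \<sigma>" v i] sd by (simp add: s\<sigma> br_simps)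
    have U: "fv.subspace U" unfolding U_def by (rule subspace_kernel[OF lin_funpow[OF lin_br] ND(1)])
    have Us: "br s v \<in> U" if "v \<in> U" for v using that pw br_N(1) G(1) by (simp add: U_def)
    have UN: "U \<subseteq> ?G" using N_vecs by (auto simp: U_def)
    have nilU: "(br s ^^ (l + k)) v = 0" if v: "v \<in> U" for v
    proof (rule nilpotent_commuting_sum[where G = UNIV and A = "br \<sigma>" and B = "br d"])
      show "br s = (\<lambda>v. br \<sigma> v - br d v)" by (simp add: s\<sigma>)
      show "br \<sigma> (br d v) = br d (br \<sigma> v)" for v using sd by (simp add: s\<sigma> br_simps)
      show "(br \<sigma> ^^ l) v = 0" using v by (simp add: U_def)
      show "(br d ^^ k) v = 0" using v UN J(6) by blast
    qed (auto simp: lin_br)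
    have qU: "pop (br s) q v = 0" if "v \<in> U" for v using J(5) UN that by blast
    have "e0 \<in> U" using e0 e0_nil by (simp add: U_def)
    then show ?thesis using separable_nilpotent_zero[OF lin_br U UN Us qU J(4) nilU] by blast
  qed
  define y where "y = d + e0"
  have yG: "y \<in> ?G" unfolding y_def using G e0 N_vecs by (intro fv.subspace_add[OF subspace_vecs]) auto
  have y_N: "br y v = br d v" if "v \<in> N" for v using N_abelian[OF e0 that] by (simp add: y_def br_simps)
  \<comment> \<open>Modulo N, y acts as d, so k steps lead into N; on the abelian ideal N it acts as
    d again, and k more steps give 0.\<close>
  have y_nil: "(br y ^^ (k + k)) v = 0" if v: "v \<in> ?G" for v
  proof -
    have "(br y ^^ i) v - (br d ^^ i) v \<in> N" for i
    proof (induction i)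
      case 0
      then show ?case using fv.subspace_0[OF ND(1)] by simp
    next
      case (Suc i)
      have "(br y ^^ i) v \<in> ?G" by (rule funpow_invariant[OF br_vecs v])
      moreover have "(br y ^^ Suc i) v - (br d ^^ Suc i) v =
          br d ((br y ^^ i) v - (br d ^^ i) v) + br e0 ((br y ^^ i) v)"
        by (simp add: y_def br_simps)
      ultimately show ?case using Suc br_N G(2) e0 fv.subspace_add[OF ND(1)] by simp
    qed
    from this[of k] have yk: "(br y ^^ k) v \<in> N" using J(6)[OF v] by simp
    have "(br y ^^ k) z = (br d ^^ k) z" if "z \<in> N" for z
      using funpow_intertwine[of N "\<lambda>v. v" "br y" "br d" z k] y_N br_N(1)[OF _ yG] that by simp
    then show ?thesis using yk J(6) N_vecs by (simp add: funpow_add)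
  qed
  have sy: "br s y = 0" using J(7) se0 by (simp add: y_def br_simps)
  text \<open>Conjugation by the automorphism \<open>1 + ad c\<close>.\<close>
  define \<theta> where "\<theta> = (\<lambda>v. v + br c v)"
  have \<theta>: "lin \<theta>" unfolding \<theta>_def by (rule lin_plus[OF lin_id lin_br])
  have \<theta>G: "\<theta> v \<in> ?G" if "v \<in> ?G" for v
    unfolding \<theta>_def by (rule fv.subspace_add[OF subspace_vecs that br_vecs])
  \<comment> \<open>1 + ad c is the exponential of ad c, because (ad c)^2 = 0. The term [[c, z],
    [c, v]] vanishes as N is abelian.\<close>
  have \<theta>_hom: "\<theta> (br z v) = br (\<theta> z) (\<theta> v)" if "z \<in> ?G" "v \<in> ?G" for z v
    using N_abelian[OF br_N(2)[OF c that(1)] br_N(2)[OF c that(2)]] br_jacobi[of c z v]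
    by (simp add: \<theta>_def br_simps)
  have \<theta>_inv: "\<theta> (v - br c v) = v" if "v \<in> ?G" for v
    using N_abelian[OF c br_N(2)[OF c that]] by (simp add: \<theta>_def br_simps)
  have invG: "v - br c v \<in> ?G" if "v \<in> ?G" for v by (rule fv.subspace_diff[OF subspace_vecs that br_vecs])
  have "pop (br (\<theta> s)) q v = 0" if v: "v \<in> ?G" for v
  proof -
    have "\<theta> (pop (br s) q (v - br c v)) = pop (br (\<theta> s)) q (\<theta> (v - br c v))"
      by (rule pop_intertwine[OF \<theta> lin_br lin_br subspace_vecs \<theta>_hom[OF G(1)] br_vecs invG[OF v]])
    then show ?thesis using J(5)[OF invG[OF v]] by (simp add: \<theta>_inv[OF v] lin_0[OF \<theta>])
  qed
  moreover have "(br (\<theta> y) ^^ (k + k)) v = 0" if v: "v \<in> ?G" for v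
  proof -
    have "\<theta> ((br y ^^ (k + k)) (v - br c v)) = (br (\<theta> y) ^^ (k + k)) (\<theta> (v - br c v))"
      by (rule funpow_intertwine[where W = ?G]) (simp_all add: \<theta>_hom[OF yG] br_vecs invG[OF v])
    then show ?thesis using y_nil[OF invG[OF v]] by (simp add: \<theta>_inv[OF v] lin_0[OF \<theta>])
  qed
  moreover have "br (\<theta> s) (\<theta> y) = 0" using \<theta>_hom[OF G(1) yG] sy lin_0[OF \<theta>] by simp
  moreover have "x = \<theta> s + \<theta> y"
  proof -
    have "br c e0 = 0" using N_abelian[OF c e0] .
    then have "\<theta> s + \<theta> y = \<sigma> + e0 + br c \<sigma>" by (simp add: \<theta>_def y_def J(3) br_simps)
    then show ?thesis by (simp add: e0_def \<sigma>_def)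
  qed
  ultimately show ?thesis using J(4) \<theta>G[OF G(1)] \<theta>G[OF yG] by blast
qed

lemma all_subalgebras_frattini_free:
  assumes H: "\<And>B. subalg B \<Longrightarrow> almost_alg B \<Longrightarrow> frattini_free B" and B: "subalg B"
  shows "frattini_free B"
  unfolding frattini_free_def
proof (intro allI impI)
  fix K assume K: "frattini_sub B K"
  then have KB: "ideal_of B K" by (simp add: frattini_sub_def)
  note KD = ideal_ofD[OF KB] and BD = subalgD[OF B]
  have K_abelian: "br x y = 0" if "x \<in> K" "y \<in> K" for x y
    by (rule nilpotent_subalg_abelian[OF H ideal_subalg[OF KB BD(2)] frattini_nilpotent[OF B K] that])
  define M where "M = {x \<in> vecs n. \<forall>k\<in>K. br x k \<in> K}"
  have M: "subalg M" unfolding subalg_def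
  proof (intro conjI ballI)
    show "fv.subspace M" using KD(1) subspace_vecs[of n] by (auto simp: M_def fv.subspace_def br_simps)
    show "br x y \<in> M" if "x \<in> M" "y \<in> M" for x y
      using that fv.subspace_diff[OF KD(1)] by (auto simp: M_def br_vecs br_br)
  qed (auto simp: M_def)
  note MD = subalgD[OF M]
  have BM: "B \<subseteq> M" using BD KD by (auto simp: M_def)
  have KM: "ideal_of M K"
    by (rule ideal_ofI[OF KD(1)]) (use BM KD(2) in \<open>auto simp: M_def\<close>)
  have "almost_alg M" unfolding almost_alg_def
  proof (intro ballI)
    fix x assume x: "x \<in> M"
    then have "x \<in> vecs n" by (simp add: M_def)
    then obtain s u q a b k where J: "s \<in> vecs n" "u \<in> vecs n" "x = s + u" "a * q + b * pderiv q = 1"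
      "\<And>v. v \<in> vecs n \<Longrightarrow> pop (br s) q v = 0" "\<And>v. v \<in> vecs n \<Longrightarrow> (br u ^^ k) v = 0" "br s u = 0"
      using jordan_inner by blast
    have comm: "br s (br u v) = br u (br s v)" for v using br_jacobi[of s u v] J(7) by simp
    have eq: "(\<lambda>v. br s v + br u v) = br x" by (rule ext) (simp add: J(3) br_simps)
    obtain P where P: "\<And>v. v \<in> vecs n \<Longrightarrow> pop (br x) P v = br s v"
      by (rule semisimple_part_polynomial[OF lin_br lin_br br_vecs br_vecs comm J(5,4,6)]) (auto simp: eq)
    have "br s v \<in> K" if "v \<in> K" for v
    proof -
      have "pop (br x) P v \<in> K"
        by (rule pop_invariant[OF lin_br _ KD(1) that]) (use x in \<open>simp add: M_def\<close>)
      then show ?thesis using P that KD(2) BD(2) by auto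
    qed
    then have sM: "s \<in> M" using J(1) by (simp add: M_def)
    have uM: "u \<in> M" using fv.subspace_diff[OF MD(1) x sM] J(3) by simp
    \<comment> \<open>The relation q(ad s) = 0 holds on M too, so complements can be found inside
      M.\<close>
    have "complemented_in M (br s)"
      by (rule separable_complemented[OF lin_br MD(1,2) MD(3)[OF sM] J(5)[OF subsetD[OF MD(2)]] J(4)])
    then show "\<exists>s\<in>M. \<exists>u\<in>M. (\<forall>v\<in>M. br x v = br s v + br u v) \<and> (\<forall>v\<in>M. br s (br u v) = br u (br s v)) \<and>
        (\<exists>k. \<forall>v\<in>M. (br u ^^ k) v = 0) \<and> complemented_in M (br s)"
      using sM uM comm J(6) MD(2) by (intro bexI[OF _ sM] bexI[OF _ uM]) (auto simp: J(3) br_simps)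
  qed
  then obtain C where C: "subalg C" "C \<subseteq> M" "\<And>v. v \<in> M \<Longrightarrow> \<exists>k\<in>K. v - k \<in> C" "K \<inter> C = {0}"
    using abelian_ideal_complement[OF M H[OF M] KM K_abelian] by metis
  show "K = {0}"
  proof (cases "B \<subseteq> C")
    case True
    then show ?thesis using KD(2) C(4) by blast
  next
    case False
    then obtain T where T: "maxsub B T" "C \<inter> B \<subseteq> T"
      using exists_maxsub[OF B subalg_inter[OF C(1) B]] by blast
    then have KT: "K \<subseteq> T" "fv.subspace T" using K by (auto simp: frattini_sub_def maxsub_def subalg_def)
    have "v \<in> T" if v: "v \<in> B" for v
    proof -
      obtain k where k: "k \<in> K" "v - k \<in> C" using C(3) v BM by blast
      then have "v - k \<in> T" using T(2) v KD(2) fv.subspace_diff[OF BD(1)] by blast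
      then show ?thesis using fv.subspace_add[OF KT(2), of "v - k" k] KT(1) k(1) by auto
    qed
    then show ?thesis using T(1) by (auto simp: maxsub_def)
  qed
qed

end

subsection \<open>Leibniz algebras in coordinates\<close>

context coord_algebra
begin

lemma lcs_zero_mono:
  assumes "lcs J p \<subseteq> {0}" "p \<le> k"
  shows "lcs J k \<subseteq> {0}"
  using assms(2)
proof (induction rule: dec_induct)
  case (step k)
  then show ?case unfolding lcs.simps by (intro fv.span_minimal) auto
qed (rule assms(1))

lemma lcs_subspace: "fv.subspace J \<Longrightarrow> fv.subspace (lcs J k)"
  by (cases k) auto

lemma nilpotent_setI: "fv.subspace J \<Longrightarrow> lcs J k \<subseteq> {0} \<Longrightarrow> nilpotent_set J"
  unfolding nilpotent_set_def using fv.subspace_0[OF lcs_subspace] by blast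

lemma lcs_subset: "subalg J \<Longrightarrow> lcs J k \<subseteq> J"
proof (induction k)
  case (Suc k)
  then show ?case unfolding lcs.simps by (intro fv.span_minimal) (auto dest: subalgD)
qed simp

lemma ideal_sum:
  assumes A: "ideal_of B J" and B: "ideal_of B K" and Bs: "fv.subspace B"
  shows "ideal_of B {a + b | a b. a \<in> J \<and> b \<in> K}"
  unfolding ideal_of_def
proof (intro conjI ballI)
  show "fv.subspace {a + b |a b. a \<in> J \<and> b \<in> K}" using ideal_ofD[OF A] ideal_ofD[OF B] by (intro subspace_sum)
  show "{a + b |a b. a \<in> J \<and> b \<in> K} \<subseteq> B"
    using ideal_ofD(2)[OF A] ideal_ofD(2)[OF B] fv.subspace_add[OF Bs] by blast
  fix x y assume "x \<in> {a + b |a b. a \<in> J \<and> b \<in> K}" and y: "y \<in> B"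
  then obtain a b where x: "x = a + b" "a \<in> J" "b \<in> K" by blast
  have "br x y = br a y + br b y" "br y x = br y a + br y b" by (simp_all add: x br_simps)
  then show "br x y \<in> {a + b |a b. a \<in> J \<and> b \<in> K}" "br y x \<in> {a + b |a b. a \<in> J \<and> b \<in> K}"
    using ideal_ofD(3,4)[OF A x(2) y] ideal_ofD(3,4)[OF B x(3) y] by blast+
qed

lemma frattini_sub_sum:
  assumes J: "frattini_sub B J" and K: "frattini_sub B K" and Bs: "fv.subspace B"
  shows "frattini_sub B {a + b | a b. a \<in> J \<and> b \<in> K}"
  unfolding frattini_sub_def
proof (intro conjI allI impI)
  show "ideal_of B {a + b |a b. a \<in> J \<and> b \<in> K}"
    using J K Bs by (intro ideal_sum) (auto simp: frattini_sub_def)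
  fix M assume M: "maxsub B M"
  then have "J \<subseteq> M" "K \<subseteq> M" "fv.subspace M"
    using J K by (auto simp: frattini_sub_def maxsub_def subalg_def)
  then show "{a + b |a b. a \<in> J \<and> b \<in> K} \<subseteq> M" using fv.subspace_add by blast
qed

section \<open>Existence of largest ideals\<close>

text \<open>A member of largest dimension is the largest member, since its sum with another member
  cannot be bigger. This gives meaning to both \<open>GREATEST\<close> expressions, for the Frattini
  ideal and for the nilradical.\<close>

lemma exists_greatest_subspace:
  fixes P :: "'f fvec set \<Rightarrow> bool"
  assumes P0: "P Z" and sub: "\<And>J. P J \<Longrightarrow> fv.subspace J \<and> J \<subseteq> vecs n"
    and sum: "\<And>J K. P J \<Longrightarrow> P K \<Longrightarrow> P {a + b | a b. a \<in> J \<and> b \<in> K}"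
  shows "\<exists>J. P J \<and> (\<forall>K. P K \<longrightarrow> K \<subseteq> J)"
proof -
  have "fv.dim J < Suc n" if "P J" for J
    using dim_le_vecs[of J n] sub[OF that] by simp
  then have "\<exists>J. P J \<and> (\<forall>K. P K \<longrightarrow> fv.dim K \<le> fv.dim J)"
    by (intro ex_has_greatest_nat[of P Z fv.dim "Suc n"] P0) blast
  then obtain J where J: "P J" "\<And>K. P K \<Longrightarrow> fv.dim K \<le> fv.dim J" by blast
  have "K \<subseteq> J" if K: "P K" for K
  proof -
    let ?T = "{a + b | a b. a \<in> J \<and> b \<in> K}"
    have T: "P ?T" by (rule sum[OF J(1) K])
    have 0: "0 \<in> J" "0 \<in> K" using sub J(1) K fv.subspace_0 by blast+
    have "\<not> J \<subset> ?T"
      using dim_strict_mono[of J ?T n] J(2)[OF T] sub[OF T] sub[OF J(1)] by auto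
    then have "?T = J" using subset_sum_left[OF 0(2), of J] by blast
    then show ?thesis using subset_sum_right[OF 0(1), of K] by blast
  qed
  then show ?thesis using J(1) by blast
qed

lemma zero_ideal: "fv.subspace B \<Longrightarrow> ideal_of B {0}"
  by (auto simp: ideal_of_def fv.subspace_0 fv.subspace_single_0)

lemma exists_greatest_frattini:
  assumes "subalg B"
  shows "\<exists>J. frattini_sub B J \<and> (\<forall>K. frattini_sub B K \<longrightarrow> K \<subseteq> J)"
proof (rule exists_greatest_subspace)
  note BD = subalgD[OF assms]
  show "frattini_sub B {0}"
    using zero_ideal[OF BD(1)] by (auto simp: frattini_sub_def maxsub_def subalg_def fv.subspace_0)
  show "fv.subspace J \<and> J \<subseteq> vecs n" if "frattini_sub B J" for J
    using that BD(2) by (auto simp: frattini_sub_def ideal_of_def)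
  show "frattini_sub B {a + b |a b. a \<in> J \<and> b \<in> K}" if "frattini_sub B J" "frattini_sub B K" for J K
    by (rule frattini_sub_sum[OF that BD(1)])
qed

section \<open>Complete reducibility of bimodules\<close>

definition sub_bimod :: "'f fvec set \<Rightarrow> 'f fvec set \<Rightarrow> bool" where
  "sub_bimod S A \<longleftrightarrow> fv.subspace A \<and> (\<forall>a\<in>A. \<forall>s\<in>S. br a s \<in> A \<and> br s a \<in> A)"

lemma sub_bimod_sum:
  assumes "sub_bimod S A" "sub_bimod S B"
  shows "sub_bimod S {a + b | a b. a \<in> A \<and> b \<in> B}"
  unfolding sub_bimod_def
proof (intro conjI ballI)
  show "fv.subspace {a + b | a b. a \<in> A \<and> b \<in> B}" using assms by (intro subspace_sum) (auto simp: sub_bimod_def)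
  fix x s assume "x \<in> {a + b | a b. a \<in> A \<and> b \<in> B}" and s: "s \<in> S"
  then obtain a b where x: "x = a + b" "a \<in> A" "b \<in> B" by blast
  have "br x s = br a s + br b s" "br s x = br s a + br s b" by (simp_all add: x br_simps)
  moreover have "br a s \<in> A" "br s a \<in> A" "br b s \<in> B" "br s b \<in> B"
    using x s assms by (auto simp: sub_bimod_def)
  ultimately show "br x s \<in> {a + b | a b. a \<in> A \<and> b \<in> B}" "br s x \<in> {a + b | a b. a \<in> A \<and> b \<in> B}"
    by blast+
qed

text \<open>W' is a sub-bimodule of largest dimension that meets W in 0. An irreducible A not inside
  W + W' meets this sum in 0, so W' + A would be larger with the same property.\<close>

lemma completely_reducible_complement:
  assumes irr: "\<And>A B. A \<in> \<A> \<Longrightarrow> sub_bimod S B \<Longrightarrow> B \<subseteq> A \<Longrightarrow> B = {0} \<or> B = A"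
    and bi: "\<And>A. A \<in> \<A> \<Longrightarrow> sub_bimod S A" and V: "fv.span (\<Union>\<A>) = V" "V \<subseteq> vecs n"
    and W: "sub_bimod S W" "W \<subseteq> V"
  shows "\<exists>W'. sub_bimod S W' \<and> W' \<subseteq> V \<and> W \<inter> W' = {0} \<and> (\<forall>v\<in>V. \<exists>w\<in>W. v - w \<in> W')"
proof -
  have V_sub: "fv.subspace V" using V(1) by auto
  have AV: "A \<subseteq> V" if "A \<in> \<A>" for A using that V(1) fv.span_superset[of "\<Union>\<A>"] by blast
  let ?P = "\<lambda>W'. sub_bimod S W' \<and> W' \<subseteq> V \<and> W \<inter> W' = {0}"
  have "fv.dim W' < Suc n" if "?P W'" for W'
    using dim_le_vecs[of W' n] that V(2) unfolding sub_bimod_def by (meson le_imp_less_Suc subset_trans)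
  moreover have P0: "?P {0}"
    using W V_sub by (auto simp: sub_bimod_def fv.subspace_0 fv.subspace_single_0)
  ultimately have "\<exists>W'. ?P W' \<and> (\<forall>T. ?P T \<longrightarrow> fv.dim T \<le> fv.dim W')"
    by (intro ex_has_greatest_nat[of ?P "{0}" fv.dim "Suc n"]) blast+
  then obtain W' where W': "?P W'" "\<And>T. ?P T \<Longrightarrow> fv.dim T \<le> fv.dim W'" by blast
  let ?T = "{a + b | a b. a \<in> W \<and> b \<in> W'}"
  have T: "sub_bimod S ?T" using W(1) W'(1) by (intro sub_bimod_sum) auto
  then have T_sub: "fv.subspace ?T" by (simp add: sub_bimod_def)
  have WT: "W \<subseteq> ?T" by (rule subset_sum_left) (use W'(1) fv.subspace_0 in \<open>auto simp: sub_bimod_def\<close>)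
  have W'T: "W' \<subseteq> ?T" by (rule subset_sum_right) (use W(1) fv.subspace_0 in \<open>auto simp: sub_bimod_def\<close>)
  have "A \<subseteq> ?T" if A: "A \<in> \<A>" for A
  proof (rule ccontr)
    assume nA: "\<not> A \<subseteq> ?T"
    have "sub_bimod S (A \<inter> ?T)" using bi[OF A] T by (auto simp: sub_bimod_def fv.subspace_inter)
    then have "A \<inter> ?T = {0} \<or> A \<inter> ?T = A" by (rule irr[OF A]) simp
    then have AT: "A \<inter> ?T = {0}" using nA by blast
    let ?R = "{a + b | a b. a \<in> W' \<and> b \<in> A}"
    have R: "sub_bimod S ?R" using bi[OF A] W'(1) by (intro sub_bimod_sum) auto
    have "W' \<subseteq> ?R" by (rule subset_sum_left) (use bi[OF A] fv.subspace_0 in \<open>auto simp: sub_bimod_def\<close>)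
    moreover have AR: "A \<subseteq> ?R" by (rule subset_sum_right) (use W'(1) fv.subspace_0 in \<open>auto simp: sub_bimod_def\<close>)
    moreover have "?R \<noteq> W'"
    proof
      assume "?R = W'"
      with AR W'T have "A \<subseteq> ?T" by (rule_tac subset_trans) simp_all
      with nA show False ..
    qed
    ultimately have "W' \<subset> ?R" by (intro psubsetI) auto
    moreover have RV: "?R \<subseteq> V" using W'(1) AV[OF A] fv.subspace_add[OF V_sub] by blast
    ultimately have "fv.dim W' < fv.dim ?R"
      using W'(1) R V(2) by (intro dim_strict_mono[of _ _ n]) (auto simp: sub_bimod_def)
    moreover have "W \<inter> ?R = {0}"
    proof -
      have "w = 0" if w: "w \<in> W" "w = b + a" "b \<in> W'" "a \<in> A" for w a b
      proof -
        have "a = w + (- b)" using w by simp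
        moreover have "- b \<in> W'" using w W'(1) by (auto simp: sub_bimod_def intro: fv.subspace_neg)
        ultimately have "a \<in> ?T" using w by blast
        then have "a = 0" using AT w by blast
        then show ?thesis using w W'(1) by auto
      qed
      moreover have "0 \<in> W" "0 \<in> ?R" using W(1) R fv.subspace_0 unfolding sub_bimod_def by blast+
      ultimately show ?thesis by blast
    qed
    ultimately show False using W'(2)[of ?R] R RV by auto
  qed
  then have "V \<subseteq> ?T" using V(1) fv.span_minimal[OF _ T_sub, of "\<Union>\<A>"] by blast
  then have "\<exists>w\<in>W. v - w \<in> W'" if v: "v \<in> V" for v
  proof -
    obtain a b where "v = a + b" "a \<in> W" "b \<in> W'" using \<open>V \<subseteq> ?T\<close> v by blast
    then show ?thesis by (intro bexI[of _ a]) auto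
  qed
  then show ?thesis using W'(1) by blast
qed

end

section \<open>Algebras with both Leibniz identities\<close>

locale coord_leibniz = coord_algebra n br
  for n and br :: "'f::field_char_0 fvec \<Rightarrow> 'f fvec \<Rightarrow> 'f fvec" +
  assumes br_left_leibniz: "br x (br y z) = br (br x y) z + br y (br x z)"
    and br_right_leibniz: "br x (br y z) = br (br x y) z - br (br x z) y"
begin

definition square_span :: "'f fvec set" where
  "square_span = fv.span {br x x | x. x \<in> vecs n}"

lemma square_span_subspace: "fv.subspace square_span"
  by (simp add: square_span_def)

lemma square_in: "x \<in> vecs n \<Longrightarrow> br x x \<in> square_span"
  unfolding square_span_def by (rule fv.span_base) blast

lemma square_span_vecs: "square_span \<subseteq> vecs n"
  unfolding square_span_def by (rule fv.span_minimal) (auto simp: br_vecs subspace_vecs)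

text \<open>The left identity for [y, [y, x]] gives [[y, y], x] = 0, the right one for [x, [y, y]]
  gives [x, [y, y]] = 0.\<close>

lemma square_span_annihilates: "i \<in> square_span \<Longrightarrow> br i x = 0" "i \<in> square_span \<Longrightarrow> br x i = 0"
proof -
  have "square_span \<subseteq> {i. br i x = 0 \<and> br x i = 0}" unfolding square_span_def
  proof (rule fv.span_minimal)
    show "fv.subspace {i. br i x = 0 \<and> br x i = 0}" by (auto simp: fv.subspace_def br_simps)
    have "br (br y y) x = 0" "br x (br y y) = 0" for y
      using br_left_leibniz[of y y x] br_right_leibniz[of x y y] by simp_all
    then show "{br x x |x. x \<in> vecs n} \<subseteq> {i. br i x = 0 \<and> br x i = 0}" by auto
  qed
  then show "i \<in> square_span \<Longrightarrow> br i x = 0" "i \<in> square_span \<Longrightarrow> br x i = 0" by blast+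
qed

lemma square_span_ideal: "ideal_of (vecs n) square_span"
  using square_span_annihilates fv.subspace_0[OF square_span_subspace]
  by (simp add: ideal_of_def square_span_subspace square_span_vecs)

lemma square_span_nilpotent: "nilpotent_set square_span"
proof (rule nilpotent_setI[OF square_span_subspace])
  show "lcs square_span 1 \<subseteq> {0}"
    unfolding One_nat_def lcs.simps by (rule fv.span_minimal) (auto simp: square_span_annihilates)
qed

lemma square_span_frattini: "frattini_sub (vecs n) square_span"
  unfolding frattini_sub_def
proof (intro conjI allI impI square_span_ideal)
  fix M assume M: "maxsub (vecs n) M"
  then have Ms: "subalg M" "M \<subseteq> vecs n" by (auto simp: maxsub_def)
  show "square_span \<subseteq> M"
  proof (rule ccontr)
    assume *: "\<not> square_span \<subseteq> M"
    let ?T = "{a + b | a b. a \<in> M \<and> b \<in> square_span}"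
    have T: "subalg ?T" by (rule subalg_sum[OF subalg_vecs Ms square_span_ideal])
    have "M \<subseteq> ?T" by (rule subset_sum_left[OF fv.subspace_0[OF square_span_subspace]])
    moreover have "square_span \<subseteq> ?T" by (rule subset_sum_right[OF fv.subspace_0[OF subalgD(1)[OF Ms(1)]]])
    then have "?T \<noteq> M" using * by blast
    ultimately have eq: "?T = vecs n" using maxsubD[OF M T] subalgD(2)[OF T] by blast
    \<comment> \<open>Since b annihilates everything, the square of a + b is the square of
      a.\<close>
    have "br x x \<in> M" if "x \<in> vecs n" for x
    proof -
      from that eq obtain a b where ab: "x = a + b" "a \<in> M" "b \<in> square_span" by blast
      then show ?thesis using subalgD(3)[OF Ms(1), of a a] by (simp add: br_simps square_span_annihilates)
    qed
    then have "square_span \<subseteq> M"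
      unfolding square_span_def by (intro fv.span_minimal subalgD(1)[OF Ms(1)]) blast
    then show False using * by blast
  qed
qed

section \<open>Sums of nilpotent ideals\<close>

lemma lcs_right_ideal:
  assumes A: "ideal_of (vecs n) A"
  shows "a \<in> lcs A k \<Longrightarrow> x \<in> vecs n \<Longrightarrow> br a x \<in> lcs A k"
proof (induction k arbitrary: a x)
  case 0
  then show ?case using ideal_ofD(3)[OF A] by simp
next
  case (Suc k)
  have "{br a b | a b. a \<in> lcs A k \<and> b \<in> A} \<subseteq> {c. br c x \<in> lcs A (Suc k)}"
  proof
    fix c assume "c \<in> {br a b | a b. a \<in> lcs A k \<and> b \<in> A}"
    then obtain a b where c: "c = br a b" "a \<in> lcs A k" "b \<in> A" by blast
    have "br c x = br a (br b x) + br (br a x) b"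
      using br_right_leibniz[of a b x] by (simp add: c)
    moreover have "br a (br b x) \<in> lcs A (Suc k)" "br (br a x) b \<in> lcs A (Suc k)"
      using c Suc.IH[OF c(2) Suc.prems(2)] ideal_ofD(3)[OF A c(3) Suc.prems(2)]
      unfolding lcs.simps by (blast intro: fv.span_base)+
    ultimately show "c \<in> {c. br c x \<in> lcs A (Suc k)}"
      using fv.subspace_add[OF lcs_subspace[OF ideal_ofD(1)[OF A], of "Suc k"]] by (simp del: lcs.simps)
  qed
  moreover have "fv.subspace {c. br c x \<in> lcs A (Suc k)}"
    using lcs_subspace[OF ideal_ofD(1)[OF A], of "Suc k"] by (auto simp: fv.subspace_def br_simps)
  ultimately have "fv.span {br a b | a b. a \<in> lcs A k \<and> b \<in> A} \<subseteq> {c. br c x \<in> lcs A (Suc k)}"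
    by (rule fv.span_minimal)
  then show ?case using Suc.prems(1) unfolding lcs.simps by blast
qed

text \<open>A left-normed product of elements of two ideals \<open>A\<close> and \<open>B\<close> with \<open>i\<close> factors in \<open>A\<close> and \<open>j\<close>
  factors in \<open>B\<close> lies in \<open>A\<^sup>i \<inter> B\<^sup>j\<close>, where the zeroth power is the whole algebra.\<close>

lemma nilpotent_ideal_sum:
  assumes A: "ideal_of (vecs n) A" "nilpotent_set A" and B: "ideal_of (vecs n) B" "nilpotent_set B"
  shows "nilpotent_set {a + b | a b. a \<in> A \<and> b \<in> B}"
proof -
  let ?C = "{a + b | a b. a \<in> A \<and> b \<in> B}"
  \<comment> \<open>The index is shifted so that i counts factors: \<open>lcs J k\<close> is the
    power k + 1 of J.\<close>
  define pw where "pw J i = (case i of 0 \<Rightarrow> vecs n | Suc k \<Rightarrow> lcs J k)" for J i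
  have pw_right: "br a x \<in> pw J i" if "ideal_of (vecs n) J" "a \<in> pw J i" "x \<in> vecs n" for J i a x
    using that lcs_right_ideal by (cases i) (auto simp: pw_def br_vecs)
  have pw_step: "br a x \<in> pw J (Suc i)" if J: "ideal_of (vecs n) J" "a \<in> pw J i" "x \<in> J" for J i a x
  proof (cases i)
    case 0
    then show ?thesis using J ideal_ofD(4)[OF J(1)] by (simp add: pw_def)
  next
    case (Suc k)
    then show ?thesis using J by (auto simp: pw_def intro!: fv.span_base)
  qed
  \<comment> \<open>The span for k + 1 factors, sorted by the number i of factors from A.\<close>
  define P where "P k = fv.span (\<Union>i\<in>{..Suc k}. pw A i \<inter> pw B (Suc k - i))" for k
  have C: "ideal_of (vecs n) ?C" by (rule ideal_sum[OF A(1) B(1) subspace_vecs])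
  have sub: "lcs ?C k \<subseteq> P k" for k
  proof (induction k)
    case 0
    have "P 0 = fv.span (vecs n \<inter> B \<union> A \<inter> vecs n)"
      by (simp add: P_def pw_def atMost_Suc Un_commute)
    then have "vecs n \<inter> B \<subseteq> P 0" "A \<inter> vecs n \<subseteq> P 0"
      using fv.span_superset[of "vecs n \<inter> B \<union> A \<inter> vecs n"] by simp_all
    then have "A \<subseteq> P 0" "B \<subseteq> P 0"
      using ideal_ofD(2)[OF A(1)] ideal_ofD(2)[OF B(1)] by auto
    then show ?case using fv.subspace_add[of "P 0"] by (auto simp: P_def)
  next
    case (Suc k)
    have "br s c \<in> P (Suc k)" if s: "s \<in> P k" and c: "c \<in> ?C" for s c
    proof -
      from c obtain a b where ab: "c = a + b" "a \<in> A" "b \<in> B" by blast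
      have av: "a \<in> vecs n" "b \<in> vecs n" using ab ideal_ofD(2)[OF A(1)] ideal_ofD(2)[OF B(1)] by auto
      have "P k \<subseteq> {s. br s c \<in> P (Suc k)}" unfolding P_def[of k]
      proof (rule fv.span_minimal)
        show "fv.subspace {s. br s c \<in> P (Suc k)}" by (auto simp: P_def fv.subspace_def br_simps fv.span_add fv.span_scale fv.span_zero)
        show "(\<Union>i\<in>{..Suc k}. pw A i \<inter> pw B (Suc k - i)) \<subseteq> {s. br s c \<in> P (Suc k)}"
        proof
          fix s assume "s \<in> (\<Union>i\<in>{..Suc k}. pw A i \<inter> pw B (Suc k - i))"
          then obtain i where i: "i \<le> Suc k" "s \<in> pw A i" "s \<in> pw B (Suc k - i)" by auto
          have "br s a \<in> pw A (Suc i) \<inter> pw B (Suc (Suc k) - Suc i)"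
            using pw_step[OF A(1) i(2) ab(2)] pw_right[OF B(1) i(3) av(1)] by simp
          then have 1: "br s a \<in> P (Suc k)" unfolding P_def using i(1) by (intro fv.span_base UN_I[of "Suc i"]) auto
          have "br s b \<in> pw A i \<inter> pw B (Suc (Suc k) - i)"
            using pw_step[OF B(1) i(3) ab(3)] pw_right[OF A(1) i(2) av(2)] i(1) by (simp add: Suc_diff_le)
          then have 2: "br s b \<in> P (Suc k)" unfolding P_def using i(1) by (intro fv.span_base UN_I[of i]) auto
          show "s \<in> {s. br s c \<in> P (Suc k)}" using fv.span_add 1 2 by (simp add: ab(1) br_simps P_def)
        qed
      qed
      then show ?thesis using s by blast
    qed
    then show ?case unfolding lcs.simps P_def[of "Suc k"] using Suc by (intro fv.span_minimal) (auto simp: P_def)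
  qed
  obtain p q where pq: "lcs A p = {0}" "lcs B q = {0}" using A B by (auto simp: nilpotent_set_def)
  \<comment> \<open>Among p + q + 2 factors, more than p come from A or more than q from B.\<close>
  have "P (p + q + 1) \<subseteq> {0}" unfolding P_def
  proof (rule fv.span_minimal)
    show "(\<Union>i\<in>{..Suc (p + q + 1)}. pw A i \<inter> pw B (Suc (p + q + 1) - i)) \<subseteq> {0}"
    proof
      fix s assume "s \<in> (\<Union>i\<in>{..Suc (p + q + 1)}. pw A i \<inter> pw B (Suc (p + q + 1) - i))"
      then obtain i where i: "s \<in> pw A i" "s \<in> pw B (Suc (p + q + 1) - i)" by blast
      show "s \<in> {0}"
      proof (cases "i > p")
        case True
        then obtain k where "i = Suc k" "p \<le> k" by (cases i) auto
        then show ?thesis using i(1) lcs_zero_mono[of A p k] pq(1) by (auto simp: pw_def)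
      next
        case False
        then have "Suc (p + q + 1) - i = Suc (p + q + 1 - i)" "q \<le> p + q + 1 - i" by auto
        then show ?thesis using i(2) lcs_zero_mono[of B q "p + q + 1 - i"] pq(2) by (auto simp: pw_def simp del: diff_Suc_Suc)
      qed
    qed
  qed simp
  then have "lcs ?C (p + q + 1) \<subseteq> {0}" using sub by blast
  then show ?thesis by (rule nilpotent_setI[OF ideal_ofD(1)[OF C]])
qed

lemma exists_greatest_nilpotent_ideal:
  "\<exists>J. (ideal_of (vecs n) J \<and> nilpotent_set J) \<and> (\<forall>K. ideal_of (vecs n) K \<and> nilpotent_set K \<longrightarrow> K \<subseteq> J)"
proof (rule exists_greatest_subspace)
  show "ideal_of (vecs n) square_span \<and> nilpotent_set square_span"
    using square_span_ideal square_span_nilpotent by blast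
qed (auto intro: ideal_sum nilpotent_ideal_sum subspace_vecs dest: ideal_ofD)

end

text \<open>The Lie algebra L/I appears as \<open>vecs m\<close> with a surjection \<pi> whose
  kernel is I. Both algebras then live in one type, and images and preimages under \<pi> replace
  cosets.\<close>

locale almost_reductive_leibniz = coord_leibniz n br + G: coord_lie m brG
  for n and br :: "'f::field_char_0 fvec \<Rightarrow> 'f fvec \<Rightarrow> 'f fvec" and m and brG :: "'f fvec \<Rightarrow> 'f fvec \<Rightarrow> 'f fvec" +
  fixes \<pi> :: "'f fvec \<Rightarrow> 'f fvec" and N S :: "'f fvec set"
  assumes \<pi>: "lin \<pi>" "\<And>v. v \<in> vecs n \<Longrightarrow> \<pi> v \<in> vecs m" "\<And>w. w \<in> vecs m \<Longrightarrow> \<exists>v\<in>vecs n. \<pi> v = w"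
    and \<pi>_br: "\<And>u v. u \<in> vecs n \<Longrightarrow> v \<in> vecs n \<Longrightarrow> \<pi> (br u v) = brG (\<pi> u) (\<pi> v)"
    and \<pi>_kernel: "\<And>v. v \<in> vecs n \<Longrightarrow> \<pi> v = 0 \<longleftrightarrow> v \<in> square_span"
    and N: "ideal_of (vecs n) N" "nilpotent_set N"
    and nilmax: "\<And>J. ideal_of (vecs n) J \<Longrightarrow> nilpotent_set J \<Longrightarrow> J \<subseteq> N"
    and S: "subalg S" and decomposition: "\<And>v. v \<in> vecs n \<Longrightarrow> \<exists>a\<in>N. v - a \<in> S" and NS: "N \<inter> S = {0}"
    and complete: "\<And>W. sub_bimod S W \<Longrightarrow> W \<subseteq> N \<Longrightarrow>
      \<exists>W'. sub_bimod S W' \<and> W' \<subseteq> N \<and> W \<inter> W' = {0} \<and> (\<forall>v\<in>N. \<exists>w\<in>W. v - w \<in> W')"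
    and H: "\<And>B. G.subalg B \<Longrightarrow> G.almost_alg B \<Longrightarrow> G.frattini_free B"
begin

lemmas ND = ideal_ofD[OF N(1)] and SD = subalgD[OF S]

lemma square_span_N: "square_span \<subseteq> N"
  by (rule nilmax[OF square_span_ideal square_span_nilpotent])

lemma \<pi>_eq: "u \<in> vecs n \<Longrightarrow> v \<in> vecs n \<Longrightarrow> \<pi> u = \<pi> v \<Longrightarrow> u - v \<in> square_span"
  using \<pi>_kernel[of "u - v"] by (simp add: lin_diff \<pi> fv.subspace_diff subspace_vecs)

lemma image_subalg: "subalg B \<Longrightarrow> G.subalg (\<pi> ` B)"
  unfolding subalg_def G.subalg_def using \<pi> \<pi>_br by (auto intro!: subspace_image) (metis imageI subsetD)

lemma image_ideal:
  assumes "ideal_of B J" "B \<subseteq> vecs n"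
  shows "G.ideal_of (\<pi> ` B) (\<pi> ` J)"
  unfolding G.ideal_of_def
proof (intro conjI ballI)
  note JD = ideal_ofD[OF assms(1)]
  show "fv.subspace (\<pi> ` J)" by (rule subspace_image[OF \<pi>(1) JD(1)])
  show "\<pi> ` J \<subseteq> \<pi> ` B" using JD(2) by blast
  fix x y assume "x \<in> \<pi> ` J" "y \<in> \<pi> ` B"
  then obtain u v where uv: "x = \<pi> u" "y = \<pi> v" "u \<in> J" "v \<in> B" by blast
  then have "u \<in> vecs n" "v \<in> vecs n" using JD(2) assms(2) by auto
  then have "brG x y = \<pi> (br u v)" "brG y x = \<pi> (br v u)" by (simp_all add: uv \<pi>_br)
  then show "brG x y \<in> \<pi> ` J" "brG y x \<in> \<pi> ` J" using uv JD by simp_all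
qed

lemma preimage_subalg:
  assumes "subalg B" "G.subalg C"
  shows "subalg {v \<in> B. \<pi> v \<in> C}"
  unfolding subalg_def
proof (intro conjI ballI)
  show "fv.subspace {v \<in> B. \<pi> v \<in> C}"
    using subalgD(1)[OF assms(1)] G.subalgD(1)[OF assms(2)]
    by (auto simp: fv.subspace_def lin_add lin_smul lin_0 \<pi>)
  show "{v \<in> B. \<pi> v \<in> C} \<subseteq> vecs n" using subalgD(2)[OF assms(1)] by blast
  fix x y assume xy: "x \<in> {v \<in> B. \<pi> v \<in> C}" "y \<in> {v \<in> B. \<pi> v \<in> C}"
  then have "\<pi> (br x y) = brG (\<pi> x) (\<pi> y)" using subalgD(2)[OF assms(1)] by (intro \<pi>_br) auto
  then show "br x y \<in> {v \<in> B. \<pi> v \<in> C}"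
    using xy subalgD(3)[OF assms(1)] G.subalgD(3)[OF assms(2)] by simp
qed

lemma image_lcs:
  assumes "subalg J"
  shows "G.lcs (\<pi> ` J) k \<subseteq> \<pi> ` lcs J k"
proof (induction k)
  case (Suc k)
  have sub: "fv.subspace (\<pi> ` lcs J (Suc k))" by (rule subspace_image[OF \<pi>(1)]) simp
  have "brG x y \<in> \<pi> ` lcs J (Suc k)" if xy: "x \<in> G.lcs (\<pi> ` J) k" "y \<in> \<pi> ` J" for x y
  proof -
    obtain a b where ab: "x = \<pi> a" "y = \<pi> b" "a \<in> lcs J k" "b \<in> J" using xy Suc by blast
    then have "a \<in> vecs n" "b \<in> vecs n" using lcs_subset[OF assms] subalgD(2)[OF assms] by auto
    then have "brG x y = \<pi> (br a b)" by (simp add: ab \<pi>_br)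
    moreover have "br a b \<in> lcs J (Suc k)" unfolding lcs.simps by (rule fv.span_base) (use ab in blast)
    ultimately show ?thesis by blast
  qed
  then show ?case unfolding G.lcs.simps by (intro fv.span_minimal sub) blast
qed simp

lemma lcs_image:
  assumes "subalg J"
  shows "\<pi> ` lcs J k \<subseteq> G.lcs (\<pi> ` J) k"
proof (induction k)
  case (Suc k)
  have "lcs J (Suc k) \<subseteq> {v. \<pi> v \<in> G.lcs (\<pi> ` J) (Suc k)}" unfolding lcs.simps
  proof (rule fv.span_minimal)
    show "fv.subspace {v. \<pi> v \<in> G.lcs (\<pi> ` J) (Suc k)}"
      by (auto simp: fv.subspace_def lin_add lin_smul lin_0 \<pi> fv.span_add fv.span_scale fv.span_zero)
    show "{br a b |a b. a \<in> lcs J k \<and> b \<in> J} \<subseteq> {v. \<pi> v \<in> G.lcs (\<pi> ` J) (Suc k)}"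
    proof
      fix v assume "v \<in> {br a b |a b. a \<in> lcs J k \<and> b \<in> J}"
      then obtain a b where ab: "v = br a b" "a \<in> lcs J k" "b \<in> J" by blast
      then have "a \<in> vecs n" "b \<in> vecs n" using lcs_subset[OF assms] subalgD(2)[OF assms] by auto
      then have "\<pi> v = brG (\<pi> a) (\<pi> b)" by (simp add: ab \<pi>_br)
      moreover have "brG (\<pi> a) (\<pi> b) \<in> G.lcs (\<pi> ` J) (Suc k)"
        unfolding G.lcs.simps by (rule fv.span_base) (use ab Suc in blast)
      ultimately show "v \<in> {v. \<pi> v \<in> G.lcs (\<pi> ` J) (Suc k)}" by simp
    qed
  qed
  then show ?case by blast
qed simp

lemma image_N_abelian:
  assumes "x \<in> \<pi> ` N" "y \<in> \<pi> ` N"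
  shows "brG x y = 0"
proof -
  have Ns: "subalg N" by (rule ideal_subalg[OF N(1) subset_refl])
  obtain k where "lcs N k = {0}" using N(2) by (auto simp: nilpotent_set_def)
  then have "G.lcs (\<pi> ` N) k \<subseteq> {0}" using image_lcs[OF Ns, of k] by (simp add: lin_0 \<pi>)
  then have "G.nilpotent_set (\<pi> ` N)" by (rule G.nilpotent_setI[OF subspace_image[OF \<pi>(1) ND(1)]])
  then show ?thesis using G.nilpotent_subalg_abelian[OF H image_subalg[OF Ns] _ assms] by blast
qed

sublocale R: reductive_lie m brG "\<pi> ` N" "\<pi> ` S"
proof
  have imG: "\<pi> ` vecs n = vecs m" using \<pi>(2,3) by auto
  show "G.ideal_of (vecs m) (\<pi> ` N)" using image_ideal[OF N(1) subset_refl] by (simp add: imG)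
  show "brG x y = 0" if "x \<in> \<pi> ` N" "y \<in> \<pi> ` N" for x y by (rule image_N_abelian[OF that])
  show "G.subalg (\<pi> ` S)" by (rule image_subalg[OF S])
  show "\<exists>a\<in>\<pi> ` N. v - a \<in> \<pi> ` S" if v: "v \<in> vecs m" for v
  proof -
    obtain u where u: "u \<in> vecs n" "\<pi> u = v" using \<pi>(3)[OF v] by blast
    obtain a where a: "a \<in> N" "u - a \<in> S" using decomposition[OF u(1)] by blast
    then have "v - \<pi> a \<in> \<pi> ` S" using u(2) by (metis imageI lin_diff \<pi>(1))
    then show ?thesis using a(1) by blast
  qed
  show "\<pi> ` N \<inter> \<pi> ` S = {0}"
  proof -
    have "\<pi> a = 0" if "a \<in> N" "s \<in> S" "\<pi> a = \<pi> s" for a s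
    proof -
      \<comment> \<open>The kernel I lies in N, which forces s into N \<inter> S.\<close>
      have "a - s \<in> N" using that \<pi>_eq[of a s] ND(2) SD(2) square_span_N by blast
      from fv.subspace_diff[OF ND(1) that(1) this] have "s = 0" using that(2) NS by auto
      then show ?thesis using that by (simp add: lin_0 \<pi>)
    qed
    moreover have "0 \<in> \<pi> ` N" "0 \<in> \<pi> ` S"
      using fv.subspace_0[OF subspace_image[OF \<pi>(1) ND(1)]] fv.subspace_0[OF subspace_image[OF \<pi>(1) SD(1)]] .
    ultimately show ?thesis by (intro subset_antisym) blast+
  qed
  show "\<exists>W'. fv.subspace W' \<and> W' \<subseteq> \<pi> ` N \<and> (\<forall>s\<in>\<pi> ` S. \<forall>w\<in>W'. brG s w \<in> W') \<and> W \<inter> W' = {0} \<and>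
      (\<forall>v\<in>\<pi> ` N. \<exists>w\<in>W. v - w \<in> W')"
    if W: "fv.subspace W" "W \<subseteq> \<pi> ` N" and inv: "\<And>s w. s \<in> \<pi> ` S \<Longrightarrow> w \<in> W \<Longrightarrow> brG s w \<in> W" for W
  proof -
    \<comment> \<open>In L/I the left and right actions differ by a sign only, so the preimage of a
      left submodule is stable under both actions in L, as the complement of bimodules
      requires.\<close>
    have bW: "sub_bimod S {v \<in> N. \<pi> v \<in> W}" unfolding sub_bimod_def
    proof (intro conjI ballI)
      show "fv.subspace {v \<in> N. \<pi> v \<in> W}"
        using W(1) ND(1) by (auto simp: fv.subspace_def lin_add lin_smul lin_0 \<pi>)
      fix a s assume a: "a \<in> {v \<in> N. \<pi> v \<in> W}" and s: "s \<in> S"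
      then have as: "a \<in> vecs n" "s \<in> vecs n" using ND(2) SD(2) by auto
      then have "\<pi> (br s a) \<in> W" "\<pi> (br a s) = - \<pi> (br s a)"
        using inv[of "\<pi> s" "\<pi> a"] a s G.br_anti[of "\<pi> a" "\<pi> s"] by (simp_all add: \<pi>_br)
      then show "br s a \<in> {v \<in> N. \<pi> v \<in> W}" "br a s \<in> {v \<in> N. \<pi> v \<in> W}"
        using a as ND(3,4) fv.subspace_neg[OF W(1)] by auto
    qed
    obtain W' where W': "sub_bimod S W'" "W' \<subseteq> N" "{v \<in> N. \<pi> v \<in> W} \<inter> W' = {0}"
      "\<And>v. v \<in> N \<Longrightarrow> \<exists>w\<in>{v \<in> N. \<pi> v \<in> W}. v - w \<in> W'"
      using complete[OF bW] by blast
    have sub: "fv.subspace (\<pi> ` W')" using W'(1) by (auto simp: sub_bimod_def intro: subspace_image \<pi>)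
    moreover have "brG s w \<in> \<pi> ` W'" if sw: "s \<in> \<pi> ` S" "w \<in> \<pi> ` W'" for s w
    proof -
      obtain t v where tv: "s = \<pi> t" "w = \<pi> v" "t \<in> S" "v \<in> W'" using sw by blast
      then have "brG s w = \<pi> (br t v)" using W'(2) ND(2) SD(2) by (metis \<pi>_br subsetD)
      then show ?thesis using W'(1) tv by (auto simp: sub_bimod_def)
    qed
    moreover have "W \<inter> \<pi> ` W' = {0}"
    proof -
      have "w = 0" if "w \<in> W" "w = \<pi> v" "v \<in> W'" for w v
      proof -
        have "v \<in> {v \<in> N. \<pi> v \<in> W} \<inter> W'" using that W'(2) by auto
        then have "v = 0" unfolding W'(3) by simp
        then show ?thesis using that(2) by (simp add: lin_0 \<pi>)
      qed
      moreover have "0 \<in> W" "0 \<in> \<pi> ` W'" using fv.subspace_0[OF W(1)] fv.subspace_0[OF sub] .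
      ultimately show ?thesis by blast
    qed
    moreover have "\<exists>w\<in>W. v - w \<in> \<pi> ` W'" if v: "v \<in> \<pi> ` N" for v
    proof -
      obtain a where a: "a \<in> N" "v = \<pi> a" using v by blast
      obtain w where w: "w \<in> N" "\<pi> w \<in> W" "a - w \<in> W'" using W'(4)[OF a(1)] by blast
      then have "v - \<pi> w \<in> \<pi> ` W'" using a(2) by (metis imageI lin_diff \<pi>(1))
      then show ?thesis using w(2) by blast
    qed
    ultimately show ?thesis using W'(2) by (intro exI[of _ "\<pi> ` W'"]) blast
  qed
  show "J \<subseteq> \<pi> ` N" if J: "G.ideal_of (vecs m) J" "G.nilpotent_set J" for J
  proof -
    \<comment> \<open>The preimage of J is nilpotent: its lower central series reaches I, and one
      further step annihilates it.\<close>
    define K where "K = {v \<in> vecs n. \<pi> v \<in> J}"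
    have K: "ideal_of (vecs n) K" unfolding ideal_of_def K_def
      using G.ideal_ofD[OF J(1)] subspace_vecs[of n]
      by (auto simp: fv.subspace_def lin_add lin_smul lin_0 \<pi> \<pi>_br br_vecs)
    have \<pi>K: "\<pi> ` K = J" using G.ideal_ofD(2)[OF J(1)] \<pi>(3) unfolding K_def by blast
    have Ks: "subalg K" by (rule ideal_subalg[OF K subset_refl])
    obtain k where k: "G.lcs J k = {0}" using J(2) by (auto simp: G.nilpotent_set_def)
    have "v \<in> square_span" if v: "v \<in> lcs K k" for v
    proof -
      have "\<pi> v \<in> {0}" using lcs_image[OF Ks, of k] k v by (auto simp: \<pi>K)
      moreover have "v \<in> vecs n" using lcs_subset[OF Ks, of k] ideal_ofD(2)[OF K] v by blast
      ultimately show ?thesis using \<pi>_kernel by blast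
    qed
    then have "lcs K (Suc k) \<subseteq> {0}"
      unfolding lcs.simps by (intro fv.span_minimal) (auto simp: square_span_annihilates)
    then have "K \<subseteq> N" by (intro nilmax K nilpotent_setI[OF ideal_ofD(1)[OF K]])
    then show ?thesis using \<pi>K by blast
  qed
qed

text \<open>Maximal subalgebras of \<pi>(B) pull back to maximal subalgebras of B, so \<pi>(J) lies
  in all maximal subalgebras of \<pi>(B), and \<pi>(B) is \<open>frattini_free\<close>. B need not
  contain I; the kernel of \<pi> on B is B \<inter> I.\<close>

lemma frattini_square_span:
  assumes B: "subalg B" and J: "frattini_sub B J"
  shows "J \<subseteq> square_span"
proof -
  have JB: "ideal_of B J" using J by (simp add: frattini_sub_def)
  note BD = subalgD[OF B] and JD = ideal_ofD[OF JB]
  have "G.frattini_sub (\<pi> ` B) (\<pi> ` J)" unfolding G.frattini_sub_def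
  proof (intro conjI allI impI image_ideal[OF JB BD(2)])
    fix M assume M: "G.maxsub (\<pi> ` B) M"
    then have Ms: "G.subalg M" "M \<subseteq> \<pi> ` B" "M \<noteq> \<pi> ` B" by (auto simp: G.maxsub_def)
    define M' where "M' = {v \<in> B. \<pi> v \<in> M}"
    have \<pi>M': "\<pi> ` M' = M" using Ms(2) by (auto simp: M'_def)
    have "maxsub B M'" unfolding maxsub_def
    proof (intro conjI allI impI)
      show "subalg M'" unfolding M'_def by (rule preimage_subalg[OF B Ms(1)])
      show "M' \<subseteq> B" by (auto simp: M'_def)
      show "M' \<noteq> B" using Ms(3) \<pi>M' by blast
      fix T assume T: "subalg T \<and> M' \<subseteq> T \<and> T \<subseteq> B"
      have "G.subalg (\<pi> ` T)" "M \<subseteq> \<pi> ` T" "\<pi> ` T \<subseteq> \<pi> ` B" using T \<pi>M' image_subalg by blast+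
      then have "\<pi> ` T = M \<or> \<pi> ` T = \<pi> ` B" using M by (simp add: G.maxsub_def)
      \<comment> \<open>M' contains the kernel of \<pi> on B, so T is the full preimage in B of its
        image.\<close>
      moreover have "v \<in> T" if v: "v \<in> B" "\<pi> v \<in> \<pi> ` T" for v
      proof -
        obtain t where t: "t \<in> T" "\<pi> v = \<pi> t" using v(2) by blast
        have vt: "v - t \<in> B" using v t T by (intro fv.subspace_diff[OF BD(1)]) auto
        have "\<pi> (v - t) = 0" using t by (simp add: lin_diff \<pi>)
        then have "v - t \<in> M'" using vt G.subalgD(1)[OF Ms(1)] by (simp add: M'_def fv.subspace_0)
        then have "(v - t) + t \<in> T" using T t by (intro fv.subspace_add) (auto simp: subalg_def)
        then show ?thesis by simp
      qed
      ultimately show "T = M' \<or> T = B" using T by (auto simp: M'_def)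
    qed
    then have "J \<subseteq> M'" using J by (simp add: frattini_sub_def)
    then show "\<pi> ` J \<subseteq> M" by (auto simp: M'_def)
  qed
  then have "\<pi> ` J = {0}"
    using R.all_subalgebras_frattini_free[OF H image_subalg[OF B]] by (simp add: G.frattini_free_def)
  then show ?thesis using \<pi>_kernel JD(2) BD(2) by blast
qed

lemma square_span_derived: "fv.span {br a b | a b. a \<in> N \<and> b \<in> N} = square_span"
proof
  have "br a b \<in> square_span" if "a \<in> N" "b \<in> N" for a b
  proof -
    have v: "a \<in> vecs n" "b \<in> vecs n" using that ND(2) by auto
    then have "\<pi> (br a b) = 0" using image_N_abelian that by (simp add: \<pi>_br)
    then show ?thesis using \<pi>_kernel[OF br_vecs] by simp
  qed
  then show "fv.span {br a b | a b. a \<in> N \<and> b \<in> N} \<subseteq> square_span"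
    by (intro fv.span_minimal square_span_subspace) blast
  define Z where "Z = {v \<in> N. \<forall>y\<in>vecs n. br v y = 0 \<and> br y v = 0}"
  have "sub_bimod S Z"
    using ND(1) SD(2) unfolding sub_bimod_def Z_def
    by (auto simp: fv.subspace_def br_simps subset_iff)
  moreover have "Z \<subseteq> N" by (auto simp: Z_def)
  ultimately have "\<exists>C. sub_bimod S C \<and> C \<subseteq> N \<and> Z \<inter> C = {0} \<and> (\<forall>v\<in>N. \<exists>z\<in>Z. v - z \<in> C)"
    by (rule complete)
  then obtain C where C: "sub_bimod S C" "C \<subseteq> N" "Z \<inter> C = {0}" "\<And>v. v \<in> N \<Longrightarrow> \<exists>z\<in>Z. v - z \<in> C"
    by blast
  have IZ: "square_span \<subseteq> Z" using square_span_N square_span_annihilates by (auto simp: Z_def)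
  have "br x x \<in> {br a b | a b. a \<in> N \<and> b \<in> N}" if x: "x \<in> vecs n" for x
  proof -
    obtain a where a: "a \<in> N" "x - a \<in> S" using decomposition[OF x] by blast
    define s where "s = x - a"
    have s: "s \<in> S" "s \<in> vecs n" using a SD(2) by (auto simp: s_def)
    obtain z where z: "z \<in> Z" "a - z \<in> C" using C(4)[OF a(1)] by blast
    define c where "c = a - z"
    have c: "c \<in> C" "c \<in> vecs n" using z C(2) ND(2) by (auto simp: c_def)
    have sq: "br y y \<in> square_span" if "y \<in> vecs n" for y by (rule square_in[OF that])
    \<comment> \<open>The square lies in I, thus in N, and it lies in S.\<close>
    have ss: "br s s = 0"
      using sq[OF s(2)] square_span_N SD(3)[OF s(1) s(1)] NS by blast
    \<comment> \<open>Polarisation: the symmetrised product is a combination of squares, hence in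
      I.\<close>
    have "br c s + br s c = br (c + s) (c + s) - br c c - br s s" by (simp add: br_simps)
    also have "\<dots> \<in> square_span"
      using c s by (intro fv.subspace_diff[OF square_span_subspace] sq fv.subspace_add[OF subspace_vecs])
    finally have "br c s + br s c \<in> Z" using IZ by blast
    moreover have "br c s + br s c \<in> C"
      using C(1) c(1) s(1) by (auto simp: sub_bimod_def intro: fv.subspace_add)
    ultimately have cs: "br c s + br s c = 0" using C(3) by blast
    have "br z s = 0" "br s z = 0" using z(1) s(2) by (auto simp: Z_def)
    then have as: "br a s + br s a = 0" using cs by (simp add: c_def br_simps)
    have "x = a + s" by (simp add: s_def)
    then have "br x x = br a a + (br a s + br s a) + br s s" by (simp add: br_simps)
    then have "br x x = br a a" using as ss by simp
    then show ?thesis using a(1) by blast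
  qed
  then show "square_span \<subseteq> fv.span {br a b | a b. a \<in> N \<and> b \<in> N}"
    unfolding square_span_def by (intro fv.span_mono) blast
qed

end

subsection \<open>Transfer to algebras over a carrier\<close>

text \<open>The image is some subspace rather than all of \<open>vecs n\<close>, so that restriction
  to a subalgebra is a \<open>coord_map\<close> again, with the same \<phi> and the same
  bracket.\<close>

locale coord_map =
  fixes M :: "('f::field_char_0, 'x, 'm) module_scheme" (structure)
    and \<phi> :: "'x \<Rightarrow> 'f fvec" and br :: "'f fvec \<Rightarrow> 'f fvec \<Rightarrow> 'f fvec"
  assumes inj: "inj_on \<phi> (carrier M)" and image_subspace: "fv.subspace (\<phi> ` carrier M)"
    and br_bilinear: "bilin br"
    and zero: "\<zero> \<in> carrier M" "\<phi> \<zero> = 0"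
    and add: "\<And>x y. \<lbrakk>x \<in> carrier M; y \<in> carrier M\<rbrakk> \<Longrightarrow> x \<oplus> y \<in> carrier M"
      "\<And>x y. \<lbrakk>x \<in> carrier M; y \<in> carrier M\<rbrakk> \<Longrightarrow> \<phi> (x \<oplus> y) = \<phi> x + \<phi> y"
    and smult: "\<And>c x. x \<in> carrier M \<Longrightarrow> c \<odot> x \<in> carrier M"
      "\<And>c x. x \<in> carrier M \<Longrightarrow> \<phi> (c \<odot> x) = smul c (\<phi> x)"
    and mult: "\<And>x y. \<lbrakk>x \<in> carrier M; y \<in> carrier M\<rbrakk> \<Longrightarrow> x \<otimes> y \<in> carrier M"
      "\<And>x y. \<lbrakk>x \<in> carrier M; y \<in> carrier M\<rbrakk> \<Longrightarrow> \<phi> (x \<otimes> y) = br (\<phi> x) (\<phi> y)"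
begin

lemma eqI: "x \<in> carrier M \<Longrightarrow> y \<in> carrier M \<Longrightarrow> \<phi> x = \<phi> y \<Longrightarrow> x = y"
  using inj by (auto dest: inj_onD)

lemma mem_image_iff: "W \<subseteq> carrier M \<Longrightarrow> x \<in> carrier M \<Longrightarrow> \<phi> x \<in> \<phi> ` W \<longleftrightarrow> x \<in> W"
  using inj by (simp add: inj_on_image_mem_iff)

text \<open>The axioms are pulled back along the injection \<phi>. This also covers restricted
  records and the quotient record, for which they are not given.\<close>

lemma is_vectorspace: "vectorspace class_ring M"
proof (rule vs_criteria)
  show "\<forall>v\<in>carrier M. \<exists>neg_v\<in>carrier M. v \<oplus> neg_v = \<zero>"
  proof
    fix v assume v: "v \<in> carrier M"
    then have "v \<oplus> (- 1) \<odot> v = \<zero>" by (intro eqI) (simp_all add: zero add smult)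
    then show "\<exists>neg_v\<in>carrier M. v \<oplus> neg_v = \<zero>" using smult(1)[OF v] by blast
  qed
qed (auto intro!: eqI simp: zero add smult class_field fv.scale_left_distrib fv.scale_right_distrib)

lemma is_bracket_algebra: "bracket_algebra M"
proof -
  interpret vectorspace class_ring M by (rule is_vectorspace)
  note b = bilinD[OF br_bilinear]
  show ?thesis
    by unfold_locales (auto intro!: eqI simp: mult add smult lin_add[OF b(1)] lin_add[OF b(2)] lin_smul[OF b(1)] lin_smul[OF b(2)])
qed

lemma lin_subspace_iff: "lin_subspace M W \<longleftrightarrow> W \<subseteq> carrier M \<and> fv.subspace (\<phi> ` W)"
proof
  assume "lin_subspace M W"
  then interpret W: submodule class_ring W M by (simp add: VectorSpace.subspace_def)
  show "W \<subseteq> carrier M \<and> fv.subspace (\<phi> ` W)"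
  proof
    show WM: "W \<subseteq> carrier M" by (rule W.subset)
    show "fv.subspace (\<phi> ` W)" unfolding fv.subspace_def
    proof (intro conjI ballI allI)
      show "0 \<in> \<phi> ` W" using W.zero_closed zero(2) by (metis imageI)
      show "u + v \<in> \<phi> ` W" if uv: "u \<in> \<phi> ` W" "v \<in> \<phi> ` W" for u v
      proof -
        from uv obtain x y where "u = \<phi> x" "v = \<phi> y" "x \<in> W" "y \<in> W" by blast
        moreover then have "x \<in> carrier M" "y \<in> carrier M" using WM by auto
        ultimately have "u + v = \<phi> (x \<oplus> y)" "x \<oplus> y \<in> W" by (simp_all add: add)
        then show ?thesis by blast
      qed
      show "smul c u \<in> \<phi> ` W" if u: "u \<in> \<phi> ` W" for c u
      proof -
        from u obtain x where x: "u = \<phi> x" "x \<in> W" by blast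
        then have "smul c u = \<phi> (c \<odot> x)" using WM by (auto simp: smult)
        moreover have "c \<odot> x \<in> W" using W.smult_closed[of c x] x by simp
        ultimately show ?thesis by blast
      qed
    qed
  qed
next
  assume W: "W \<subseteq> carrier M \<and> fv.subspace (\<phi> ` W)"
  have mem: "x \<in> W" if "x \<in> carrier M" "\<phi> x \<in> \<phi> ` W" for x
    using mem_image_iff that W by blast
  have "submodule class_ring W M"
  proof (rule submodule.intro)
    show "Module.module class_ring M" using is_vectorspace by (simp add: vectorspace_def)
    show "W \<subseteq> carrier M" using W by blast
    show "\<zero> \<in> W" using mem[OF zero(1)] zero(2) W by (simp add: fv.subspace_0)
    show "v \<oplus> w \<in> W" if vw: "v \<in> W" "w \<in> W" for v w
    proof -
      have "v \<in> carrier M" "w \<in> carrier M" using vw W by auto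
      then show ?thesis using vw W by (intro mem) (simp_all add: add fv.subspace_add)
    qed
    show "c \<odot> v \<in> W" if v: "v \<in> W" for c v
    proof -
      have "v \<in> carrier M" using v W by auto
      then show ?thesis using v W by (intro mem) (simp_all add: smult fv.subspace_scale)
    qed
  qed
  then show "lin_subspace M W" by (simp add: VectorSpace.subspace_def is_vectorspace)
qed

lemma lin_span_image:
  assumes S: "S \<subseteq> carrier M"
  shows "\<phi> ` lin_span M S = fv.span (\<phi> ` S)" "lin_span M S \<subseteq> carrier M"
proof -
  interpret vectorspace class_ring M by (rule is_vectorspace)
  have "submodule class_ring (lin_span M S) M" by (rule span_is_submodule[OF S])
  then have sp: "lin_subspace M (lin_span M S)" by (simp add: VectorSpace.subspace_def is_vectorspace)
  then show sub: "lin_span M S \<subseteq> carrier M" by (simp add: lin_subspace_iff)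
  let ?T = "{x \<in> carrier M. \<phi> x \<in> fv.span (\<phi> ` S)}"
  have le: "fv.span (\<phi> ` S) \<subseteq> \<phi> ` carrier M" using S by (intro fv.span_minimal image_subspace image_mono)
  then have T: "\<phi> ` ?T = fv.span (\<phi> ` S)" by blast
  then have "lin_subspace M ?T" by (auto simp: lin_subspace_iff)
  then have "submodule class_ring ?T M" by (simp add: VectorSpace.subspace_def)
  moreover have "S \<subseteq> ?T" using S by (auto intro: fv.span_base)
  ultimately have "lin_span M S \<subseteq> ?T" by (intro span_is_subset)
  then have "\<phi> ` lin_span M S \<subseteq> fv.span (\<phi> ` S)" by blast
  moreover have "fv.span (\<phi> ` S) \<subseteq> \<phi> ` lin_span M S"
    using sp in_own_span[OF S] by (intro fv.span_minimal) (auto simp: lin_subspace_iff)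
  ultimately show "\<phi> ` lin_span M S = fv.span (\<phi> ` S)" by blast
qed

lemma is_subalgebra_iff:
  "is_subalgebra M B \<longleftrightarrow> B \<subseteq> carrier M \<and> fv.subspace (\<phi> ` B) \<and> (\<forall>u\<in>\<phi> ` B. \<forall>v\<in>\<phi> ` B. br u v \<in> \<phi> ` B)"
proof -
  have "x \<otimes> y \<in> B \<longleftrightarrow> br (\<phi> x) (\<phi> y) \<in> \<phi> ` B" if "B \<subseteq> carrier M" "x \<in> B" "y \<in> B" for x y
    using that mem_image_iff[of B "x \<otimes> y"] by (auto simp: mult subset_iff)
  then show ?thesis by (auto simp: is_subalgebra_def lin_subspace_iff)
qed

lemma restrict_subalgebra:
  assumes "is_subalgebra M B"
  shows "coord_map (M\<lparr>carrier := B\<rparr>) \<phi> br"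
proof -
  have B: "B \<subseteq> carrier M" "fv.subspace (\<phi> ` B)" using assms by (auto simp: is_subalgebra_iff)
  interpret B: submodule class_ring B M using assms by (simp add: is_subalgebra_def VectorSpace.subspace_def)
  show ?thesis
  proof
    show "inj_on \<phi> (carrier (M\<lparr>carrier := B\<rparr>))" using inj B(1) by (auto intro: inj_on_subset)
    show "c \<odot>\<^bsub>M\<lparr>carrier := B\<rparr>\<^esub> x \<in> carrier (M\<lparr>carrier := B\<rparr>)" if "x \<in> carrier (M\<lparr>carrier := B\<rparr>)" for c x
      using B.smult_closed[of c x] that by simp
  qed (use B assms in \<open>auto simp: zero add smult mult br_bilinear is_subalgebra_def subset_iff\<close>)
qed

lemma is_ideal_iff:
  "is_ideal M J \<longleftrightarrow> J \<subseteq> carrier M \<and> fv.subspace (\<phi> ` J) \<and>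
    (\<forall>u\<in>\<phi> ` J. \<forall>v\<in>\<phi> ` carrier M. br u v \<in> \<phi> ` J \<and> br v u \<in> \<phi> ` J)"
proof -
  have "x \<otimes> y \<in> J \<longleftrightarrow> br (\<phi> x) (\<phi> y) \<in> \<phi> ` J" "y \<otimes> x \<in> J \<longleftrightarrow> br (\<phi> y) (\<phi> x) \<in> \<phi> ` J"
    if "J \<subseteq> carrier M" "x \<in> J" "y \<in> carrier M" for x y
    using that mem_image_iff[of J "x \<otimes> y"] mem_image_iff[of J "y \<otimes> x"] by (auto simp: mult subset_iff)
  then show ?thesis by (auto simp: is_ideal_def lin_subspace_iff)
qed

end

section \<open>Algebras identified with a full coordinate space\<close>

locale coords = coord_map M \<phi> br + coord_algebra n br
  for M :: "('f::field_char_0, 'x, 'm) module_scheme" (structure)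
    and \<phi> :: "'x \<Rightarrow> 'f fvec" and br :: "'f fvec \<Rightarrow> 'f fvec \<Rightarrow> 'f fvec" and n :: nat +
  assumes image_carrier: "\<phi> ` carrier M = vecs n"
begin

lemma subalgebra_iff: "is_subalgebra M B \<longleftrightarrow> B \<subseteq> carrier M \<and> subalg (\<phi> ` B)"
  unfolding is_subalgebra_iff subalg_def using image_carrier by blast

lemma ideal_iff: "is_ideal M J \<longleftrightarrow> J \<subseteq> carrier M \<and> ideal_of (vecs n) (\<phi> ` J)"
  unfolding is_ideal_iff ideal_of_def using image_carrier by blast

definition pull :: "'f fvec set \<Rightarrow> 'x set" where
  "pull T = {x \<in> carrier M. \<phi> x \<in> T}"

lemma image_pull: "T \<subseteq> vecs n \<Longrightarrow> \<phi> ` pull T = T"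
  using image_carrier by (auto simp: pull_def)

lemma pull_image: "W \<subseteq> carrier M \<Longrightarrow> pull (\<phi> ` W) = W"
  using mem_image_iff by (auto simp: pull_def)

lemma pull_carrier: "pull T \<subseteq> carrier M"
  by (auto simp: pull_def)

lemma pull_mono: "S \<subseteq> T \<Longrightarrow> pull S \<subseteq> pull T"
  by (auto simp: pull_def)

lemma image_subset_iff': "A \<subseteq> carrier M \<Longrightarrow> B \<subseteq> carrier M \<Longrightarrow> \<phi> ` A \<subseteq> \<phi> ` B \<longleftrightarrow> A \<subseteq> B"
  using pull_mono[of "\<phi> ` A" "\<phi> ` B"] pull_image by (metis image_mono)

lemma image_eq_iff': "A \<subseteq> carrier M \<Longrightarrow> B \<subseteq> carrier M \<Longrightarrow> \<phi> ` A = \<phi> ` B \<longleftrightarrow> A = B"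
  using inj by (simp add: inj_on_image_eq_iff)

lemma image_zero_iff: "A \<subseteq> carrier M \<Longrightarrow> \<phi> ` A = {0} \<longleftrightarrow> A = {\<zero>}"
  using image_eq_iff'[of A "{\<zero>}"] zero by simp

lemma restrict_subalgebra_iff:
  assumes "is_subalgebra M B"
  shows "is_subalgebra (M\<lparr>carrier := B\<rparr>) S \<longleftrightarrow> S \<subseteq> B \<and> subalg (\<phi> ` S)"
proof -
  interpret B: coord_map "M\<lparr>carrier := B\<rparr>" \<phi> br by (rule restrict_subalgebra[OF assms])
  show ?thesis unfolding B.is_subalgebra_iff subalg_def
    using assms by (auto simp: is_subalgebra_iff image_carrier[symmetric])
qed

lemma restrict_maximal_iff:
  assumes B: "is_subalgebra M B"
  shows "maximal_subalgebra (M\<lparr>carrier := B\<rparr>) S \<longleftrightarrow> S \<subseteq> B \<and> maxsub (\<phi> ` B) (\<phi> ` S)"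
proof -
  have BM: "B \<subseteq> carrier M" using B by (simp add: subalgebra_iff)
  have "(\<forall>T. (T \<subseteq> B \<and> subalg (\<phi> ` T)) \<and> S \<subseteq> T \<longrightarrow> T = S \<or> T = B) \<longleftrightarrow>
    (\<forall>T. subalg T \<and> \<phi> ` S \<subseteq> T \<and> T \<subseteq> \<phi> ` B \<longrightarrow> T = \<phi> ` S \<or> T = \<phi> ` B)" (is "?l = ?r") if SB: "S \<subseteq> B"
  proof
    assume l: ?l
    show ?r
    proof (intro allI impI)
      fix T assume T: "subalg T \<and> \<phi> ` S \<subseteq> T \<and> T \<subseteq> \<phi> ` B"
      then have eq: "\<phi> ` pull T = T" by (intro image_pull) (auto dest: subalgD)
      have "pull T \<subseteq> B" using T pull_mono[of T "\<phi> ` B"] pull_image[OF BM] by auto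
      moreover have "S \<subseteq> pull T" using T SB BM by (auto simp: pull_def)
      ultimately have "pull T = S \<or> pull T = B" using l T eq by simp
      then show "T = \<phi> ` S \<or> T = \<phi> ` B" using eq by metis
    qed
  next
    assume r: ?r
    show ?l
    proof (intro allI impI)
      fix T assume T: "(T \<subseteq> B \<and> subalg (\<phi> ` T)) \<and> S \<subseteq> T"
      then have "\<phi> ` T = \<phi> ` S \<or> \<phi> ` T = \<phi> ` B" using r by (simp add: image_mono)
      then show "T = S \<or> T = B" using T BM by (metis image_eq_iff' subset_trans)
    qed
  qed
  note key = this
  show ?thesis
  proof (cases "S \<subseteq> B")
    case True
    then have "\<phi> ` S = \<phi> ` B \<longleftrightarrow> S = B" using BM by (intro image_eq_iff') auto
    then show ?thesis
      unfolding maximal_subalgebra_def restrict_subalgebra_iff[OF B] maxsub_def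
      using key[OF True] True by (simp add: image_mono)
  next
    case False
    then show ?thesis by (simp add: maximal_subalgebra_def restrict_subalgebra_iff[OF B])
  qed
qed

lemma restrict_ideal_iff:
  assumes "is_subalgebra M B"
  shows "is_ideal (M\<lparr>carrier := B\<rparr>) J \<longleftrightarrow> J \<subseteq> B \<and> ideal_of (\<phi> ` B) (\<phi> ` J)"
proof -
  interpret B: coord_map "M\<lparr>carrier := B\<rparr>" \<phi> br by (rule restrict_subalgebra[OF assms])
  show ?thesis unfolding B.is_ideal_iff ideal_of_def by auto
qed

lemma restrict_frattini_iff:
  assumes B: "is_subalgebra M B"
  shows "is_ideal (M\<lparr>carrier := B\<rparr>) J \<and> (\<forall>S. maximal_subalgebra (M\<lparr>carrier := B\<rparr>) S \<longrightarrow> J \<subseteq> S) \<longleftrightarrow>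
    J \<subseteq> B \<and> frattini_sub (\<phi> ` B) (\<phi> ` J)"
proof -
  have BM: "B \<subseteq> carrier M" using B by (simp add: subalgebra_iff)
  have "(\<forall>S. S \<subseteq> B \<and> maxsub (\<phi> ` B) (\<phi> ` S) \<longrightarrow> J \<subseteq> S) \<longleftrightarrow> (\<forall>T. maxsub (\<phi> ` B) T \<longrightarrow> \<phi> ` J \<subseteq> T)"
    (is "?l = ?r") if J: "J \<subseteq> B"
  proof
    assume l: ?l
    show ?r
    proof (intro allI impI)
      fix T assume T: "maxsub (\<phi> ` B) T"
      then have TB: "T \<subseteq> \<phi> ` B" "T \<subseteq> vecs n" by (auto simp: maxsub_def subalg_def)
      then have "pull T \<subseteq> B" using pull_mono[of T "\<phi> ` B"] pull_image[OF BM] by auto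
      then have "J \<subseteq> pull T" using l T image_pull[OF TB(2)] by simp
      then show "\<phi> ` J \<subseteq> T" by (auto simp: pull_def)
    qed
  next
    assume r: ?r
    then show ?l using J BM image_subset_iff' by (meson subset_trans)
  qed
  then show ?thesis
    unfolding restrict_maximal_iff[OF B] restrict_ideal_iff[OF B] frattini_sub_def by blast
qed

text \<open>The \<open>GREATEST\<close> in \<open>frattini_ideal\<close> is evaluated by the largest
  coordinate ideal, whose preimage it is; the three parts give its extremal property in
  coordinates.\<close>

lemma restrict_frattini_ideal:
  assumes B: "is_subalgebra M B"
  shows "frattini_ideal (M\<lparr>carrier := B\<rparr>) \<subseteq> B"
    and "frattini_sub (\<phi> ` B) (\<phi> ` frattini_ideal (M\<lparr>carrier := B\<rparr>))"
    and "frattini_sub (\<phi> ` B) K \<Longrightarrow> K \<subseteq> \<phi> ` frattini_ideal (M\<lparr>carrier := B\<rparr>)"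
proof -
  have BM: "B \<subseteq> carrier M" and Bs: "subalg (\<phi> ` B)" using B by (simp_all add: subalgebra_iff)
  obtain J where J: "frattini_sub (\<phi> ` B) J" "\<And>K. frattini_sub (\<phi> ` B) K \<Longrightarrow> K \<subseteq> J"
    using exists_greatest_frattini[OF Bs] by blast
  have JB: "J \<subseteq> \<phi> ` B" using J(1) by (simp add: frattini_sub_def ideal_of_def)
  then have eq: "\<phi> ` pull J = J" using subalgD(2)[OF Bs] by (intro image_pull) blast
  have pB: "pull J \<subseteq> B" using JB pull_mono[of J "\<phi> ` B"] pull_image[OF BM] by auto
  have "frattini_ideal (M\<lparr>carrier := B\<rparr>) = pull J"
    unfolding frattini_ideal_def restrict_frattini_iff[OF B]
  proof (rule Greatest_equality)
    show "pull J \<subseteq> B \<and> frattini_sub (\<phi> ` B) (\<phi> ` pull J)" using pB eq J(1) by simp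
    show "K \<subseteq> pull J" if "K \<subseteq> B \<and> frattini_sub (\<phi> ` B) (\<phi> ` K)" for K
      using that J(2)[of "\<phi> ` K"] BM by (auto simp: pull_def)
  qed
  then show "frattini_ideal (M\<lparr>carrier := B\<rparr>) \<subseteq> B"
    "frattini_sub (\<phi> ` B) (\<phi> ` frattini_ideal (M\<lparr>carrier := B\<rparr>))"
    "frattini_sub (\<phi> ` B) K \<Longrightarrow> K \<subseteq> \<phi> ` frattini_ideal (M\<lparr>carrier := B\<rparr>)"
    using pB eq J by simp_all
qed

lemma restrict_phi_free:
  assumes B: "is_subalgebra M B" and free: "phi_free (M\<lparr>carrier := B\<rparr>)"
  shows "frattini_free (\<phi> ` B)"
proof -
  have "\<phi> ` frattini_ideal (M\<lparr>carrier := B\<rparr>) = {0}" using free zero by (simp add: phi_free_def)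
  then have "K \<subseteq> {0}" if "frattini_sub (\<phi> ` B) K" for K
    using restrict_frattini_ideal(3)[OF B that] by simp
  then show ?thesis unfolding frattini_free_def
    by (metis frattini_sub_def fv.subspace_0 ideal_ofD(1) empty_iff subset_singletonD)
qed

lemma bracket_span_image:
  assumes "A \<subseteq> carrier M" "B \<subseteq> carrier M"
  shows "\<phi> ` bracket_span M A B = fv.span {br a b | a b. a \<in> \<phi> ` A \<and> b \<in> \<phi> ` B}"
    and "bracket_span M A B \<subseteq> carrier M"
proof -
  let ?S = "{a \<otimes> b | a b. a \<in> A \<and> b \<in> B}"
  have S: "?S \<subseteq> carrier M" using assms by (auto simp: mult subset_iff)
  have im: "\<phi> ` ?S = {br a b | a b. a \<in> \<phi> ` A \<and> b \<in> \<phi> ` B}"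
  proof
    show "\<phi> ` ?S \<subseteq> {br a b | a b. a \<in> \<phi> ` A \<and> b \<in> \<phi> ` B}"
    proof
      fix v assume "v \<in> \<phi> ` ?S"
      then obtain a b where "v = \<phi> (a \<otimes> b)" "a \<in> A" "b \<in> B" by blast
      moreover then have "\<phi> (a \<otimes> b) = br (\<phi> a) (\<phi> b)" using assms by (intro mult) auto
      ultimately show "v \<in> {br a b | a b. a \<in> \<phi> ` A \<and> b \<in> \<phi> ` B}" by blast
    qed
    show "{br a b | a b. a \<in> \<phi> ` A \<and> b \<in> \<phi> ` B} \<subseteq> \<phi> ` ?S"
    proof
      fix v assume "v \<in> {br a b | a b. a \<in> \<phi> ` A \<and> b \<in> \<phi> ` B}"
      then obtain a b where "v = br (\<phi> a) (\<phi> b)" "a \<in> A" "b \<in> B" by blast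
      moreover then have "\<phi> (a \<otimes> b) = br (\<phi> a) (\<phi> b)" using assms by (intro mult) auto
      ultimately show "v \<in> \<phi> ` ?S" by (metis (mono_tags, lifting) image_eqI mem_Collect_eq)
    qed
  qed
  show "\<phi> ` bracket_span M A B = fv.span {br a b | a b. a \<in> \<phi> ` A \<and> b \<in> \<phi> ` B}"
    "bracket_span M A B \<subseteq> carrier M"
    unfolding bracket_span_def using lin_span_image[OF S] by (simp_all add: im)
qed

lemma lower_central_image:
  assumes J: "is_subalgebra M J"
  shows "\<phi> ` lower_central (M\<lparr>carrier := J\<rparr>) k = lcs (\<phi> ` J) k \<and> lower_central (M\<lparr>carrier := J\<rparr>) k \<subseteq> J"
proof (induction k)
  case (Suc k)
  let ?M = "M\<lparr>carrier := J\<rparr>"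
  interpret B: coord_map ?M \<phi> br by (rule restrict_subalgebra[OF J])
  have JM: "J \<subseteq> carrier M" using J by (simp add: subalgebra_iff)
  let ?S = "{a \<otimes> b | a b. a \<in> lower_central ?M k \<and> b \<in> J}"
  have S: "?S \<subseteq> carrier ?M" using Suc J by (auto simp: is_subalgebra_def subset_iff)
  have im: "\<phi> ` ?S = {br a b | a b. a \<in> \<phi> ` lower_central ?M k \<and> b \<in> \<phi> ` J}"
  proof
    show "\<phi> ` ?S \<subseteq> {br a b | a b. a \<in> \<phi> ` lower_central ?M k \<and> b \<in> \<phi> ` J}"
    proof
      fix v assume "v \<in> \<phi> ` ?S"
      then obtain a b where "v = \<phi> (a \<otimes> b)" "a \<in> lower_central ?M k" "b \<in> J" by blast
      moreover then have "\<phi> (a \<otimes> b) = br (\<phi> a) (\<phi> b)" using Suc JM by (intro mult) auto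
      ultimately show "v \<in> {br a b | a b. a \<in> \<phi> ` lower_central ?M k \<and> b \<in> \<phi> ` J}" by blast
    qed
    show "{br a b | a b. a \<in> \<phi> ` lower_central ?M k \<and> b \<in> \<phi> ` J} \<subseteq> \<phi> ` ?S"
    proof
      fix v assume "v \<in> {br a b | a b. a \<in> \<phi> ` lower_central ?M k \<and> b \<in> \<phi> ` J}"
      then obtain a b where "v = br (\<phi> a) (\<phi> b)" "a \<in> lower_central ?M k" "b \<in> J" by blast
      moreover then have "\<phi> (a \<otimes> b) = br (\<phi> a) (\<phi> b)" using Suc JM by (intro mult) auto
      ultimately show "v \<in> \<phi> ` ?S" by (metis (mono_tags, lifting) image_eqI mem_Collect_eq)
    qed
  qed
  show ?case using B.lin_span_image[OF S] Suc by (simp add: bracket_span_def im)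
qed simp

lemma nilpotent_algebra_iff:
  assumes J: "is_subalgebra M J"
  shows "nilpotent_algebra (M\<lparr>carrier := J\<rparr>) \<longleftrightarrow> nilpotent_set (\<phi> ` J)"
proof -
  have "lower_central (M\<lparr>carrier := J\<rparr>) k = {\<zero>} \<longleftrightarrow> lcs (\<phi> ` J) k = {0}" for k
    using lower_central_image[OF J, of k] image_zero_iff[of "lower_central (M\<lparr>carrier := J\<rparr>) k"] J
    by (auto simp: subalgebra_iff)
  then show ?thesis by (simp add: nilpotent_algebra_def nilpotent_set_def)
qed

lemma ideal_is_subalgebra: "is_ideal M J \<Longrightarrow> is_subalgebra M J"
  using ideal_subalg[OF _ subset_refl] by (auto simp: ideal_iff subalgebra_iff)

lemma sub_bimodule_iff:
  assumes "\<Sigma> \<subseteq> carrier M"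
  shows "sub_bimodule M \<Sigma> A \<longleftrightarrow> A \<subseteq> carrier M \<and> sub_bimod (\<phi> ` \<Sigma>) (\<phi> ` A)"
proof -
  have "x \<otimes> y \<in> A \<longleftrightarrow> br (\<phi> x) (\<phi> y) \<in> \<phi> ` A" "y \<otimes> x \<in> A \<longleftrightarrow> br (\<phi> y) (\<phi> x) \<in> \<phi> ` A"
    if "A \<subseteq> carrier M" "x \<in> A" "y \<in> \<Sigma>" for x y
    using that assms mem_image_iff[of A "x \<otimes> y"] mem_image_iff[of A "y \<otimes> x"] by (auto simp: mult subset_iff)
  then show ?thesis by (auto simp: sub_bimodule_def sub_bimod_def lin_subspace_iff)
qed

lemma completely_reducible_image:
  assumes \<Sigma>: "\<Sigma> \<subseteq> carrier M" and V: "V \<subseteq> carrier M" and cr: "completely_reducible_bimodule M \<Sigma> V"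
    and W: "sub_bimod (\<phi> ` \<Sigma>) W" "W \<subseteq> \<phi> ` V"
  shows "\<exists>W'. sub_bimod (\<phi> ` \<Sigma>) W' \<and> W' \<subseteq> \<phi> ` V \<and> W \<inter> W' = {0} \<and> (\<forall>v\<in>\<phi> ` V. \<exists>w\<in>W. v - w \<in> W')"
proof -
  obtain \<A> where A: "\<And>A. A \<in> \<A> \<Longrightarrow> irreducible_bimodule M \<Sigma> A" "lin_span M (\<Union>\<A>) = V"
    using cr by (auto simp: completely_reducible_bimodule_def)
  have AM: "A \<subseteq> carrier M" "sub_bimod (\<phi> ` \<Sigma>) (\<phi> ` A)" if "A \<in> \<A>" for A
    using A(1)[OF that] by (auto simp: irreducible_bimodule_def sub_bimodule_iff[OF \<Sigma>])
  show ?thesis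
  proof (rule completely_reducible_complement[where \<A> = "(`) \<phi> ` \<A>", OF _ _ _ _ W])
    show "fv.span (\<Union> ((`) \<phi> ` \<A>)) = \<phi> ` V"
      using lin_span_image(1)[of "\<Union>\<A>"] AM(1) A(2) by (auto simp: image_Union)
    show "\<phi> ` V \<subseteq> vecs n" using V image_carrier by blast
    show "sub_bimod (\<phi> ` \<Sigma>) A" if "A \<in> (`) \<phi> ` \<A>" for A using that AM(2) by blast
    fix A' B assume A': "A' \<in> (`) \<phi> ` \<A>" and B: "sub_bimod (\<phi> ` \<Sigma>) B" "B \<subseteq> A'"
    obtain A where AA: "A' = \<phi> ` A" "A \<in> \<A>" using A' by blast
    have "B \<subseteq> vecs n" using B(2) AM(1)[OF AA(2)] image_carrier AA(1) by blast
    then have eq: "\<phi> ` pull B = B" by (rule image_pull)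
    have "sub_bimodule M \<Sigma> (pull B)" using B(1) eq by (simp add: sub_bimodule_iff[OF \<Sigma>] pull_carrier)
    moreover have "pull B \<subseteq> A" using pull_mono[OF B(2)] pull_image[OF AM(1)[OF AA(2)]] AA(1) by simp
    ultimately have "pull B = {\<zero>} \<or> pull B = A"
      using A(1)[OF AA(2)] by (simp add: irreducible_bimodule_def)
    then show "B = {0} \<or> B = A'" using eq AA(1) zero(2) by (metis image_empty image_insert)
  qed
qed

lemma carrier_self [simp]: "M\<lparr>carrier := carrier M\<rparr> = M"
  by (cases M) simp

lemma leibniz_kernel_image:
  "\<phi> ` leibniz_kernel M = fv.span {br v v | v. v \<in> vecs n}" "leibniz_kernel M \<subseteq> carrier M"
proof -
  have S: "{x \<otimes> x | x. x \<in> carrier M} \<subseteq> carrier M" by (auto simp: mult)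
  have "\<phi> ` {x \<otimes> x | x. x \<in> carrier M} = {br v v | v. v \<in> vecs n}"
  proof
    show "\<phi> ` {x \<otimes> x | x. x \<in> carrier M} \<subseteq> {br v v | v. v \<in> vecs n}"
      unfolding image_carrier[symmetric] by (auto simp: mult)
    show "{br v v | v. v \<in> vecs n} \<subseteq> \<phi> ` {x \<otimes> x | x. x \<in> carrier M}"
    proof
      fix w assume "w \<in> {br v v | v. v \<in> vecs n}"
      then obtain x where "w = br (\<phi> x) (\<phi> x)" "x \<in> carrier M" unfolding image_carrier[symmetric] by blast
      then have "w = \<phi> (x \<otimes> x)" "x \<in> carrier M" by (simp_all add: mult)
      then show "w \<in> \<phi> ` {x \<otimes> x | x. x \<in> carrier M}" by blast
    qed
  qed
  then show "\<phi> ` leibniz_kernel M = fv.span {br v v | v. v \<in> vecs n}" "leibniz_kernel M \<subseteq> carrier M"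
    unfolding leibniz_kernel_def using lin_span_image[OF S] by simp_all
qed

end

locale lie_coords = coords M \<phi> br n + coord_lie n br
  for M :: "('f::field_char_0, 'x, 'm) module_scheme" (structure)
    and \<phi> :: "'x \<Rightarrow> 'f fvec" and br :: "'f fvec \<Rightarrow> 'f fvec \<Rightarrow> 'f fvec" and n :: nat
begin

text \<open>The coordinate elements s' and u' pull back to elements whose ad are the Jordan
  components, and a coordinate complement W' pulls back to an invariant complement U.\<close>

lemma restrict_almost_algebraic:
  assumes B: "is_subalgebra M B" and alm: "almost_alg (\<phi> ` B)"
  shows "almost_algebraic (M\<lparr>carrier := B\<rparr>)"
proof -
  let ?M = "M\<lparr>carrier := B\<rparr>"
  interpret B: coord_map ?M \<phi> br by (rule restrict_subalgebra[OF B])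
  interpret BA: bracket_algebra ?M by (rule B.is_bracket_algebra)
  have BM: "B \<subseteq> carrier M" using B by (simp add: subalgebra_iff)
  have closed: "x \<otimes> y \<in> B" if "x \<in> B" "y \<in> B" for x y using B.mult(1) that by simp
  have ad: "ad ?M x y = x \<otimes> y" if "y \<in> B" for x y using that by (simp add: ad_def)
  have \<phi>ad: "\<phi> (ad ?M x y) = br (\<phi> x) (\<phi> y)" if "x \<in> B" "y \<in> B" for x y
    using that B.mult(2) by (simp add: ad)
  have endo: "ad ?M x \<in> endomorphisms ?M" if x: "x \<in> B" for x
  proof -
    have "ad ?M x \<in> LinearCombinations.module_hom class_ring ?M ?M"
      unfolding LinearCombinations.module_hom_def
      using x closed BA.bracket_add_right[of x] BA.bracket_smult_right[of x] B.add(1) B.smult(1) by (auto simp: ad_def)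
    moreover have "ad ?M x \<in> extensional (carrier ?M)" by (simp add: ad_def)
    ultimately show ?thesis by (simp add: endomorphisms_def)
  qed
  have jordan: "\<exists>s\<in>B. \<exists>u\<in>B. jordan_components ?M (ad ?M x) (ad ?M s) (ad ?M u)" if x: "x \<in> B" for x
  proof -
    have "\<phi> x \<in> \<phi> ` B" using x by blast
    then obtain s' u' k where "s' \<in> \<phi> ` B" "u' \<in> \<phi> ` B" "\<forall>v\<in>\<phi> ` B. br (\<phi> x) v = br s' v + br u' v"
      "\<forall>v\<in>\<phi> ` B. br s' (br u' v) = br u' (br s' v)" "\<forall>v\<in>\<phi> ` B. (br u' ^^ k) v = 0"
      "complemented_in (\<phi> ` B) (br s')"
      using alm unfolding almost_alg_def by metis
    then obtain s u where su: "s \<in> B" "u \<in> B"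
      and sum: "\<And>v. v \<in> B \<Longrightarrow> br (\<phi> x) (\<phi> v) = br (\<phi> s) (\<phi> v) + br (\<phi> u) (\<phi> v)"
      and comm: "\<And>v. v \<in> B \<Longrightarrow> br (\<phi> s) (br (\<phi> u) (\<phi> v)) = br (\<phi> u) (br (\<phi> s) (\<phi> v))"
      and nil: "\<And>v. v \<in> B \<Longrightarrow> (br (\<phi> u) ^^ k) (\<phi> v) = 0"
      and compl: "complemented_in (\<phi> ` B) (br (\<phi> s))" by blast
    have adB: "ad ?M y v \<in> B" if "y \<in> B" "v \<in> B" for y v using that closed by (simp add: ad)
    have "semisimple_endo ?M (ad ?M s)" unfolding semisimple_endo_def
    proof (intro conjI allI impI endo su)
      fix W assume W: "invariant_subspace ?M (ad ?M s) W"
      then have W1: "W \<subseteq> B" "fv.subspace (\<phi> ` W)"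
        by (simp_all add: invariant_subspace_def B.lin_subspace_iff)
      have "\<forall>w\<in>\<phi> ` W. br (\<phi> s) w \<in> \<phi> ` W"
        using W W1(1) \<phi>ad[OF su(1)] by (auto simp: invariant_subspace_def image_subset_iff) (metis imageI subsetD)
      then have "\<exists>W'. fv.subspace W' \<and> W' \<subseteq> \<phi> ` B \<and> (\<forall>w\<in>W'. br (\<phi> s) w \<in> W') \<and> \<phi> ` W \<inter> W' = {0} \<and>
          (\<forall>v\<in>\<phi> ` B. \<exists>w\<in>\<phi> ` W. v - w \<in> W')"
        using W1(2) image_mono[OF W1(1)] by (intro compl[unfolded complemented_in_def, THEN spec, THEN mp] conjI)
      then obtain W' where *: "fv.subspace W' \<and> W' \<subseteq> \<phi> ` B \<and> (\<forall>w\<in>W'. br (\<phi> s) w \<in> W') \<and> \<phi> ` W \<inter> W' = {0} \<and>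
          (\<forall>v\<in>\<phi> ` B. \<exists>w\<in>\<phi> ` W. v - w \<in> W')" by (elim exE)
      then have W': "fv.subspace W'" "W' \<subseteq> \<phi> ` B" "\<And>w. w \<in> W' \<Longrightarrow> br (\<phi> s) w \<in> W'"
        "\<phi> ` W \<inter> W' = {0}" "\<And>v. v \<in> \<phi> ` B \<Longrightarrow> \<exists>w\<in>\<phi> ` W. v - w \<in> W'" by blast+
      define U where "U = {x \<in> B. \<phi> x \<in> W'}"
      have \<phi>U: "\<phi> ` U = W'" using W'(2) by (auto simp: U_def)
      have U: "invariant_subspace ?M (ad ?M s) U"
        unfolding invariant_subspace_def B.lin_subspace_iff
        using W'(1,3) \<phi>ad[OF su(1)] adB[OF su(1)] \<phi>U by (auto simp: U_def)
      have "W <+>\<^bsub>?M\<^esub> U = carrier ?M"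
      proof
        show "W <+>\<^bsub>?M\<^esub> U \<subseteq> carrier ?M"
          using W1(1) B.add(1) by (auto simp: set_add_def' U_def subset_iff)
        show "carrier ?M \<subseteq> W <+>\<^bsub>?M\<^esub> U"
        proof
          fix v assume "v \<in> carrier ?M"
          then have v: "v \<in> B" by simp
          then obtain w where w: "w \<in> W" "\<phi> v - \<phi> w \<in> W'" using W'(5)[of "\<phi> v"] by blast
          then obtain y where y: "y \<in> B" "\<phi> v - \<phi> w = \<phi> y" using W'(2) by blast
          have wB: "w \<in> B" using w W1(1) by blast
          have "v = w \<oplus> y" using v y wB B.add[of w y] by (intro B.eqI) (auto simp: diff_eq_eq add.commute)
          moreover have "y \<in> U" using y w by (simp add: U_def)
          ultimately show "v \<in> W <+>\<^bsub>?M\<^esub> U" using w(1) by (auto simp: set_add_def')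
        qed
      qed
      moreover have "W \<inter> U = {\<zero>\<^bsub>?M\<^esub>}"
      proof -
        have z: "\<zero> \<in> B" "\<phi> \<zero> = 0" using B.zero by simp_all
        have sub: "W \<inter> U \<subseteq> {\<zero>}"
        proof
          fix w assume "w \<in> W \<inter> U"
          then have w: "w \<in> W" "w \<in> U" by auto
          have "\<phi> w \<in> \<phi> ` W \<inter> W'" using w by (simp add: U_def)
          then have "\<phi> w = \<phi> \<zero>" unfolding W'(4) z(2) by simp
          then show "w \<in> {\<zero>}" using B.eqI[of w \<zero>] w(1) W1(1) z(1) by auto
        qed
        have "\<zero> \<in> U" using z fv.subspace_0[OF W'(1)] by (simp add: U_def)
        moreover have "\<phi> \<zero> \<in> \<phi> ` W" unfolding z(2) by (rule fv.subspace_0[OF W1(2)])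
        then have "\<zero> \<in> W" using B.mem_image_iff[of W \<zero>] W1(1) z(1) by simp
        ultimately have "W \<inter> U = {\<zero>}" using sub by (intro equalityI) simp_all
        then show ?thesis by simp
      qed
      ultimately show "\<exists>W'. invariant_subspace ?M (ad ?M s) W' \<and> W <+>\<^bsub>?M\<^esub> W' = carrier ?M \<and> W \<inter> W' = {\<zero>\<^bsub>?M\<^esub>}"
        using U by blast
    qed
    moreover have "nilpotent_endo ?M (ad ?M u)" unfolding nilpotent_endo_def
    proof (intro conjI endo su exI ballI)
      fix v assume "v \<in> carrier ?M"
      then have v: "v \<in> B" by simp
      have "(ad ?M u ^^ i) v \<in> B \<and> \<phi> ((ad ?M u ^^ i) v) = (br (\<phi> u) ^^ i) (\<phi> v)" for i
        by (induction i) (simp_all add: v adB su \<phi>ad)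
      then show "(ad ?M u ^^ k) v = \<zero>\<^bsub>?M\<^esub>" using nil[OF v] B.zero by (intro B.eqI) auto
    qed
    moreover have "ad ?M x v = ad ?M s v \<oplus>\<^bsub>?M\<^esub> ad ?M u v" "ad ?M s (ad ?M u v) = ad ?M u (ad ?M s v)"
      if v: "v \<in> B" for v
    proof -
      note mem = adB[OF x v] adB[OF su(1) v] adB[OF su(2) v]
      show "ad ?M x v = ad ?M s v \<oplus>\<^bsub>?M\<^esub> ad ?M u v"
        using mem B.add[of "ad ?M s v" "ad ?M u v"] sum[OF v] by (intro B.eqI) (auto simp: \<phi>ad x su v)
      show "ad ?M s (ad ?M u v) = ad ?M u (ad ?M s v)"
        using mem comm[OF v] adB su v by (intro B.eqI) (auto simp: \<phi>ad)
    qed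
    ultimately show ?thesis using su unfolding jordan_components_def by auto
  qed
  show ?thesis unfolding almost_algebraic_def almost_algebraic_linear_def
    using endo jordan by (auto simp: image_iff Bex_def) (metis (no_types, lifting))
qed

end

subsection \<open>Coordinates of an algebra and of its quotients\<close>

text \<open>Besides coordinates, the lemma records that br sees only the first n entries. Identities
  checked on the carrier then hold for all sequences.\<close>

lemma exists_coords:
  fixes L :: "('f::field_char_0, 'a, 'm) module_scheme" (structure)
  assumes L: "bracket_algebra L" and fdim: "vectorspace.fin_dim class_ring L"
  shows "\<exists>\<phi> br n. coords L \<phi> br n \<and> (\<forall>u v. br u v = br (trunc n u) (trunc n v))"
proof -
  interpret bracket_algebra L by (rule L)
  obtain \<beta> where \<beta>: "finite \<beta>" "basis \<beta>" using finite_basis_exists[OF fdim] by blast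
  then have \<beta>C: "\<beta> \<subseteq> carrier L" and li: "lin_indpt \<beta>" and gen: "gen_set \<beta>" by (auto simp: basis_def)
  define n where "n = card \<beta>"
  obtain b where b: "bij_betw b {..<n} \<beta>"
    using ex_bij_betw_nat_finite[OF \<beta>(1)] by (auto simp: n_def lessThan_atLeast0)
  have bC: "b i \<in> carrier L" if "i < n" for i using b that \<beta>C by (auto simp: bij_betw_def)
  define \<psi> where "\<psi> v = finsum L (\<lambda>i. cf v i \<odot> b i) {..<n}" for v
  have summand: "(\<lambda>i. cf v i \<odot> b i) \<in> {..<n} \<rightarrow> carrier L" for v using bC by auto
  have \<psi>C: "\<psi> v \<in> carrier L" for v unfolding \<psi>_def by (rule finsum_closed[OF summand])
  have \<psi>_add: "\<psi> (u + v) = \<psi> u \<oplus> \<psi> v" for u v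
  proof -
    have "\<psi> (u + v) = finsum L (\<lambda>i. cf u i \<odot> b i \<oplus> cf v i \<odot> b i) {..<n}"
      unfolding \<psi>_def using bC smult_l_distr by (intro finsum_cong') auto
    then show ?thesis unfolding \<psi>_def using finsum_addf[OF summand summand] by simp
  qed
  have \<psi>_smul: "\<psi> (smul c v) = c \<odot> \<psi> v" for c v
  proof -
    have "\<psi> (smul c v) = finsum L (\<lambda>i. c \<odot> (cf v i \<odot> b i)) {..<n}"
      unfolding \<psi>_def using bC smult_assoc1[of c] by (intro finsum_cong') auto
    then show ?thesis unfolding \<psi>_def using finsum_smult[OF _ summand, of c v] by simp
  qed
  have lincomb: "lincomb a \<beta> = \<psi> (mkv (\<lambda>i. if i < n then a (b i) else 0))" for a
  proof -
    have "lincomb a \<beta> = finsum L (\<lambda>i. a (b i) \<odot> b i) {..<n}"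
      unfolding lincomb_def using b \<beta>C
      by (subst finsum_reindex[of "\<lambda>x. a x \<odot> x" b "{..<n}", symmetric]) (auto simp: bij_betw_def)
    also have "\<dots> = \<psi> (mkv (\<lambda>i. if i < n then a (b i) else 0))"
      unfolding \<psi>_def using bC by (intro finsum_cong') auto
    finally show ?thesis .
  qed
  have surj: "\<exists>v\<in>vecs n. \<psi> v = x" if "x \<in> carrier L" for x
  proof -
    have "x \<in> span \<beta>" using gen that by simp
    then obtain a where "x = lincomb a \<beta>" unfolding finite_span[OF \<beta>(1) \<beta>C] by blast
    then show ?thesis unfolding lincomb
      by (intro bexI[of _ "mkv (\<lambda>i. if i < n then a (b i) else 0)"]) (auto simp: vecs_def)
  qed
  have kernel: "v = 0" if v: "v \<in> vecs n" "\<psi> v = \<zero>" for v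
  proof (rule ccontr)
    assume "v \<noteq> 0"
    then obtain i where i: "cf v i \<noteq> 0" by (auto simp: fvec_eq_iff)
    then have "i < n" using v by (metis (mono_tags) mem_Collect_eq not_le vecs_def)
    define a where "a x = cf v (the_inv_into {..<n} b x)" for x
    have ab: "a (b j) = cf v j" if "j < n" for j
      using b that by (simp add: a_def bij_betw_def the_inv_into_f_f)
    have "mkv (\<lambda>i. if i < n then a (b i) else 0) = v" using v by (auto simp: fvec_eq_iff ab vecs_def)
    then have "lincomb a \<beta> = \<zero>" using v by (simp add: lincomb)
    then have "lin_dep \<beta>" using i ab[OF \<open>i < n\<close>] b \<open>i < n\<close> \<beta>(1)
      by (intro lin_dep_crit[of \<beta> \<beta> a "b i"]) (auto simp: bij_betw_def)
    then show False using li by simp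
  qed
  have inj: "inj_on \<psi> (vecs n)"
  proof
    fix u v assume uv: "u \<in> vecs n" "v \<in> vecs n" "\<psi> u = \<psi> v"
    have "\<psi> (u - v) \<oplus> \<psi> v = \<zero> \<oplus> \<psi> v" using \<psi>_add[of "u - v" v] uv(3) \<psi>C by simp
    then have "\<psi> (u - v) = \<zero>" using \<psi>C by (simp only: add.r_cancel zero_closed)
    then show "u = v" using kernel[of "u - v"] uv by (simp add: fv.subspace_diff subspace_vecs)
  qed
  define \<phi> where "\<phi> = inv_into (vecs n) \<psi>"
  have \<phi>\<psi>: "\<phi> (\<psi> v) = v" if "v \<in> vecs n" for v unfolding \<phi>_def by (rule inv_into_f_f[OF inj that])
  have \<psi>\<phi>: "\<psi> (\<phi> x) = x" "\<phi> x \<in> vecs n" if "x \<in> carrier L" for x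
    unfolding \<phi>_def using surj[OF that] by (auto intro: f_inv_into_f inv_into_into)
  have \<phi>_add: "\<phi> (x \<oplus> y) = \<phi> x + \<phi> y" if "x \<in> carrier L" "y \<in> carrier L" for x y
    using \<phi>\<psi>[of "\<phi> x + \<phi> y"] \<psi>\<phi>[OF that(1)] \<psi>\<phi>[OF that(2)] by (simp add: \<psi>_add fv.subspace_add subspace_vecs)
  have \<phi>_smul: "\<phi> (c \<odot> x) = smul c (\<phi> x)" if "x \<in> carrier L" for c x
    using \<phi>\<psi>[of "smul c (\<phi> x)"] \<psi>\<phi>[OF that] by (simp add: \<psi>_smul fv.subspace_scale subspace_vecs)
  \<comment> \<open>Truncation makes br bilinear on all sequences, although \<phi> inverts \<psi> on
    \<open>vecs n\<close> only.\<close>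
  define br where "br u v = \<phi> (\<psi> (trunc n u) \<otimes> \<psi> (trunc n v))" for u v
  have brC: "\<psi> u \<otimes> \<psi> v \<in> carrier L" for u v using bracket_closed \<psi>C by blast
  have image: "\<phi> ` carrier L = vecs n" using \<phi>\<psi> \<psi>\<phi> \<psi>C by (metis image_subset_iff imageI subsetI subset_antisym)
  have "coords L \<phi> br n"
  proof
    show "inj_on \<phi> (carrier L)" by (rule inj_onI) (metis \<psi>\<phi>(1))
    show "fv.subspace (\<phi> ` carrier L)" by (simp add: image subspace_vecs)
    show "bilin br" unfolding bilin_def br_def
      by (intro conjI allI linI) (simp_all add: lin_add[OF lin_trunc] lin_smul[OF lin_trunc] \<psi>_add \<psi>_smul
        bracket_add_left bracket_add_right bracket_smult_left bracket_smult_right \<psi>C \<phi>_add \<phi>_smul brC)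
    show "\<phi> \<zero> = 0" using \<phi>_smul[of \<zero> 0] by simp
    show "\<phi> (x \<otimes> y) = br (\<phi> x) (\<phi> y)" if "x \<in> carrier L" "y \<in> carrier L" for x y
      using that by (simp add: br_def trunc_id \<psi>\<phi>)
    show "br u v \<in> vecs n" for u v unfolding br_def by (rule \<psi>\<phi>(2)[OF brC])
    show "\<phi> ` carrier L = vecs n" by (rule image)
    show "c \<odot> x \<in> carrier L" if "x \<in> carrier L" for c x using smult_closed[of c x] that by simp
  qed (auto simp: \<phi>_add \<phi>_smul bracket_closed)
  moreover have "br u v = br (trunc n u) (trunc n v)" for u v by (simp add: br_def trunc_id)
  ultimately show ?thesis by blast
qed

text \<open>P = 1 - A B is a projection with kernel K. Its image W, in coordinates, is the quotient,
  and the chart of W gives the section \<sigma>.\<close>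

lemma (in coord_algebra) quotient_map:
  assumes K: "fv.subspace K" "K \<subseteq> vecs n"
  shows "\<exists>\<pi> \<sigma> m. lin \<pi> \<and> lin \<sigma> \<and> (\<forall>v. \<pi> v \<in> vecs m) \<and> (\<forall>w. \<sigma> w \<in> vecs n) \<and>
    (\<forall>w\<in>vecs m. \<pi> (\<sigma> w) = w) \<and> (\<forall>v\<in>vecs n. \<pi> v = 0 \<longleftrightarrow> v \<in> K)"
proof -
  obtain A B k where AB: "lin A" "lin B" "k \<le> n" "k = fv.dim K" "\<And>v. A v \<in> K" "\<And>v. B v \<in> vecs k"
    "\<And>v. v \<in> vecs k \<Longrightarrow> B (A v) = v" "\<And>w. w \<in> K \<Longrightarrow> A (B w) = w"
    using subspace_retract[OF K] by blast
  define P where "P = (\<lambda>v. v - A (B v))"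
  have P: "lin P" unfolding P_def by (rule lin_sub[OF lin_id lin_comp[OF AB(1,2)]])
  have PP: "P (P v) = P v" for v
    using AB(7)[OF AB(6)] by (simp add: P_def lin_diff AB(1,2) lin_0)
  have P0: "P v = 0 \<longleftrightarrow> v \<in> K" for v using AB(5,8) by (auto simp: P_def) (metis)
  define W where "W = P ` vecs n"
  have "P v \<in> vecs n" if "v \<in> vecs n" for v
    unfolding P_def using that AB(5) K(2) by (intro fv.subspace_diff[OF subspace_vecs]) auto
  then have W: "fv.subspace W" "W \<subseteq> vecs n" unfolding W_def by (auto intro: subspace_image P subspace_vecs)
  obtain A' B' m where AB': "lin A'" "lin B'" "m \<le> n" "m = fv.dim W" "\<And>v. A' v \<in> W" "\<And>v. B' v \<in> vecs m"
    "\<And>v. v \<in> vecs m \<Longrightarrow> B' (A' v) = v" "\<And>w. w \<in> W \<Longrightarrow> A' (B' w) = w"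
    using subspace_retract[OF W] by blast
  have PW: "P w = w" if "w \<in> W" for w using that PP by (auto simp: W_def)
  show ?thesis
  proof (intro exI conjI allI ballI)
    show "lin (\<lambda>v. B' (P v))" by (rule lin_comp[OF AB'(2) P])
    show "lin A'" by (rule AB')
    show "B' (P v) \<in> vecs m" for v by (rule AB')
    show "A' w \<in> vecs n" for w using AB'(5) W(2) by blast
    show "B' (P (A' w)) = w" if "w \<in> vecs m" for w using PW[OF AB'(5)] AB'(7)[OF that] by simp
    show "B' (P v) = 0 \<longleftrightarrow> v \<in> K" if "v \<in> vecs n" for v
    proof -
      have "P v \<in> W" using that by (simp add: W_def)
      then have "B' (P v) = 0 \<longleftrightarrow> P v = 0" using AB'(8)[of "P v"] lin_0[OF AB'(1)] lin_0[OF AB'(2)] by auto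
      then show ?thesis using P0 by simp
    qed
  qed
qed

text \<open>The bracket of the quotient is that of the representatives chosen by \<sigma>. A coset
  of J is a fibre of \<pi> after \<phi> on the carrier, denoted F, so each union over
  representatives in the quotient record is a union of equal sets.\<close>

lemma (in coords) quotient_coords:
  assumes J: "is_ideal M J"
  shows "\<exists>\<pi> \<phi>' br' m. lin \<pi> \<and> (\<forall>v. \<pi> v \<in> vecs m) \<and> (\<forall>w\<in>vecs m. \<exists>v\<in>vecs n. \<pi> v = w) \<and>
    (\<forall>v\<in>vecs n. \<pi> v = 0 \<longleftrightarrow> v \<in> \<phi> ` J) \<and> (\<forall>u\<in>vecs n. \<forall>v\<in>vecs n. \<pi> (br u v) = br' (\<pi> u) (\<pi> v)) \<and>
    (\<forall>u v. br' u v = br' (trunc m u) (trunc m v)) \<and> coords (quotient_algebra M J) \<phi>' br' m"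
proof -
  have JM: "J \<subseteq> carrier M" and Ji: "ideal_of (vecs n) (\<phi> ` J)" using J by (simp_all add: ideal_iff)
  obtain \<pi> \<sigma> m where *: "lin \<pi> \<and> lin \<sigma> \<and> (\<forall>v. \<pi> v \<in> vecs m) \<and> (\<forall>w. \<sigma> w \<in> vecs n) \<and>
      (\<forall>w\<in>vecs m. \<pi> (\<sigma> w) = w) \<and> (\<forall>v\<in>vecs n. \<pi> v = 0 \<longleftrightarrow> v \<in> \<phi> ` J)"
    using quotient_map[OF ideal_ofD(1,2)[OF Ji]] by (elim exE)
  then have \<pi>: "lin \<pi>" "\<And>v. \<pi> v \<in> vecs m" and \<sigma>: "lin \<sigma>" "\<And>w. \<sigma> w \<in> vecs n"
    and \<pi>\<sigma>: "\<And>w. w \<in> vecs m \<Longrightarrow> \<pi> (\<sigma> w) = w" and ker: "\<And>v. v \<in> vecs n \<Longrightarrow> \<pi> v = 0 \<longleftrightarrow> v \<in> \<phi> ` J"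
    by blast+
  define br' where "br' u v = \<pi> (br (\<sigma> (trunc m u)) (\<sigma> (trunc m v)))" for u v
  have bil: "bilin br'" unfolding bilin_def br'_def
    by (intro conjI allI linI) (simp_all add: lin_add lin_smul lin_trunc \<pi> \<sigma> br_simps)
  have \<pi>_br: "\<pi> (br u v) = br' (\<pi> u) (\<pi> v)" if uv: "u \<in> vecs n" "v \<in> vecs n" for u v
  proof -
    define u' v' where "u' = \<sigma> (\<pi> u)" and "v' = \<sigma> (\<pi> v)"
    have *: "u - u' \<in> \<phi> ` J" "v - v' \<in> \<phi> ` J" "u' \<in> vecs n" "v' \<in> vecs n"
      using uv ker[of "u - u'"] ker[of "v - v'"] \<sigma>(2) \<pi>\<sigma>[OF \<pi>(2)]
      by (simp_all add: u'_def v'_def lin_diff \<pi> fv.subspace_diff subspace_vecs)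
    have "br u v - br u' v' = br (u - u') v + br u' (v - v')" by (simp add: br_simps)
    also have "\<dots> \<in> \<phi> ` J"
      using * uv ideal_ofD[OF Ji] by (intro fv.subspace_add) auto
    finally have "\<pi> (br u v - br u' v') = 0"
      using ker[of "br u v - br u' v'"] by (simp add: fv.subspace_diff subspace_vecs br_vecs)
    then show ?thesis by (simp add: br'_def trunc_id \<pi> u'_def v'_def lin_diff)
  qed
  define F where "F x = {z \<in> carrier M. \<pi> (\<phi> z) = \<pi> (\<phi> x)}" for x
  have \<phi>n: "\<phi> x \<in> vecs n" if "x \<in> carrier M" for x using that image_carrier by blast
  have coset: "J +> x = F x" if x: "x \<in> carrier M" for x
  proof
    show "J +> x \<subseteq> F x"
    proof
      fix z assume "z \<in> J +> x"
      then obtain j where j: "j \<in> J" "z = j \<oplus> x" by (auto simp: a_r_coset_def')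
      then have jM: "j \<in> carrier M" using JM by blast
      then have "\<pi> (\<phi> j) = 0" using j ker[OF \<phi>n[OF jM]] by blast
      then show "z \<in> F x" using j jM x by (simp add: F_def add lin_add \<pi>)
    qed
    show "F x \<subseteq> J +> x"
    proof
      fix z assume z: "z \<in> F x"
      then have zM: "z \<in> carrier M" by (simp add: F_def)
      have "\<phi> z - \<phi> x \<in> \<phi> ` J"
        using ker[of "\<phi> z - \<phi> x"] z \<phi>n[OF zM] \<phi>n[OF x] by (simp add: F_def lin_diff \<pi> fv.subspace_diff subspace_vecs)
      then obtain j where j: "j \<in> J" "\<phi> z - \<phi> x = \<phi> j" by blast
      have "z = j \<oplus> x" using j JM x zM by (intro eqI) (auto simp: add diff_eq_eq)
      then show "z \<in> J +> x" using j by (auto simp: a_r_coset_def')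
    qed
  qed
  have F_self: "x \<in> F x" if "x \<in> carrier M" for x using that by (simp add: F_def)
  have F_eq: "F x = F y" if "\<pi> (\<phi> x) = \<pi> (\<phi> y)" for x y using that by (simp add: F_def)
  let ?Q = "quotient_algebra M J"
  have Q_carrier: "carrier ?Q = F ` carrier M"
    by (auto simp: quotient_algebra_def FactRing_def ring.defs module.defs A_RCOSETS_def' coset)
  have Q_zero: "\<zero>\<^bsub>?Q\<^esub> = F \<zero>"
  proof -
    have "\<zero>\<^bsub>?Q\<^esub> = J" by (simp add: quotient_algebra_def FactRing_def ring.defs module.defs)
    also have "J = F \<zero>"
    proof -
      have "\<pi> (\<phi> z) = 0 \<longleftrightarrow> z \<in> J" if "z \<in> carrier M" for z
        using ker[OF \<phi>n[OF that]] mem_image_iff[OF JM that] by simp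
      then show ?thesis using JM by (auto simp: F_def zero lin_0 \<pi>)
    qed
    finally show ?thesis .
  qed
  have Q_add: "F x \<oplus>\<^bsub>?Q\<^esub> F y = F (x \<oplus> y)" if xy: "x \<in> carrier M" "y \<in> carrier M" for x y
  proof -
    have "F x \<oplus>\<^bsub>?Q\<^esub> F y = F x <+> F y" by (simp add: quotient_algebra_def FactRing_def ring.defs module.defs)
    also have "\<dots> = F (x \<oplus> y)"
    proof
      show "F x <+> F y \<subseteq> F (x \<oplus> y)" using xy by (auto simp: set_add_def' F_def add lin_add \<pi>)
      show "F (x \<oplus> y) \<subseteq> F x <+> F y"
      proof
        fix z assume z: "z \<in> F (x \<oplus> y)"
        then have zM: "z \<in> carrier M" by (simp add: F_def)
        have "\<phi> z - \<phi> x \<in> vecs n" using \<phi>n zM xy by (simp add: fv.subspace_diff subspace_vecs)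
        then obtain k where k: "k \<in> carrier M" "\<phi> k = \<phi> z - \<phi> x" using image_carrier by (metis imageE)
        have "k \<in> F y" using k z xy by (simp add: F_def add lin_add lin_diff \<pi>)
        moreover have "z = x \<oplus> k" using k zM xy by (intro eqI) (auto simp: add)
        ultimately show "z \<in> F x <+> F y" using F_self[OF xy(1)] by (auto simp: set_add_def')
      qed
    qed
    finally show ?thesis .
  qed
  have Q_smult: "c \<odot>\<^bsub>?Q\<^esub> F x = F (c \<odot> x)" if x: "x \<in> carrier M" for c x
  proof -
    have "c \<odot>\<^bsub>?Q\<^esub> F x = (\<Union>a\<in>F x. J +> (c \<odot> a))"
      by (simp add: quotient_algebra_def FactRing_def ring.defs module.defs)
    also have "\<dots> = (\<Union>a\<in>F x. F (c \<odot> x))"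
    proof (rule SUP_cong[OF refl])
      fix a assume "a \<in> F x"
      then have a: "a \<in> carrier M" "\<pi> (\<phi> a) = \<pi> (\<phi> x)" by (simp_all add: F_def)
      show "J +> (c \<odot> a) = F (c \<odot> x)"
        using a x by (simp add: coset smult) (rule F_eq, simp add: smult lin_smul \<pi>)
    qed
    also have "\<dots> = F (c \<odot> x)" using F_self[OF x] by auto
    finally show ?thesis .
  qed
  have Q_mult: "F x \<otimes>\<^bsub>?Q\<^esub> F y = F (x \<otimes> y)" if xy: "x \<in> carrier M" "y \<in> carrier M" for x y
  proof -
    have "F x \<otimes>\<^bsub>?Q\<^esub> F y = (\<Union>a\<in>F x. \<Union>b\<in>F y. J +> (a \<otimes> b))"
      by (simp add: quotient_algebra_def FactRing_def ring.defs module.defs rcoset_mult_def)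
    also have "\<dots> = (\<Union>a\<in>F x. \<Union>b\<in>F y. F (x \<otimes> y))"
    proof (intro SUP_cong refl)
      fix a b assume "a \<in> F x" "b \<in> F y"
      then have a: "a \<in> carrier M" "\<pi> (\<phi> a) = \<pi> (\<phi> x)" "b \<in> carrier M" "\<pi> (\<phi> b) = \<pi> (\<phi> y)"
        by (simp_all add: F_def)
      show "J +> (a \<otimes> b) = F (x \<otimes> y)"
        using a xy by (simp add: coset mult) (rule F_eq, simp add: mult \<pi>_br \<phi>n)
    qed
    also have "\<dots> = F (x \<otimes> y)" using F_self xy by auto
    finally show ?thesis .
  qed
  \<comment> \<open>Any representative does, as \<pi> after \<phi> is constant on a coset.\<close>
  define \<phi>' where "\<phi>' A = \<pi> (\<phi> (SOME z. z \<in> A))" for A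
  have \<phi>'F: "\<phi>' (F x) = \<pi> (\<phi> x)" if x: "x \<in> carrier M" for x
  proof -
    have "(SOME z. z \<in> F x) \<in> F x" using F_self[OF x] by (rule someI)
    then show ?thesis by (simp add: \<phi>'_def F_def)
  qed
  have image: "\<phi>' ` carrier ?Q = vecs m"
  proof
    show "\<phi>' ` carrier ?Q \<subseteq> vecs m" by (auto simp: Q_carrier \<phi>'F \<pi>)
    show "vecs m \<subseteq> \<phi>' ` carrier ?Q"
    proof
      fix w :: "'f fvec" assume w: "w \<in> vecs m"
      have "\<sigma> w \<in> \<phi> ` carrier M" using \<sigma>(2) image_carrier by simp
      then obtain x where x: "x \<in> carrier M" "\<phi> x = \<sigma> w" by (metis imageE)
      then have "\<phi>' (F x) = w" using \<pi>\<sigma>[OF w] by (simp add: \<phi>'F)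
      then show "w \<in> \<phi>' ` carrier ?Q" using x(1) Q_carrier by blast
    qed
  qed
  have "coords ?Q \<phi>' br' m"
  proof
    show "inj_on \<phi>' (carrier ?Q)"
    proof (rule inj_onI)
      fix A B assume AB: "A \<in> carrier ?Q" "B \<in> carrier ?Q" "\<phi>' A = \<phi>' B"
      obtain x where x: "A = F x" "x \<in> carrier M" using AB(1) unfolding Q_carrier by blast
      obtain y where y: "B = F y" "y \<in> carrier M" using AB(2) unfolding Q_carrier by blast
      have "\<pi> (\<phi> x) = \<pi> (\<phi> y)" using AB(3) unfolding x(1) y(1) \<phi>'F[OF x(2)] \<phi>'F[OF y(2)] .
      then show "A = B" unfolding x(1) y(1) by (rule F_eq)
    qed
    show "fv.subspace (\<phi>' ` carrier ?Q)" by (simp add: image subspace_vecs)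
    show "bilin br'" by (rule bil)
    show "br' u v \<in> vecs m" for u v by (simp add: br'_def \<pi>)
    show "\<phi>' ` carrier ?Q = vecs m" by (rule image)
  qed (auto simp: Q_carrier Q_zero Q_add Q_smult Q_mult \<phi>'F zero add smult mult lin_0 lin_add lin_smul \<pi> \<pi>_br \<phi>n)
  moreover have "br' u v = br' (trunc m u) (trunc m v)" for u v by (simp add: br'_def trunc_id)
  moreover have "\<exists>v\<in>vecs n. \<pi> v = w" if "w \<in> vecs m" for w using \<pi>\<sigma>[OF that] \<sigma>(2) by blast
  ultimately show ?thesis using \<pi> ker \<pi>_br by blast
qed

theorem proposition2p14:
  fixes L :: "('f::field_char_0, 'a) module" and N I :: "'a set"
  assumes "symmetric_leibniz_algebra L"
    and "vectorspace.fin_dim class_ring L"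
    and "almost_reductive L"
    and "N = nilradical L"
    and "I = leibniz_kernel L"
    and "\<And>B. \<lbrakk>is_subalgebra (quotient_algebra L I) B;
               almost_algebraic ((quotient_algebra L I)\<lparr>carrier := B\<rparr>)\<rbrakk>
           \<Longrightarrow> phi_free ((quotient_algebra L I)\<lparr>carrier := B\<rparr>)"
  shows "frattini_ideal L = bracket_span L N N \<and> bracket_span L N N = I \<and> E_algebra L"
proof -
  interpret L: symmetric_leibniz_algebra L by (rule assms(1))
  obtain \<phi> br n where co: "coords L \<phi> br n" and tr: "\<And>u v. br u v = br (trunc n u) (trunc n v)"
    using exists_coords[OF L.bracket_algebra_axioms assms(2)] by blast
  interpret C: coords L \<phi> br n by (rule co)
  have obt: "\<exists>x\<in>carrier L. \<phi> x = trunc n u" for u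
    using C.image_carrier trunc_in_vecs by (metis imageE)
  \<comment> \<open>Each sequence is represented by the element with the truncated coordinates;
    \<open>tr1\<close> then removes the truncations.\<close>
  interpret CL: coord_leibniz n br
  proof
    fix u v w
    obtain x where x: "x \<in> carrier L" "\<phi> x = trunc n u" using obt[of u] by blast
    obtain y where y: "y \<in> carrier L" "\<phi> y = trunc n v" using obt[of v] by blast
    obtain z where z: "z \<in> carrier L" "\<phi> z = trunc n w" using obt[of w] by blast
    have tr1: "br (trunc n u) v = br u v" "br u (trunc n v) = br u v" for u v
      using tr[of "trunc n u" v] tr[of u "trunc n v"] tr[of u v] by (simp_all add: trunc_id)
    note mem = x(1) y(1) z(1) L.bracket_closed
    have "\<phi> (x \<otimes>\<^bsub>L\<^esub> (y \<otimes>\<^bsub>L\<^esub> z)) = \<phi> ((x \<otimes>\<^bsub>L\<^esub> y) \<otimes>\<^bsub>L\<^esub> z \<oplus>\<^bsub>L\<^esub> y \<otimes>\<^bsub>L\<^esub> (x \<otimes>\<^bsub>L\<^esub> z))"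
      using L.left_leibniz[OF x(1) y(1) z(1)] by simp
    then show "br u (br v w) = br (br u v) w + br v (br u w)"
      using mem by (simp add: C.mult C.add x(2) y(2) z(2) tr1)
    \<comment> \<open>The subtraction is first moved to the other side, because the rules for \<phi>
      are about sums.\<close>
    have "x \<otimes>\<^bsub>L\<^esub> (y \<otimes>\<^bsub>L\<^esub> z) \<oplus>\<^bsub>L\<^esub> (x \<otimes>\<^bsub>L\<^esub> z) \<otimes>\<^bsub>L\<^esub> y = (x \<otimes>\<^bsub>L\<^esub> y) \<otimes>\<^bsub>L\<^esub> z"
      using L.right_leibniz[OF x(1) y(1) z(1)] mem by (simp add: a_minus_def L.a_assoc L.l_neg)
    then have "\<phi> (x \<otimes>\<^bsub>L\<^esub> (y \<otimes>\<^bsub>L\<^esub> z) \<oplus>\<^bsub>L\<^esub> (x \<otimes>\<^bsub>L\<^esub> z) \<otimes>\<^bsub>L\<^esub> y) = \<phi> ((x \<otimes>\<^bsub>L\<^esub> y) \<otimes>\<^bsub>L\<^esub> z)" by simp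
    then have "br u (br v w) + br (br u w) v = br (br u v) w"
      using mem by (simp add: C.mult C.add x(2) y(2) z(2) tr1)
    then show "br u (br v w) = br (br u v) w - br (br u w) v" by (simp add: eq_diff_eq)
  qed
  have I: "\<phi> ` I = CL.square_span" "I \<subseteq> carrier L"
    using C.leibniz_kernel_image by (simp_all add: assms(5) CL.square_span_def)
  have Ideal: "is_ideal L I" using I CL.square_span_ideal by (simp add: C.ideal_iff)
  let ?Q = "quotient_algebra L I"
  obtain \<pi> \<phi>' br' m where q: "lin \<pi> \<and> (\<forall>v. \<pi> v \<in> vecs m) \<and> (\<forall>w\<in>vecs m. \<exists>v\<in>vecs n. \<pi> v = w) \<and>
    (\<forall>v\<in>vecs n. \<pi> v = 0 \<longleftrightarrow> v \<in> \<phi> ` I) \<and> (\<forall>u\<in>vecs n. \<forall>v\<in>vecs n. \<pi> (br u v) = br' (\<pi> u) (\<pi> v)) \<and>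
    (\<forall>u v. br' u v = br' (trunc m u) (trunc m v)) \<and> coords ?Q \<phi>' br' m"
    using C.quotient_coords[OF Ideal] by (elim exE)
  then have \<pi>: "lin \<pi>" "\<And>v. \<pi> v \<in> vecs m" "\<And>w. w \<in> vecs m \<Longrightarrow> \<exists>v\<in>vecs n. \<pi> v = w"
    "\<And>v. v \<in> vecs n \<Longrightarrow> \<pi> v = 0 \<longleftrightarrow> v \<in> \<phi> ` I" "\<And>u v. u \<in> vecs n \<Longrightarrow> v \<in> vecs n \<Longrightarrow> \<pi> (br u v) = br' (\<pi> u) (\<pi> v)"
    by blast+
  from q have tr': "br' u v = br' (trunc m u) (trunc m v)" for u v by (elim conjE allE)
  from q have co': "coords ?Q \<phi>' br' m" by (elim conjE)
  interpret Q: coords ?Q \<phi>' br' m by (rule co')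
  interpret Q: lie_coords ?Q \<phi>' br' m
  proof
    have obt': "\<exists>v\<in>vecs n. \<pi> v = trunc m u" for u using \<pi>(3) by simp
    have tr1: "br' (trunc m u) v = br' u v" "br' u (trunc m v) = br' u v" for u v
      using tr'[of "trunc m u" v] tr'[of u "trunc m v"] tr'[of u v] by (simp_all add: trunc_id)
    show "br' u u = 0" for u
    proof -
      obtain x where x: "x \<in> vecs n" "\<pi> x = trunc m u" using obt' by blast
      have "br' u u = \<pi> (br x x)" using \<pi>(5)[OF x(1) x(1)] by (simp add: x(2) tr1)
      also have "\<dots> = 0" using \<pi>(4)[OF C.br_vecs] CL.square_in[OF x(1)] I(1) by simp
      finally show ?thesis .
    qed
    show "br' u (br' v w) = br' (br' u v) w + br' v (br' u w)" for u v w
    proof -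
      obtain x where x: "x \<in> vecs n" "\<pi> x = trunc m u" using obt' by blast
      obtain y where y: "y \<in> vecs n" "\<pi> y = trunc m v" using obt' by blast
      obtain z where z: "z \<in> vecs n" "\<pi> z = trunc m w" using obt' by blast
      have "\<pi> (br x (br y z)) = \<pi> (br (br x y) z) + \<pi> (br y (br x z))"
        using CL.br_left_leibniz[of x y z] by (simp add: lin_add \<pi>)
      then show ?thesis using x y z C.br_vecs by (simp add: \<pi>(5) tr1)
    qed
  qed
  have nil_iff: "is_ideal L J \<and> nilpotent_algebra (L\<lparr>carrier := J\<rparr>) \<longleftrightarrow>
      J \<subseteq> carrier L \<and> C.ideal_of (vecs n) (\<phi> ` J) \<and> C.nilpotent_set (\<phi> ` J)" for J
    using C.ideal_iff C.nilpotent_algebra_iff C.ideal_is_subalgebra by blast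
  obtain J where J: "C.ideal_of (vecs n) J" "C.nilpotent_set J"
    "\<And>K. C.ideal_of (vecs n) K \<Longrightarrow> C.nilpotent_set K \<Longrightarrow> K \<subseteq> J"
    using CL.exists_greatest_nilpotent_ideal by blast
  have Jn: "\<phi> ` C.pull J = J" by (rule C.image_pull[OF C.ideal_ofD(2)[OF J(1)]])
  have "N = C.pull J"
    unfolding assms(4) nilradical_def nil_iff
  proof (rule Greatest_equality)
    show "C.pull J \<subseteq> carrier L \<and> C.ideal_of (vecs n) (\<phi> ` C.pull J) \<and> C.nilpotent_set (\<phi> ` C.pull J)"
      using J Jn C.pull_carrier by simp
    show "K \<subseteq> C.pull J" if "K \<subseteq> carrier L \<and> C.ideal_of (vecs n) (\<phi> ` K) \<and> C.nilpotent_set (\<phi> ` K)" for K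
      using that J(3)[of "\<phi> ` K"] by (auto simp: C.pull_def)
  qed
  then have N: "\<phi> ` N = J" "N \<subseteq> carrier L" using Jn C.pull_carrier by simp_all
  obtain \<Sigma> where \<Sigma>: "is_subalgebra L \<Sigma>" "N <+>\<^bsub>L\<^esub> \<Sigma> = carrier L" "N \<inter> \<Sigma> = {\<zero>\<^bsub>L\<^esub>}"
    "completely_reducible_bimodule L \<Sigma> N"
    using assms(3) unfolding almost_reductive_def assms(4) by blast
  have \<Sigma>C: "\<Sigma> \<subseteq> carrier L" using \<Sigma>(1) by (simp add: C.subalgebra_iff)
  interpret A: almost_reductive_leibniz n br m br' \<pi> "\<phi> ` N" "\<phi> ` \<Sigma>"
  proof
    show "\<exists>v\<in>vecs n. \<pi> v = w" if "w \<in> vecs m" for w using \<pi>(3) that .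
    show "\<pi> (br u v) = br' (\<pi> u) (\<pi> v)" if "u \<in> vecs n" "v \<in> vecs n" for u v using \<pi>(5) that .
    show "\<pi> v = 0 \<longleftrightarrow> v \<in> CL.square_span" if "v \<in> vecs n" for v using \<pi>(4)[OF that] I(1) by simp
    show "C.ideal_of (vecs n) (\<phi> ` N)" "C.nilpotent_set (\<phi> ` N)" using N(1) J by simp_all
    show "K \<subseteq> \<phi> ` N" if "C.ideal_of (vecs n) K" "C.nilpotent_set K" for K using N(1) J(3) that by simp
    show "C.subalg (\<phi> ` \<Sigma>)" using \<Sigma>(1) by (simp add: C.subalgebra_iff)
    show "\<exists>a\<in>\<phi> ` N. v - a \<in> \<phi> ` \<Sigma>" if v: "v \<in> vecs n" for v
    proof -
      obtain x where x: "x \<in> carrier L" "v = \<phi> x" using v C.image_carrier by blast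
      then have "x \<in> N <+>\<^bsub>L\<^esub> \<Sigma>" using \<Sigma>(2) by simp
      then obtain a s where as: "x = a \<oplus>\<^bsub>L\<^esub> s" "a \<in> N" "s \<in> \<Sigma>" by (auto simp: set_add_def')
      then have "a \<in> carrier L" "s \<in> carrier L" using N(2) \<Sigma>C by auto
      then have "v - \<phi> a = \<phi> s" by (simp add: x as C.add)
      then show ?thesis using as by auto
    qed
    show "\<phi> ` N \<inter> \<phi> ` \<Sigma> = {0}"
      using inj_on_image_Int[OF C.inj N(2) \<Sigma>C] \<Sigma>(3) C.zero(2) by simp
    show "\<exists>W'. C.sub_bimod (\<phi> ` \<Sigma>) W' \<and> W' \<subseteq> \<phi> ` N \<and> W \<inter> W' = {0} \<and> (\<forall>v\<in>\<phi> ` N. \<exists>w\<in>W. v - w \<in> W')"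
      if "C.sub_bimod (\<phi> ` \<Sigma>) W" "W \<subseteq> \<phi> ` N" for W
      by (rule C.completely_reducible_image[OF \<Sigma>C N(2) \<Sigma>(4) that])
    show "Q.frattini_free B" if B: "Q.subalg B" "Q.almost_alg B" for B
    proof -
      have im: "\<phi>' ` Q.pull B = B" by (rule Q.image_pull[OF Q.subalgD(2)[OF B(1)]])
      then have sub: "is_subalgebra ?Q (Q.pull B)" using B(1) by (simp add: Q.subalgebra_iff Q.pull_carrier)
      then have "almost_algebraic (?Q\<lparr>carrier := Q.pull B\<rparr>)"
        using Q.restrict_almost_algebraic B(2) im by simp
      then have "phi_free (?Q\<lparr>carrier := Q.pull B\<rparr>)" by (rule assms(6)[OF sub])
      then show ?thesis using Q.restrict_phi_free[OF sub] im by simp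
    qed
  qed (rule \<pi>(1), rule \<pi>(2))
  have NN: "bracket_span L N N = I"
  proof -
    note b = C.bracket_span_image[OF N(2) N(2)]
    have "\<phi> ` bracket_span L N N = \<phi> ` I" unfolding b(1) I(1) using A.square_span_derived by simp
    then show ?thesis using C.image_eq_iff'[OF b(2) I(2)] by blast
  qed
  \<comment> \<open>L counts among its subalgebras, so the statements about B also evaluate the
    Frattini ideal of L.\<close>
  have self: "is_subalgebra L (carrier L)" using C.subalg_vecs by (simp add: C.subalgebra_iff C.image_carrier)
  have frat: "frattini_ideal (L\<lparr>carrier := B\<rparr>) \<subseteq> I" if B: "is_subalgebra L B" for B
  proof -
    have "\<phi> ` frattini_ideal (L\<lparr>carrier := B\<rparr>) \<subseteq> \<phi> ` I"
      using A.frattini_square_span[OF _ C.restrict_frattini_ideal(2)[OF B]] B I(1) by (simp add: C.subalgebra_iff)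
    moreover have "frattini_ideal (L\<lparr>carrier := B\<rparr>) \<subseteq> carrier L"
      using C.restrict_frattini_ideal(1)[OF B] B by (auto simp: C.subalgebra_iff)
    ultimately show ?thesis using C.image_subset_iff' I(2) by blast
  qed
  have "\<phi> ` I \<subseteq> \<phi> ` frattini_ideal L"
    using C.restrict_frattini_ideal(3)[OF self] CL.square_span_frattini by (simp add: I C.image_carrier)
  moreover have "frattini_ideal L \<subseteq> I" using frat[OF self] by simp
  ultimately have "frattini_ideal L = I" using C.image_subset_iff' I(2) by blast
  then show ?thesis using NN frat by (simp add: E_algebra_def)
qed

end
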